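(* Let $J$ be a $\sigma$-invariant nilpotent subalgebra of $A$, let $P=1+J$, and let $\lambda\in C_J(\sigma)^\circ$. Then $$\sigma_\lambda(x)=\sum_{\mu\in\Omega_P(\lambda)}\mu(\Psi(x))$$ for all $x\in C_P(\sigma)$. In particular, $\sigma_\lambda$ has a constant value on each superclass of $C_P(\sigma)$.
   Context: Let $k$ be a finite field of odd characteristic $p$ and $A$ a finite-dimensional associative $k$-algebra with identity, endowed with an involution $\sigma$: an additive map $\sigma:A\to A$ with $\sigma(ab)=\sigma(b)\sigma(a)$ and $\sigma^2=\mathrm{id}$, such that $\sigma(k\cdot 1)=k\cdot 1$ ($\sigma$ need not be $k$-linear). A subalgebra of $A$ is a multiplicatively closed $k$-subspace (it need not contain $1$). For a $\sigma$-invariant nilpotent subalgebra $J$, $P=1+J$ is a finite $p$-group (an algebra group). The group $\langle\sigma\rangle$ acts on $P$ by $x^\sigma=\sigma(x^{-1})$ and on $J$ by $a^\sigma=-\sigma(a)$. Put $C_P(\sigma)=\{x\in P: x^\sigma=x\}$ and $C_J(\sigma)=\{a\in J:a^\sigma=a\}$. The Cayley transform $\Phi:J\to P$, $\Phi(a)=(1+a)(1-a)^{-1}$, is a bijection with inverse $\Psi(x)=(x-1)(x+1)^{-1}$. $J^\circ$ is the group of linear characters $\lambda:J^+\to\mathbb{C}^\times$ of the additive group of $J$. $P$ acts on $J^\circ$ on the left and on the right by $(x\lambda)(a)=\lambda(x^{-1}a)$, $(\lambda x)(a)=\lambda(ax^{-1})$. Put $\lambda^\sigma(a)=\lambda(a^\sigma)$.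 The dual group $C_J(\sigma)^\circ$ of $C_J(\sigma)^+$ is identified (via restriction) with $\{\lambda\in J^\circ:\lambda^\sigma=\lambda\}$. For $\lambda\in C_J(\sigma)^\circ$, $\Omega_P(\lambda)=\{\mu\in P\lambda P:\mu^\sigma=\mu\}$. For $\lambda\in J^\circ$ the supercharacter $\hat\xi_\lambda$ of $P$ is $\hat\xi_\lambda(x)=\frac{|P\lambda|}{|P\lambda P|}\sum_{\mu\in P\lambda P}\mu(\Psi(x))$, $x\in P$. $\mathrm{Irr}_\sigma(P)$ is the set of irreducible complex characters $\hat\chi$ of $P$ with $\hat\chi(x^\sigma)=\hat\chi(x)$ for all $x$. The Glauberman correspondence is the bijection $\pi_P:\mathrm{Irr}_\sigma(P)\to\mathrm{Irr}(C_P(\sigma))$ sending $\hat\chi$ to the unique irreducible constituent of the restriction $\hat\chi_{C_P(\sigma)}$ with odd multiplicity. For $\lambda\in C_J(\sigma)^\circ$, let $X(\lambda)=\{\pi_P(\hat\chi):\hat\chi\in\mathrm{Irr}_\sigma(P),\ \langle\hat\chi,\hat\xi_\lambda\rangle\ne0\}$ and $\sigma_\lambda=\sum_{\chi\in X(\lambda)}\chi(1)\chi$. A superclass of $P$ is a set $1+PaP$ with $a\in J$, where $PaP=\{xay:x,y\in P\}$; a superclass of $C_P(\sigma)$ is a non-empty intersection of a superclass of $P$ with $C_P(\sigma)$. *)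

theory Defs
  imports Complex_Main "HOL-Algebra.Group" "Jordan_Normal_Form.Matrix"
begin

section \<open>Complex characters of finite groups\<close>

text \<open>A matrix representation of degree \<open>n\<close> is a homomorphism into \<open>GL\<^sub>n(\<complex>)\<close>, the group of units
  of the ring of complex \<open>n \<times> n\<close> matrices.\<close>

definition is_rep :: "('g, 'm) monoid_scheme \<Rightarrow> nat \<Rightarrow> ('g \<Rightarrow> complex mat) \<Rightarrow> bool" where
  "is_rep G n \<rho> \<longleftrightarrow> \<rho> \<in> hom G (units_of (ring_mat TYPE(complex) n ()))"

definition vec_subspace :: "nat \<Rightarrow> complex vec set \<Rightarrow> bool" where
  "vec_subspace n W \<longleftrightarrow> W \<subseteq> carrier_vec n \<and> 0\<^sub>v n \<in> W
     \<and> (\<forall>v\<in>W. \<forall>w\<in>W. v + w \<in> W) \<and> (\<forall>c. \<forall>v\<in>W. c \<cdot>\<^sub>v v \<in> W)"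

definition irreducible_rep :: "('g, 'm) monoid_scheme \<Rightarrow> nat \<Rightarrow> ('g \<Rightarrow> complex mat) \<Rightarrow> bool" where
  "irreducible_rep G n \<rho> \<longleftrightarrow> is_rep G n \<rho> \<and> n > 0
     \<and> (\<forall>W. vec_subspace n W \<and> (\<forall>g\<in>carrier G. \<forall>w\<in>W. \<rho> g *\<^sub>v w \<in> W)
          \<longrightarrow> W = {0\<^sub>v n} \<or> W = carrier_vec n)"

text \<open>Functions on a group \<open>G\<close> (and, below, on the additive group of \<open>J\<close>) are extensional, so
  that distinct HOL functions are distinct as functions on the carrier.\<close>

definition rep_character ::
    "('g, 'm) monoid_scheme \<Rightarrow> nat \<Rightarrow> ('g \<Rightarrow> complex mat) \<Rightarrow> 'g \<Rightarrow> complex" where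
  "rep_character G n \<rho> = (\<lambda>g\<in>carrier G. \<Sum>i<n. \<rho> g $$ (i, i))"

definition Irr :: "('g, 'm) monoid_scheme \<Rightarrow> ('g \<Rightarrow> complex) set" where
  "Irr G = {rep_character G n \<rho> | n \<rho>. irreducible_rep G n \<rho>}"

definition char_inner ::
    "('g, 'm) monoid_scheme \<Rightarrow> ('g \<Rightarrow> complex) \<Rightarrow> ('g \<Rightarrow> complex) \<Rightarrow> complex" where
  "char_inner G \<phi> \<psi> = (\<Sum>g\<in>carrier G. \<phi> g * cnj (\<psi> g)) / of_nat (card (carrier G))"

text \<open>\<open>glauberman C \<chi>\<close>, for \<open>C\<close> the fixed-point subgroup: the unique irreducible constituent of the
  restriction of \<open>\<chi>\<close> to \<open>C\<close> whose multiplicity is odd.\<close>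

definition glauberman :: "('g, 'm) monoid_scheme \<Rightarrow> ('g \<Rightarrow> complex) \<Rightarrow> 'g \<Rightarrow> complex" where
  "glauberman C \<chi> = (THE \<psi>. \<psi> \<in> Irr C \<and>
     (\<exists>m::nat. odd m \<and> char_inner C (restrict \<chi> (carrier C)) \<psi> = of_nat m))"


section \<open>Algebras with involution\<close>

text \<open>The involution is not assumed to be linear over the field of scalars.\<close>

locale involutive_algebra = vector_space scale
  for scale :: "'k::{field,finite} \<Rightarrow> 'a::ring_1 \<Rightarrow> 'a" +
  fixes \<sigma> :: "'a \<Rightarrow> 'a"
  assumes odd_char: "odd CHAR('k)"
    and scale_mult_left: "scale c a * b = scale c (a * b)"
    and scale_mult_right: "a * scale c b = scale c (a * b)"
    and finite_dim: "\<exists>B. finite B \<and> span B = UNIV"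
    and involution_add: "\<sigma> (a + b) = \<sigma> a + \<sigma> b"
    and involution_mult: "\<sigma> (a * b) = \<sigma> b * \<sigma> a"
    and involution_involution: "\<sigma> (\<sigma> a) = a"
    and involution_scalars: "\<sigma> ` range (\<lambda>c. scale c 1) = range (\<lambda>c. scale c 1)"

definition nilpotent_subalgebra :: "('k::field \<Rightarrow> 'a::ring_1 \<Rightarrow> 'a) \<Rightarrow> 'a set \<Rightarrow> bool" where
  "nilpotent_subalgebra scale J \<longleftrightarrow> module.subspace scale J
     \<and> (\<forall>a\<in>J. \<forall>b\<in>J. a * b \<in> J)
     \<and> (\<exists>n>0. \<forall>as. length as = n \<and> set as \<subseteq> J \<longrightarrow> prod_list as = 0)"

definition mult_monoid :: "'a::monoid_mult monoid" where
  "mult_monoid = \<lparr>carrier = UNIV, monoid.mult = (*), one = 1\<rparr>"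

abbreviation minv :: "'a::monoid_mult \<Rightarrow> 'a" where
  "minv x \<equiv> inv\<^bsub>mult_monoid\<^esub> x"

definition algebra_group :: "'a::ring_1 set \<Rightarrow> 'a monoid" where
  "algebra_group J = mult_monoid\<lparr>carrier := (\<lambda>a. 1 + a) ` J\<rparr>"

definition group_act :: "('a::ring_1 \<Rightarrow> 'a) \<Rightarrow> 'a \<Rightarrow> 'a" where
  "group_act \<sigma> x = \<sigma> (minv x)"

definition alg_act :: "('a::ring_1 \<Rightarrow> 'a) \<Rightarrow> 'a \<Rightarrow> 'a" where
  "alg_act \<sigma> a = - \<sigma> a"

definition fixed_group :: "('a::ring_1 \<Rightarrow> 'a) \<Rightarrow> 'a set \<Rightarrow> 'a monoid" where
  "fixed_group \<sigma> J = mult_monoid\<lparr>carrier := {x \<in> carrier (algebra_group J). group_act \<sigma> x = x}\<rparr>"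

text \<open>The inverse of the Cayley transform \<open>a \<mapsto> (1 + a)(1 - a)\<^sup>-\<^sup>1\<close>.\<close>

definition inv_cayley :: "'a::ring_1 \<Rightarrow> 'a" where
  "inv_cayley x = (x - 1) * minv (x + 1)"


section \<open>Linear characters of the additive group\<close>

definition dual :: "'a::ring_1 set \<Rightarrow> ('a \<Rightarrow> complex) set" where
  "dual J = {\<theta> \<in> extensional J. (\<forall>a\<in>J. \<theta> a \<noteq> 0) \<and> (\<forall>a\<in>J. \<forall>b\<in>J. \<theta> (a + b) = \<theta> a * \<theta> b)}"

definition left_act :: "'a::ring_1 set \<Rightarrow> 'a \<Rightarrow> ('a \<Rightarrow> complex) \<Rightarrow> 'a \<Rightarrow> complex" where
  "left_act J x \<theta> = (\<lambda>a\<in>J. \<theta> (minv x * a))"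

definition right_act :: "'a::ring_1 set \<Rightarrow> ('a \<Rightarrow> complex) \<Rightarrow> 'a \<Rightarrow> 'a \<Rightarrow> complex" where
  "right_act J \<theta> x = (\<lambda>a\<in>J. \<theta> (a * minv x))"

definition left_orbit :: "'a::ring_1 set \<Rightarrow> ('a \<Rightarrow> complex) \<Rightarrow> ('a \<Rightarrow> complex) set" where
  "left_orbit J \<theta> = {left_act J x \<theta> | x. x \<in> carrier (algebra_group J)}"

definition two_sided_orbit :: "'a::ring_1 set \<Rightarrow> ('a \<Rightarrow> complex) \<Rightarrow> ('a \<Rightarrow> complex) set" where
  "two_sided_orbit J \<theta> = {right_act J (left_act J x \<theta>) y | x y.
     x \<in> carrier (algebra_group J) \<and> y \<in> carrier (algebra_group J)}"

definition dual_act :: "('a::ring_1 \<Rightarrow> 'a) \<Rightarrow> 'a set \<Rightarrow> ('a \<Rightarrow> complex) \<Rightarrow> 'a \<Rightarrow> complex" where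
  "dual_act \<sigma> J \<theta> = (\<lambda>a\<in>J. \<theta> (alg_act \<sigma> a))"

text \<open>The linear characters of \<open>J\<close> fixed by \<open>\<sigma>\<close>; restriction identifies them with the linear
  characters of the additive group of the \<open>\<sigma>\<close>-fixed points of \<open>J\<close>.\<close>

definition fixed_dual :: "('a::ring_1 \<Rightarrow> 'a) \<Rightarrow> 'a set \<Rightarrow> ('a \<Rightarrow> complex) set" where
  "fixed_dual \<sigma> J = {\<theta> \<in> dual J. dual_act \<sigma> J \<theta> = \<theta>}"

definition Omega ::
    "('a::ring_1 \<Rightarrow> 'a) \<Rightarrow> 'a set \<Rightarrow> ('a \<Rightarrow> complex) \<Rightarrow> ('a \<Rightarrow> complex) set" where
  "Omega \<sigma> J \<theta> = {\<mu> \<in> two_sided_orbit J \<theta>. dual_act \<sigma> J \<mu> = \<mu>}"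


section \<open>Supercharacters and superclasses\<close>

definition supercharacter :: "'a::ring_1 set \<Rightarrow> ('a \<Rightarrow> complex) \<Rightarrow> 'a \<Rightarrow> complex" where
  "supercharacter J \<theta> = (\<lambda>x\<in>carrier (algebra_group J).
     of_nat (card (left_orbit J \<theta>)) / of_nat (card (two_sided_orbit J \<theta>))
       * (\<Sum>\<mu>\<in>two_sided_orbit J \<theta>. \<mu> (inv_cayley x)))"

definition invariant_Irr :: "('a::ring_1 \<Rightarrow> 'a) \<Rightarrow> 'a set \<Rightarrow> ('a \<Rightarrow> complex) set" where
  "invariant_Irr \<sigma> J = {\<chi> \<in> Irr (algebra_group J).
     \<forall>x\<in>carrier (algebra_group J). \<chi> (group_act \<sigma> x) = \<chi> x}"

definition glauberman_constituents ::
    "('a::ring_1 \<Rightarrow> 'a) \<Rightarrow> 'a set \<Rightarrow> ('a \<Rightarrow> complex) \<Rightarrow> ('a \<Rightarrow> complex) set" where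
  "glauberman_constituents \<sigma> J \<theta> = {glauberman (fixed_group \<sigma> J) \<chi> | \<chi>.
     \<chi> \<in> invariant_Irr \<sigma> J \<and> char_inner (algebra_group J) \<chi> (supercharacter J \<theta>) \<noteq> 0}"

definition sigma_character ::
    "('a::ring_1 \<Rightarrow> 'a) \<Rightarrow> 'a set \<Rightarrow> ('a \<Rightarrow> complex) \<Rightarrow> 'a \<Rightarrow> complex" where
  "sigma_character \<sigma> J \<theta> = (\<lambda>x\<in>carrier (fixed_group \<sigma> J).
     \<Sum>\<chi>\<in>glauberman_constituents \<sigma> J \<theta>. \<chi> 1 * \<chi> x)"

definition superclasses :: "'a::ring_1 set \<Rightarrow> 'a set set" where
  "superclasses J = {{1 + x * a * y | x y. x \<in> carrier (algebra_group J) \<and> y \<in> carrier (algebra_group J)}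
     | a. a \<in> J}"

definition fixed_superclasses :: "('a::ring_1 \<Rightarrow> 'a) \<Rightarrow> 'a set \<Rightarrow> 'a set set" where
  "fixed_superclasses \<sigma> J =
     {K \<inter> carrier (fixed_group \<sigma> J) | K. K \<in> superclasses J \<and> K \<inter> carrier (fixed_group \<sigma> J) \<noteq> {}}"

end

(*
  For a sigma-invariant irreducible character chi of P choose an involution S intertwining the
  representation rho with its twist by sigma.  Then c |-> tr (rho(c) S) is, up to sign, the Glauberman
  correspondent of chi, and Schur's lemma turns the product of its values at 1 and c into
  chi(1)/|P| * sum_x chi(c x^sigma x^-1), a sum which vanishes for non-invariant chi.  The orbit sum
  f = sum_{mu in P lambda P} mu(Psi(.)) satisfies f * f = |P| f, so f is the sum of chi(1) chi over the
  constituents chi of the supercharacter, and sigma_lambda(c) = 1/|P| * sum_x f(c x^sigma x^-1).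
  Here x^sigma x^-1 runs uniformly through the elements y = 1 + b with sigma(b) = b, and summing f(c y)
  over these b leaves exactly those mu that are trivial on the sigma-symmetric part of J, that is,
  the sigma-fixed ones.
*)
theory Submission
  imports Defs "Jordan_Normal_Form.Spectral_Radius" "HOL-Library.Function_Algebras"
    "HOL-Algebra.Multiplicative_Group"
begin

section \<open>Representations and Schur orthogonality\<close>

text \<open>Odd order of P enters through unique square roots. They make every twisted class, the
  set of all y x (y^sigma)^-1, meet C_P(sigma) in a single conjugacy class of C_P(sigma), so that
  sums of twisted class functions over P reduce to sums over C_P(sigma). Hence c |-> tr (rho(c) S)
  has norm 1 there. As S^2 = 1, its coefficients are differences of the multiplicities in the two
  eigenspaces of S, so they are integers congruent modulo 2 to the multiplicities in the restriction
  of chi. Norm 1 leaves one coefficient, 1 or -1, and its character is the only constituent of odd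
  multiplicity, as the description in \<open>glauberman\<close> demands. The same orthogonality
  makes the correspondence injective, so the sum over the set X(lambda) is a sum over characters of
  P. On the other side, Psi(x) = a (1 + a)^-1 with a = (x - 1)/2, and orbit sums ignore factors from
  P; so Psi gives way to the affine map x |-> (x - 1)/2, and convolution on P becomes additive
  convolution on J. Square roots also show that two sigma-skew elements of one two-sided orbit are
  related by a |-> z a sigma(z), which settles superclasses.\<close>

definition tr :: "complex mat \<Rightarrow> complex" where
  "tr A = (\<Sum>i<dim_row A. A $$ (i, i))"

lemma mat_mult_entry:
  fixes A B :: "complex mat"
  assumes "A \<in> carrier_mat n m" "B \<in> carrier_mat m k" "i < n" "j < k"
  shows "(A * B) $$ (i, j) = (\<Sum>l<m. A $$ (i, l) * B $$ (l, j))"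
  using assms by (auto simp: scalar_prod_def lessThan_atLeast0)

lemma mat_vec_entry:
  fixes A :: "complex mat"
  assumes "A \<in> carrier_mat n m" "v \<in> carrier_vec m" "i < n"
  shows "(A *\<^sub>v v) $ i = (\<Sum>l<m. A $$ (i, l) * v $ l)"
  using assms by (auto simp: scalar_prod_def lessThan_atLeast0)

lemma mat_unit_vec_entry:
  fixes A :: "complex mat"
  assumes "A \<in> carrier_mat n m" "i < n" "j < m"
  shows "(A *\<^sub>v unit_vec m j) $ i = A $$ (i, j)"
proof -
  have "(A *\<^sub>v unit_vec m j) $ i = (\<Sum>l<m. A $$ (i, l) * unit_vec m j $ l)"
    by (rule mat_vec_entry[OF assms(1) unit_vec_carrier assms(2)])
  also have "\<dots> = (\<Sum>l<m. if l = j then A $$ (i, l) else 0)"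
    using assms by (intro sum.cong) auto
  finally show ?thesis using assms by simp
qed

lemma tr_carrier: "A \<in> carrier_mat n n \<Longrightarrow> tr A = (\<Sum>i<n. A $$ (i, i))"
  by (auto simp: tr_def)

lemma tr_mult:
  assumes "A \<in> carrier_mat n m" "B \<in> carrier_mat m n"
  shows "tr (A * B) = (\<Sum>i<n. \<Sum>j<m. A $$ (i, j) * B $$ (j, i))"
proof -
  have "A * B \<in> carrier_mat n n" using assms by simp
  then show ?thesis
    unfolding tr_carrier[OF \<open>A * B \<in> carrier_mat n n\<close>]
    by (intro sum.cong refl mat_mult_entry[OF assms]) auto
qed

lemma tr_comm:
  assumes "A \<in> carrier_mat n m" "B \<in> carrier_mat m n"
  shows "tr (A * B) = tr (B * A)"
  unfolding tr_mult[OF assms] tr_mult[OF assms(2,1)]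
  by (subst sum.swap) (simp add: mult.commute)

lemma tr_one: "tr (1\<^sub>m n) = of_nat n"
  by (simp add: tr_def)

lemma tr_smult: "A \<in> carrier_mat n n \<Longrightarrow> tr (c \<cdot>\<^sub>m A) = c * tr A"
  by (auto simp: tr_def sum_distrib_left)

text \<open>Evaluates the inner sum when Schur orthogonality leaves a product of two Kronecker
  deltas; \<open>P\<close> carries the outer one.\<close>

lemma sum_delta_conj:
  fixes c :: complex and a n :: nat
  assumes "a < n"
  shows "(\<Sum>b<n. u b * (if P \<and> a = b then c else 0)) = (if P then u a * c else 0)"
proof -
  have "(\<Sum>b<n. u b * (if P \<and> a = b then c else 0)) = (\<Sum>b<n. if a = b then if P then u b * c else 0 else 0)"
    by (intro sum.cong) auto
  then show ?thesis using assms by (simp add: sum.delta')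
qed

lemma sum_rotate3:
  "(\<Sum>l\<in>A. \<Sum>g\<in>B. \<Sum>k\<in>C. F l g k) = (\<Sum>g\<in>B. \<Sum>k\<in>C. \<Sum>l\<in>A. F l g k)"
  by (subst sum.swap, intro sum.cong refl, rule sum.swap)

section \<open>Finite groups and their matrix representations\<close>

locale fin_group = group G for G (structure) +
  assumes finite_carrier: "finite (carrier G)"
begin

lemma card_pos: "card (carrier G) > 0"
  using finite_carrier one_closed by (auto simp: card_gt_0_iff)

text \<open>Invertibility of \<open>\<rho> g\<close> comes from \<open>\<rho> (inv g)\<close>, so a
  homomorphism into the units amounts to equations between square matrices, the form used
  throughout.\<close>

lemma is_rep_iff:
  "is_rep G n \<rho> \<longleftrightarrow> (\<forall>g\<in>carrier G. \<rho> g \<in> carrier_mat n n)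
     \<and> (\<forall>g\<in>carrier G. \<forall>h\<in>carrier G. \<rho> (g \<otimes> h) = \<rho> g * \<rho> h) \<and> \<rho> \<one> = 1\<^sub>m n" (is "?l \<longleftrightarrow> ?r")
proof -
  let ?R = "ring_mat TYPE(complex) n ()"
  interpret R: ring ?R by (rule ring_mat)
  show ?thesis
  proof
    assume ?l
    then have h: "\<rho> \<in> hom G (units_of ?R)" by (simp add: is_rep_def)
    have "\<rho> \<one> = \<one>\<^bsub>units_of ?R\<^esub>"
      using hom_one[OF h is_group R.units_group] .
    moreover have "\<rho> g \<in> Units ?R" if "g \<in> carrier G" for g
      using hom_in_carrier[OF h that] by (simp add: units_of_def)
    moreover have "\<rho> (g \<otimes> k) = \<rho> g * \<rho> k" if "g \<in> carrier G" "k \<in> carrier G" for g k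
      using hom_mult[OF h that] by (simp add: units_of_def ring_mat_def)
    ultimately show ?r by (auto simp: units_of_def Units_def ring_mat_def)
  next
    assume r: ?r
    have "\<rho> g \<in> Units ?R" if g: "g \<in> carrier G" for g
    proof -
      have "\<rho> g * \<rho> (inv g) = 1\<^sub>m n" "\<rho> (inv g) * \<rho> g = 1\<^sub>m n"
        using r g by (metis inv_closed r_inv, metis inv_closed l_inv)
      then show ?thesis
        using r g unfolding Units_def ring_mat_def by auto
    qed
    then show ?l using r by (auto simp: is_rep_def hom_def units_of_def ring_mat_def)
  qed
qed

lemma rep_carrier: "is_rep G n \<rho> \<Longrightarrow> g \<in> carrier G \<Longrightarrow> \<rho> g \<in> carrier_mat n n"
  and rep_mult: "is_rep G n \<rho> \<Longrightarrow> g \<in> carrier G \<Longrightarrow> h \<in> carrier G \<Longrightarrow> \<rho> (g \<otimes> h) = \<rho> g * \<rho> h"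
  and rep_one: "is_rep G n \<rho> \<Longrightarrow> \<rho> \<one> = 1\<^sub>m n"
  by (auto simp: is_rep_iff)

lemma rep_mult_entry:
  assumes "is_rep G n \<rho>" "g \<in> carrier G" "h \<in> carrier G" "i < n" "j < n"
  shows "\<rho> (g \<otimes> h) $$ (i, j) = (\<Sum>k<n. \<rho> g $$ (i, k) * \<rho> h $$ (k, j))"
  unfolding rep_mult[OF assms(1-3)]
  by (rule mat_mult_entry) (use assms rep_carrier in auto)

lemma irreducible_is_rep: "irreducible_rep G n \<rho> \<Longrightarrow> is_rep G n \<rho>"
  and irreducible_pos: "irreducible_rep G n \<rho> \<Longrightarrow> n > 0"
  by (auto simp: irreducible_rep_def)

lemma rep_character_eq: "is_rep G n \<rho> \<Longrightarrow> g \<in> carrier G \<Longrightarrow> rep_character G n \<rho> g = tr (\<rho> g)"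
  using rep_carrier[of n \<rho> g] by (simp add: rep_character_def tr_carrier)

lemma rep_character_one: "is_rep G n \<rho> \<Longrightarrow> rep_character G n \<rho> \<one> = of_nat n"
  by (simp add: rep_character_eq rep_one tr_one)

lemma inv_cancel:
  assumes "x \<in> carrier G" "y \<in> carrier G"
  shows "inv x \<otimes> (x \<otimes> y) = y" "x \<otimes> (inv x \<otimes> y) = y"
  using assms by (simp_all add: m_assoc[symmetric])

lemma sum_left_translate:
  assumes "h \<in> carrier G"
  shows "(\<Sum>g\<in>carrier G. F (h \<otimes> g)) = (\<Sum>g\<in>carrier G. F g)"
  by (rule sum.reindex_bij_witness[of _ "\<lambda>g. inv h \<otimes> g" "\<lambda>g. h \<otimes> g"])
     (use assms in \<open>auto simp: m_assoc[symmetric]\<close>)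

lemma sum_right_translate:
  assumes "h \<in> carrier G"
  shows "(\<Sum>g\<in>carrier G. F (g \<otimes> h)) = (\<Sum>g\<in>carrier G. F g)"
  by (rule sum.reindex_bij_witness[of _ "\<lambda>g. g \<otimes> inv h" "\<lambda>g. g \<otimes> h"])
     (use assms in \<open>auto simp: m_assoc\<close>)

section \<open>Schur's lemma and orthogonality of matrix coefficients\<close>

lemma schur_inverse:
  assumes irr: "irreducible_rep G n \<rho>" "irreducible_rep G m \<tau>"
    and M: "M \<in> carrier_mat n m" "\<And>g. g \<in> carrier G \<Longrightarrow> \<rho> g * M = M * \<tau> g" "M \<noteq> 0\<^sub>m n m"
  obtains R where "R \<in> carrier_mat m n" "M * R = 1\<^sub>m n" "R * M = 1\<^sub>m m"
proof -
  note rep = irr[THEN irreducible_is_rep]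
  note car = rep_carrier[OF rep(1)] rep_carrier[OF rep(2)]
  have colM: "M *\<^sub>v unit_vec m j = col M j" if "j < m" for j
    using that M(1) by (intro eq_vecI) (auto simp: mat_vec_entry)
  \<comment> \<open>Kernel and image of \<open>M\<close> are invariant subspaces, so irreducibility
    makes \<open>M\<close> injective and surjective. The degrees \<open>n\<close> and
    \<open>m\<close> may differ a priori, hence each of the two inverse equations gets its own
    argument.\<close>
  define K where "K = {v \<in> carrier_vec m. M *\<^sub>v v = 0\<^sub>v n}"
  have "vec_subspace m K"
    using M(1) unfolding vec_subspace_def K_def
    by (auto simp: mult_add_distrib_mat_vec[of _ n m] mult_mat_vec[of _ n m])
  moreover have "\<tau> g *\<^sub>v v \<in> K" if g: "g \<in> carrier G" and v: "v \<in> K" for g v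
  proof -
    have "M *\<^sub>v (\<tau> g *\<^sub>v v) = (M * \<tau> g) *\<^sub>v v"
      using M(1) car(2)[OF g] v by (simp add: K_def assoc_mult_mat_vec[of _ n m])
    also have "\<dots> = \<rho> g *\<^sub>v (M *\<^sub>v v)"
      using M(1) car(1)[OF g] v by (simp add: K_def M(2)[OF g, symmetric] assoc_mult_mat_vec[of _ n n])
    also have "\<dots> = 0\<^sub>v n" using v car(1)[OF g] by (auto simp: K_def)
    finally show ?thesis using car(2)[OF g] v by (auto simp: K_def)
  qed
  ultimately have "K = {0\<^sub>v m} \<or> K = carrier_vec m"
    using irr(2) by (auto simp: irreducible_rep_def)
  moreover have "K \<noteq> carrier_vec m"
  proof
    assume "K = carrier_vec m"
    then have "unit_vec m j \<in> K" for j by simp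
    then have "col M j = 0\<^sub>v n" if "j < m" for j
      using colM[OF that] by (simp add: K_def)
    then have "M = 0\<^sub>m n m"
      using M(1) by (intro eq_matI) (auto, metis index_col index_zero_vec(1) carrier_matD)
    with M(3) show False ..
  qed
  ultimately have K0: "K = {0\<^sub>v m}" by blast
  define I where "I = (\<lambda>v. M *\<^sub>v v) ` carrier_vec m"
  have "vec_subspace n I"
    unfolding vec_subspace_def
  proof (intro conjI ballI allI)
    show "I \<subseteq> carrier_vec n" using M(1) by (auto simp: I_def)
    show "0\<^sub>v n \<in> I" unfolding I_def
      by (rule image_eqI[of _ _ "0\<^sub>v m"]) (use M(1) in auto)
    show "v + w \<in> I" if "v \<in> I" "w \<in> I" for v w
    proof -
      from that obtain a b where ab: "v = M *\<^sub>v a" "w = M *\<^sub>v b" "a \<in> carrier_vec m" "b \<in> carrier_vec m"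
        by (auto simp: I_def)
      show ?thesis unfolding I_def
        by (rule image_eqI[of _ _ "a + b"]) (use ab M(1) in \<open>auto simp: mult_add_distrib_mat_vec[of _ n m]\<close>)
    qed
    show "c \<cdot>\<^sub>v v \<in> I" if "v \<in> I" for c v
    proof -
      from that obtain a where a: "v = M *\<^sub>v a" "a \<in> carrier_vec m"
        by (auto simp: I_def)
      show ?thesis unfolding I_def
        by (rule image_eqI[of _ _ "c \<cdot>\<^sub>v a"]) (use a M(1) in \<open>auto simp: mult_mat_vec[of _ n m]\<close>)
    qed
  qed
  moreover have "\<rho> g *\<^sub>v v \<in> I" if g: "g \<in> carrier G" and v: "v \<in> I" for g v
  proof -
    from v obtain a where a: "v = M *\<^sub>v a" "a \<in> carrier_vec m"
      by (auto simp: I_def)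
    have "\<rho> g *\<^sub>v v = (\<rho> g * M) *\<^sub>v a"
      using M(1) car(1)[OF g] a by (simp add: assoc_mult_mat_vec[of _ n n])
    also have "\<dots> = M *\<^sub>v (\<tau> g *\<^sub>v a)"
      using M(1) car(2)[OF g] a by (simp add: M(2)[OF g] assoc_mult_mat_vec[of _ n m])
    finally show ?thesis unfolding I_def using car(2)[OF g] a by auto
  qed
  ultimately have "I = {0\<^sub>v n} \<or> I = carrier_vec n"
    using irr(1) by (auto simp: irreducible_rep_def)
  moreover have "I \<noteq> {0\<^sub>v n}"
  proof
    assume "I = {0\<^sub>v n}"
    then have "K = carrier_vec m" by (auto simp: I_def K_def)
    with \<open>K \<noteq> carrier_vec m\<close> show False ..
  qed
  ultimately have "I = carrier_vec n" by blast
  \<comment> \<open>The columns of a right inverse are preimages of the unit vectors.\<close>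
  then have "\<forall>i<n. \<exists>r. r \<in> carrier_vec m \<and> M *\<^sub>v r = unit_vec n i"
    unfolding I_def by (metis imageE unit_vec_carrier)
  then obtain r where r: "\<And>i. i < n \<Longrightarrow> r i \<in> carrier_vec m" "\<And>i. i < n \<Longrightarrow> M *\<^sub>v r i = unit_vec n i"
    by metis
  define R where "R = mat m n (\<lambda>(k, i). r i $ k)"
  have R: "R \<in> carrier_mat m n" by (simp add: R_def)
  have MR: "M * R = 1\<^sub>m n"
  proof (rule eq_matI)
    fix i j assume ij: "i < dim_row (1\<^sub>m n)" "j < dim_col (1\<^sub>m n :: complex mat)"
    then have "(M * R) $$ (i, j) = (\<Sum>l<m. M $$ (i, l) * R $$ (l, j))"
      using mat_mult_entry[OF M(1) R] by simp
    also have "\<dots> = (\<Sum>l<m. M $$ (i, l) * r j $ l)" using ij by (simp add: R_def)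
    also have "\<dots> = (M *\<^sub>v r j) $ i" using mat_vec_entry[OF M(1) r(1)[of j], of i] ij by simp
    also have "\<dots> = unit_vec n j $ i" using r(2) ij by simp
    finally show "(M * R) $$ (i, j) = 1\<^sub>m n $$ (i, j)" using ij by auto
  qed (use M R in auto)
  \<comment> \<open>The right inverse is also a left inverse, because \<open>R (M v) - v\<close>
    lies in the trivial kernel of \<open>M\<close>.\<close>
  have "R *\<^sub>v (M *\<^sub>v v) = v" if v: "v \<in> carrier_vec m" for v
  proof -
    have Mv: "M *\<^sub>v v \<in> carrier_vec n" using M(1) v by auto
    have c: "R *\<^sub>v (M *\<^sub>v v) \<in> carrier_vec m" using R Mv by auto
    have "M *\<^sub>v (R *\<^sub>v (M *\<^sub>v v)) = M *\<^sub>v v"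
      using assoc_mult_mat_vec[OF M(1) R Mv] MR Mv by simp
    then have "M *\<^sub>v (R *\<^sub>v (M *\<^sub>v v) - v) = 0\<^sub>v n"
      using mult_minus_distrib_mat_vec[OF M(1) c v] Mv by simp
    then have "R *\<^sub>v (M *\<^sub>v v) - v \<in> K" using c v by (auto simp: K_def)
    then have z: "R *\<^sub>v (M *\<^sub>v v) - v = 0\<^sub>v m" using K0 by simp
    show ?thesis
    proof (rule eq_vecI)
      fix i assume "i < dim_vec v"
      then have i: "i < m" using v by simp
      have "(R *\<^sub>v (M *\<^sub>v v) - v) $ i = 0" using z i by simp
      then show "(R *\<^sub>v (M *\<^sub>v v)) $ i = v $ i" using i c v by simp
    qed (use c v R in auto)
  qed
  then have rm: "(R * M) *\<^sub>v v = v" if "v \<in> carrier_vec m" for v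
    using assoc_mult_mat_vec[OF R M(1) that] that by simp
  have RMc: "R * M \<in> carrier_mat m m" using R M by simp
  have RM: "R * M = 1\<^sub>m m"
  proof (rule eq_matI)
    fix i j assume ij: "i < dim_row (1\<^sub>m m)" "j < dim_col (1\<^sub>m m :: complex mat)"
    have "((R * M) *\<^sub>v unit_vec m j) $ i = (\<Sum>l<m. (R * M) $$ (i, l) * unit_vec m j $ l)"
      using ij by (intro mat_vec_entry[OF RMc]) auto
    also have "\<dots> = (\<Sum>l<m. if l = j then (R * M) $$ (i, l) else 0)"
      using ij by (intro sum.cong) auto
    also have "\<dots> = (R * M) $$ (i, j)"
      using ij by (subst sum.delta) auto
    finally show "(R * M) $$ (i, j) = 1\<^sub>m m $$ (i, j)" using rm[of "unit_vec m j"] ij by auto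
  qed (use RMc in auto)
  show thesis using that R MR RM by blast
qed

text \<open>A nonzero intertwiner is invertible, and conjugate matrices have the same trace. Used
  contrapositively: between representations with distinct characters every intertwiner
  vanishes.\<close>

lemma schur_character_eq:
  assumes irr: "irreducible_rep G n \<rho>" "irreducible_rep G m \<tau>"
    and M: "M \<in> carrier_mat n m" "\<And>g. g \<in> carrier G \<Longrightarrow> \<rho> g * M = M * \<tau> g" "M \<noteq> 0\<^sub>m n m"
  shows "rep_character G n \<rho> = rep_character G m \<tau>"
proof -
  obtain R where R: "R \<in> carrier_mat m n" "M * R = 1\<^sub>m n" "R * M = 1\<^sub>m m"
    using schur_inverse[OF assms] by blast
  note rep = irr[THEN irreducible_is_rep]
  have "tr (\<rho> g) = tr (\<tau> g)" if g: "g \<in> carrier G" for g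
  proof -
    note c = rep_carrier[OF rep(1) g] rep_carrier[OF rep(2) g]
    have "tr (\<rho> g) = tr (\<rho> g * (M * R))" using c R by simp
    also have "\<dots> = tr (M * \<tau> g * R)"
      using assoc_mult_mat[OF c(1) M(1) R(1)] M(2)[OF g] by simp
    also have "\<dots> = tr (R * (M * \<tau> g))"
      using tr_comm[of "M * \<tau> g" n m R] c M(1) R(1) by simp
    also have "\<dots> = tr (\<tau> g)"
      using assoc_mult_mat[OF R(1) M(1) c(2)] R(3) c by simp
    finally show ?thesis .
  qed
  then have "rep_character G n \<rho> g = rep_character G m \<tau> g" for g
    using rep_character_eq[OF rep(1)] rep_character_eq[OF rep(2)]
    by (cases "g \<in> carrier G") (auto simp: rep_character_def)
  then show ?thesis by blast
qed

text \<open>Over the complex numbers \<open>S\<close> has an eigenvalue \<open>c\<close>. The matrix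
  \<open>S - c\<close> again commutes with the representation but kills an eigenvector, so it is not
  invertible and must be zero.\<close>

lemma schur_scalar:
  assumes irr: "irreducible_rep G n \<rho>" and S: "S \<in> carrier_mat n n"
    and comm: "\<And>g. g \<in> carrier G \<Longrightarrow> \<rho> g * S = S * \<rho> g"
  obtains c where "S = c \<cdot>\<^sub>m 1\<^sub>m n"
proof -
  have "spectrum S \<noteq> {}" using spectrum_non_empty[OF S] irr by (auto simp: irreducible_rep_def)
  then obtain c v where v: "v \<in> carrier_vec n" "v \<noteq> 0\<^sub>v n" "S *\<^sub>v v = c \<cdot>\<^sub>v v"
    using S unfolding spectrum_def eigenvalue_def eigenvector_def by auto
  define M where "M = S - c \<cdot>\<^sub>m 1\<^sub>m n"
  have M: "M \<in> carrier_mat n n" using S by (simp add: M_def minus_carrier_mat)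
  have Mv: "M *\<^sub>v v = 0\<^sub>v n"
  proof (rule eq_vecI)
    fix i assume "i < dim_vec (0\<^sub>v n :: complex vec)"
    then have i: "i < n" by simp
    have "(M *\<^sub>v v) $ i = (\<Sum>l<n. (S $$ (i, l) - (if l = i then c else 0)) * v $ l)"
      unfolding mat_vec_entry[OF M v(1) i] using i S by (intro sum.cong) (auto simp: M_def)
    also have "\<dots> = (S *\<^sub>v v) $ i - (\<Sum>l<n. if l = i then c * v $ l else 0)"
      unfolding mat_vec_entry[OF S v(1) i] sum_subtractf[symmetric]
      by (intro sum.cong) (auto simp: algebra_simps)
    also have "(\<Sum>l<n. if l = i then c * v $ l else 0) = c * v $ i" using i by simp
    finally show "(M *\<^sub>v v) $ i = 0\<^sub>v n $ i" using v i by simp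
  qed (use M in auto)
  have "M = 0\<^sub>m n n"
  proof (rule ccontr)
    assume "M \<noteq> 0\<^sub>m n n"
    moreover have "\<rho> g * M = M * \<rho> g" if g: "g \<in> carrier G" for g
    proof -
      have c: "\<rho> g \<in> carrier_mat n n" using irr g by (simp add: irreducible_is_rep rep_carrier)
      show ?thesis
        unfolding M_def mult_minus_distrib_mat[OF c S smult_carrier_mat[OF one_carrier_mat]]
          minus_mult_distrib_mat[OF S smult_carrier_mat[OF one_carrier_mat] c]
        using c comm[OF g] by (simp add: mult_smult_distrib[OF c one_carrier_mat] mult_smult_assoc_mat[OF one_carrier_mat c])
    qed
    ultimately obtain R where R: "R \<in> carrier_mat n n" "R * M = 1\<^sub>m n"
      using schur_inverse[OF irr irr M] by metis
    then have "v = R *\<^sub>v (M *\<^sub>v v)"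
      using assoc_mult_mat_vec[OF R(1) M v(1)] v(1) by simp
    also have "\<dots> = 0\<^sub>v n" using Mv R by auto
    finally show False using v(2) by simp
  qed
  have "S = c \<cdot>\<^sub>m 1\<^sub>m n"
  proof (rule eq_matI)
    fix i j assume "i < dim_row (c \<cdot>\<^sub>m 1\<^sub>m n)" "j < dim_col (c \<cdot>\<^sub>m 1\<^sub>m n)"
    then show "S $$ (i, j) = (c \<cdot>\<^sub>m 1\<^sub>m n) $$ (i, j)"
      using \<open>M = 0\<^sub>m n n\<close> S by (auto simp: M_def dest!: arg_cong[of _ _ "\<lambda>A. A $$ (i, j)"])
  qed (use S in auto)
  with that show thesis .
qed

text \<open>\<open>M\<close> is the sum over the group of
  \<open>\<rho> g * E * \<tau> (inv g)\<close>, where \<open>E\<close> is the matrix unit in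
  position \<open>(a, b)\<close>. Translating the summation variable moves \<open>h\<close> from one
  side to the other.\<close>

lemma schur_average:
  assumes rep: "is_rep G n \<rho>" "is_rep G m \<tau>" and ab: "a < n" "b < m" and h: "h \<in> carrier G"
  defines "M \<equiv> mat n m (\<lambda>(i, j). \<Sum>g\<in>carrier G. \<rho> g $$ (i, a) * \<tau> (inv g) $$ (b, j))"
  shows "\<rho> h * M = M * \<tau> h"
proof -
  have M: "M \<in> carrier_mat n m" by (simp add: M_def)
  note c = rep_carrier[OF rep(1) h] rep_carrier[OF rep(2) h]
  show ?thesis
  proof (rule eq_matI)
    fix i j assume "i < dim_row (M * \<tau> h)" "j < dim_col (M * \<tau> h)"
    then have ij: "i < n" "j < m" using M c by auto
    have "(\<rho> h * M) $$ (i, j) = (\<Sum>k<n. \<rho> h $$ (i, k) * (\<Sum>g\<in>carrier G. \<rho> g $$ (k, a) * \<tau> (inv g) $$ (b, j)))"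
      unfolding mat_mult_entry[OF c(1) M ij] using ij by (intro sum.cong) (auto simp: M_def)
    also have "\<dots> = (\<Sum>g\<in>carrier G. (\<Sum>k<n. \<rho> h $$ (i, k) * \<rho> g $$ (k, a)) * \<tau> (inv g) $$ (b, j))"
      by (simp add: sum_distrib_left sum_distrib_right mult.assoc, subst sum.swap, simp)
    also have "\<dots> = (\<Sum>g\<in>carrier G. \<rho> (h \<otimes> g) $$ (i, a) * \<tau> (inv g) $$ (b, j))"
      using rep_mult_entry[OF rep(1) h] ij ab by (intro sum.cong) auto
    also have "\<dots> = (\<Sum>g\<in>carrier G. \<rho> (h \<otimes> g) $$ (i, a) * \<tau> (inv (h \<otimes> g) \<otimes> h) $$ (b, j))"
      using h by (intro sum.cong) (auto simp: inv_mult_group m_assoc)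
    also have "\<dots> = (\<Sum>g\<in>carrier G. \<rho> g $$ (i, a) * \<tau> (inv g \<otimes> h) $$ (b, j))"
      by (rule sum_left_translate[OF h])
    also have "\<dots> = (\<Sum>g\<in>carrier G. \<rho> g $$ (i, a) * (\<Sum>k<m. \<tau> (inv g) $$ (b, k) * \<tau> h $$ (k, j)))"
      using rep_mult_entry[OF rep(2) _ h] ij ab by (intro sum.cong) auto
    also have "\<dots> = (\<Sum>k<m. (\<Sum>g\<in>carrier G. \<rho> g $$ (i, a) * \<tau> (inv g) $$ (b, k)) * \<tau> h $$ (k, j))"
      by (simp add: sum_distrib_left sum_distrib_right mult.assoc, subst sum.swap, simp)
    also have "\<dots> = (M * \<tau> h) $$ (i, j)"
      unfolding mat_mult_entry[OF M c(2) ij] using ij by (intro sum.cong) (auto simp: M_def)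
    finally show "(\<rho> h * M) $$ (i, j) = (M * \<tau> h) $$ (i, j)" .
  qed (use M c in auto)
qed

lemma schur_orthogonality_distinct:
  assumes irr: "irreducible_rep G n \<rho>" "irreducible_rep G m \<tau>"
    and ne: "rep_character G n \<rho> \<noteq> rep_character G m \<tau>"
    and "i < n" "a < n" "b < m" "j < m"
  shows "(\<Sum>g\<in>carrier G. \<rho> g $$ (i, a) * \<tau> (inv g) $$ (b, j)) = 0"
proof -
  define M where "M = mat n m (\<lambda>(i, j). \<Sum>g\<in>carrier G. \<rho> g $$ (i, a) * \<tau> (inv g) $$ (b, j))"
  have "\<rho> h * M = M * \<tau> h" if "h \<in> carrier G" for h
    unfolding M_def by (rule schur_average) (use assms that irreducible_is_rep in auto)
  then have "M = 0\<^sub>m n m"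
    using schur_character_eq[OF irr, of M] ne by (auto simp: M_def)
  then have "M $$ (i, j) = 0" using assms by simp
  then show ?thesis using assms by (simp add: M_def)
qed

text \<open>The intertwiner is a scalar matrix, and its trace fixes the scalar: the diagonal sum
  collapses to entry \<open>(b, a)\<close> of the identity, once for each group element.\<close>

lemma schur_orthogonality_same:
  assumes irr: "irreducible_rep G n \<rho>" and l: "i < n" "a < n" "b < n" "j < n"
  shows "(\<Sum>g\<in>carrier G. \<rho> g $$ (i, a) * \<rho> (inv g) $$ (b, j))
    = (if i = j \<and> a = b then of_nat (card (carrier G)) / of_nat n else 0)"
proof -
  note rep = irreducible_is_rep[OF irr]
  define M where "M = mat n n (\<lambda>(i, j). \<Sum>g\<in>carrier G. \<rho> g $$ (i, a) * \<rho> (inv g) $$ (b, j))"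
  have "\<rho> h * M = M * \<rho> h" if "h \<in> carrier G" for h
    unfolding M_def by (rule schur_average) (use assms that irreducible_is_rep in auto)
  then obtain c where c: "M = c \<cdot>\<^sub>m 1\<^sub>m n"
    using schur_scalar[OF irr, of M] by (auto simp: M_def)
  have "of_nat n * c = (\<Sum>k<n. M $$ (k, k))" by (simp add: c)
  also have "\<dots> = (\<Sum>g\<in>carrier G. \<Sum>k<n. \<rho> (inv g) $$ (b, k) * \<rho> g $$ (k, a))"
    by (subst sum.swap) (auto simp: M_def mult.commute intro!: sum.cong)
  also have "\<dots> = (\<Sum>g\<in>carrier G. 1\<^sub>m n $$ (b, a))"
  proof (intro sum.cong refl)
    fix g assume g: "g \<in> carrier G"
    show "(\<Sum>k<n. \<rho> (inv g) $$ (b, k) * \<rho> g $$ (k, a)) = 1\<^sub>m n $$ (b, a)"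
      using rep_mult_entry[OF rep inv_closed[OF g] g l(3,2)] rep_one[OF rep] g by simp
  qed
  finally have "of_nat n * c = (if a = b then of_nat (card (carrier G)) else 0)"
    using l by auto
  then have "c = (if a = b then of_nat (card (carrier G)) / of_nat n else 0)"
    using l(1) by (auto simp: field_simps split: if_splits)
  moreover have "(\<Sum>g\<in>carrier G. \<rho> g $$ (i, a) * \<rho> (inv g) $$ (b, j)) = M $$ (i, j)"
    using l by (simp add: M_def)
  ultimately show ?thesis using l by (auto simp: c)
qed

section \<open>Sums of traces over the group\<close>

lemma tr_mult2:
  assumes "A \<in> carrier_mat m n" "X \<in> carrier_mat n n" "B \<in> carrier_mat n m" "Y \<in> carrier_mat m m"
  shows "tr (A * X * B * Y) = (\<Sum>j<m. \<Sum>i<n. \<Sum>a<n. \<Sum>b<m. A $$ (j, i) * B $$ (a, b) * (X $$ (i, a) * Y $$ (b, j)))"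
proof -
  have "A * X * B * Y = A * (X * (B * Y))"
    using assms by (simp add: assoc_mult_mat[of _ m n _ n] assoc_mult_mat[of _ m n _ m])
  moreover have "A * (X * (B * Y)) \<in> carrier_mat m m"
    using assms by auto
  moreover have "(A * (X * (B * Y))) $$ (j, j)
      = (\<Sum>i<n. \<Sum>a<n. \<Sum>b<m. A $$ (j, i) * B $$ (a, b) * (X $$ (i, a) * Y $$ (b, j)))" if j: "j < m" for j
  proof -
    have BY: "B * Y \<in> carrier_mat n m" and XBY: "X * (B * Y) \<in> carrier_mat n m" using assms by auto
    have "(A * (X * (B * Y))) $$ (j, j) = (\<Sum>i<n. A $$ (j, i) * (X * (B * Y)) $$ (i, j))"
      by (rule mat_mult_entry[OF assms(1) XBY j j])
    also have "\<dots> = (\<Sum>i<n. A $$ (j, i) * (\<Sum>a<n. X $$ (i, a) * (\<Sum>b<m. B $$ (a, b) * Y $$ (b, j))))"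
      using mat_mult_entry[OF assms(2) BY _ j] mat_mult_entry[OF assms(3,4) _ j]
      by (intro sum.cong arg_cong2[where f = "(*)"]) auto
    finally show ?thesis by (simp add: sum_distrib_left mult_ac)
  qed
  ultimately show ?thesis by (simp add: tr_carrier)
qed

text \<open>The shape that arises when a character is evaluated at
  \<open>c \<otimes> s x \<otimes> inv x\<close> and summed over \<open>x\<close>. Expanding it in
  matrix coefficients makes both Schur relations applicable.\<close>

lemma tr_sandwich:
  assumes rep: "is_rep G n \<rho>" "is_rep G m \<tau>"
    and AB: "A \<in> carrier_mat m n" "B \<in> carrier_mat n m"
  shows "(\<Sum>g\<in>carrier G. tr (A * \<rho> g * B * \<tau> (inv g)))
    = (\<Sum>j<m. \<Sum>i<n. \<Sum>a<n. \<Sum>b<m. A $$ (j, i) * B $$ (a, b) *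
         (\<Sum>g\<in>carrier G. \<rho> g $$ (i, a) * \<tau> (inv g) $$ (b, j)))"
proof -
  have "(\<Sum>g\<in>carrier G. tr (A * \<rho> g * B * \<tau> (inv g)))
    = (\<Sum>g\<in>carrier G. \<Sum>j<m. \<Sum>i<n. \<Sum>a<n. \<Sum>b<m. A $$ (j, i) * B $$ (a, b) * (\<rho> g $$ (i, a) * \<tau> (inv g) $$ (b, j)))"
    using rep AB by (intro sum.cong tr_mult2) (auto simp: rep_carrier)
  then show ?thesis
    by (simp only: sum_distrib_left sum.swap[of _ "carrier G"])
qed

lemma tr_sandwich_distinct:
  assumes irr: "irreducible_rep G n \<rho>" "irreducible_rep G m \<tau>"
    and ne: "rep_character G n \<rho> \<noteq> rep_character G m \<tau>"
    and AB: "A \<in> carrier_mat m n" "B \<in> carrier_mat n m"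
  shows "(\<Sum>g\<in>carrier G. tr (A * \<rho> g * B * \<tau> (inv g))) = 0"
  unfolding tr_sandwich[OF irr[THEN irreducible_is_rep] AB]
  by (intro sum.neutral ballI) (simp add: schur_orthogonality_distinct[OF irr ne])

lemma tr_sandwich_same:
  assumes irr: "irreducible_rep G n \<rho>"
    and AB: "A \<in> carrier_mat n n" "B \<in> carrier_mat n n"
  shows "(\<Sum>g\<in>carrier G. tr (A * \<rho> g * B * \<rho> (inv g)))
    = of_nat (card (carrier G)) / of_nat n * tr A * tr B"
proof -
  let ?c = "of_nat (card (carrier G)) / of_nat n :: complex"
  have "(\<Sum>g\<in>carrier G. tr (A * \<rho> g * B * \<rho> (inv g)))
    = (\<Sum>j<n. \<Sum>i<n. \<Sum>a<n. \<Sum>b<n. A $$ (j, i) * B $$ (a, b) * (if i = j \<and> a = b then ?c else 0))"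
    unfolding tr_sandwich[OF irr[THEN irreducible_is_rep] irr[THEN irreducible_is_rep] AB]
    by (intro sum.cong) (auto simp: schur_orthogonality_same[OF irr])
  also have "\<dots> = (\<Sum>j<n. \<Sum>i<n. \<Sum>a<n. if i = j then A $$ (j, i) * B $$ (a, a) * ?c else 0)"
    by (intro sum.cong refl sum_delta_conj) simp
  also have "\<dots> = (\<Sum>j<n. \<Sum>a<n. \<Sum>i<n. if i = j then A $$ (j, i) * B $$ (a, a) * ?c else 0)"
    by (intro sum.cong refl sum.swap)
  also have "\<dots> = (\<Sum>j<n. \<Sum>a<n. A $$ (j, j) * B $$ (a, a) * ?c)"
    by (intro sum.cong refl) (subst sum.delta, auto)
  also have "\<dots> = ?c * tr A * tr B"
    by (simp only: tr_carrier[OF AB(1)] tr_carrier[OF AB(2)] mult.assoc sum_product)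
      (simp only: sum_distrib_left mult_ac)
  finally show ?thesis .
qed

text \<open>The shape of an inner product of two functions
  \<open>g \<mapsto> tr (\<rho> g * A)\<close>; these include the characters and their twists by an
  intertwiner.\<close>

lemma tr_product:
  assumes rep: "is_rep G n \<rho>" "is_rep G m \<tau>"
    and AB: "A \<in> carrier_mat n n" "B \<in> carrier_mat m m"
  shows "(\<Sum>g\<in>carrier G. tr (\<rho> g * A) * tr (B * \<tau> (inv g)))
    = (\<Sum>i<n. \<Sum>a<n. \<Sum>j<m. \<Sum>b<m. A $$ (a, i) * B $$ (j, b) *
         (\<Sum>g\<in>carrier G. \<rho> g $$ (i, a) * \<tau> (inv g) $$ (b, j)))"
proof -
  have "(\<Sum>g\<in>carrier G. tr (\<rho> g * A) * tr (B * \<tau> (inv g)))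
    = (\<Sum>g\<in>carrier G. \<Sum>i<n. \<Sum>a<n. \<Sum>j<m. \<Sum>b<m. A $$ (a, i) * B $$ (j, b) * (\<rho> g $$ (i, a) * \<tau> (inv g) $$ (b, j)))"
  proof (intro sum.cong refl)
    fix g assume g: "g \<in> carrier G"
    note c = rep_carrier[OF rep(1) g] rep_carrier[OF rep(2) inv_closed[OF g]]
    show "tr (\<rho> g * A) * tr (B * \<tau> (inv g)) = (\<Sum>i<n. \<Sum>a<n. \<Sum>j<m. \<Sum>b<m. A $$ (a, i) * B $$ (j, b) * (\<rho> g $$ (i, a) * \<tau> (inv g) $$ (b, j)))"
      unfolding tr_mult[OF c(1) AB(1)] tr_mult[OF AB(2) c(2)]
      by (simp only: sum_distrib_right) (simp only: sum_distrib_left mult_ac)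
  qed
  then show ?thesis
    by (simp only: sum_distrib_left sum.swap[of _ "carrier G"])
qed

lemma tr_product_distinct:
  assumes irr: "irreducible_rep G n \<rho>" "irreducible_rep G m \<tau>"
    and ne: "rep_character G n \<rho> \<noteq> rep_character G m \<tau>"
    and AB: "A \<in> carrier_mat n n" "B \<in> carrier_mat m m"
  shows "(\<Sum>g\<in>carrier G. tr (\<rho> g * A) * tr (B * \<tau> (inv g))) = 0"
  unfolding tr_product[OF irr[THEN irreducible_is_rep] AB]
  by (intro sum.neutral ballI) (simp add: schur_orthogonality_distinct[OF irr ne])

lemma tr_product_same:
  assumes irr: "irreducible_rep G n \<rho>"
    and AB: "A \<in> carrier_mat n n" "B \<in> carrier_mat n n"
  shows "(\<Sum>g\<in>carrier G. tr (\<rho> g * A) * tr (B * \<rho> (inv g)))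
    = of_nat (card (carrier G)) / of_nat n * tr (A * B)"
proof -
  let ?c = "of_nat (card (carrier G)) / of_nat n :: complex"
  have "(\<Sum>g\<in>carrier G. tr (\<rho> g * A) * tr (B * \<rho> (inv g)))
    = (\<Sum>i<n. \<Sum>a<n. \<Sum>j<n. \<Sum>b<n. A $$ (a, i) * B $$ (j, b) * (if i = j \<and> a = b then ?c else 0))"
    unfolding tr_product[OF irr[THEN irreducible_is_rep] irr[THEN irreducible_is_rep] AB]
    by (intro sum.cong) (auto simp: schur_orthogonality_same[OF irr])
  also have "\<dots> = (\<Sum>i<n. \<Sum>a<n. \<Sum>j<n. if i = j then A $$ (a, i) * B $$ (j, a) * ?c else 0)"
    by (intro sum.cong refl sum_delta_conj) simp
  also have "\<dots> = (\<Sum>i<n. \<Sum>a<n. A $$ (a, i) * B $$ (i, a) * ?c)"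
    by (intro sum.cong refl) (subst sum.delta', auto)
  also have "\<dots> = ?c * tr (A * B)"
    unfolding tr_mult[OF AB] by (subst sum.swap) (simp add: sum_distrib_left mult_ac)
  finally show ?thesis .
qed

text \<open>The averaged positive definite form \<open>H = \<Sum>\<rho>(g)\<^sup>* \<rho>(g)\<close> satisfies \<open>\<rho>(h)\<^sup>* H = H \<rho>(h\<^sup>-\<^sup>1)\<close>.\<close>

lemma cnj_tr_rep:
  assumes rep: "is_rep G n \<rho>" and h: "h \<in> carrier G"
  shows "cnj (tr (\<rho> h)) = tr (\<rho> (inv h))"
proof -
  note c = rep_carrier[OF rep]
  define H where "H = mat n n (\<lambda>(i, j). \<Sum>g\<in>carrier G. \<Sum>k<n. cnj (\<rho> g $$ (k, i)) * \<rho> g $$ (k, j))"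
  have H: "H \<in> carrier_mat n n" by (simp add: H_def)
  define L where "L = mat n n (\<lambda>(i, j). cnj (\<rho> h $$ (j, i)))"
  have L: "L \<in> carrier_mat n n" by (simp add: L_def)
  have Lentry: "L $$ (i, l) = cnj (\<rho> h $$ (l, i))" if "i < n" "l < n" for i l
    using that by (simp add: L_def)
  have Hentry: "H $$ (i, j) = (\<Sum>g\<in>carrier G. \<Sum>k<n. cnj (\<rho> g $$ (k, i)) * \<rho> g $$ (k, j))"
    if "i < n" "j < n" for i j
    using that by (simp add: H_def)
  have LH: "L * H = H * \<rho> (inv h)"
  proof (rule eq_matI)
    fix i j assume "i < dim_row (H * \<rho> (inv h))" "j < dim_col (H * \<rho> (inv h))"
    then have ij: "i < n" "j < n" using H c[of "inv h"] h by auto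
    have "(L * H) $$ (i, j) = (\<Sum>l<n. cnj (\<rho> h $$ (l, i)) *
        (\<Sum>g\<in>carrier G. \<Sum>k<n. cnj (\<rho> g $$ (k, l)) * \<rho> g $$ (k, j)))"
      unfolding mat_mult_entry[OF L H ij] using ij
      by (intro sum.cong arg_cong2[where f = "(*)"]) (auto simp: Lentry Hentry)
    also have "\<dots> = (\<Sum>g\<in>carrier G. \<Sum>k<n. \<Sum>l<n. cnj (\<rho> h $$ (l, i)) * (cnj (\<rho> g $$ (k, l)) * \<rho> g $$ (k, j)))"
      unfolding sum_distrib_left by (rule sum_rotate3)
    also have "\<dots> = (\<Sum>g\<in>carrier G. \<Sum>k<n. cnj (\<Sum>l<n. \<rho> g $$ (k, l) * \<rho> h $$ (l, i)) * \<rho> g $$ (k, j))"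
      by (simp only: cnj_sum complex_cnj_mult sum_distrib_right) (simp only: mult_ac)
    also have "\<dots> = (\<Sum>g\<in>carrier G. \<Sum>k<n. cnj (\<rho> (g \<otimes> h) $$ (k, i)) * \<rho> (g \<otimes> h \<otimes> inv h) $$ (k, j))"
      using rep_mult_entry[OF rep _ h _ ij(1)] h
      by (intro sum.cong) (auto simp: m_assoc)
    also have "\<dots> = (\<Sum>g\<in>carrier G. \<Sum>k<n. cnj (\<rho> g $$ (k, i)) * \<rho> (g \<otimes> inv h) $$ (k, j))"
      by (rule sum_right_translate[OF h])
    also have "\<dots> = (\<Sum>g\<in>carrier G. \<Sum>k<n. cnj (\<rho> g $$ (k, i)) * (\<Sum>l<n. \<rho> g $$ (k, l) * \<rho> (inv h) $$ (l, j)))"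
      using rep_mult_entry[OF rep _ inv_closed[OF h] _ ij(2)]
      by (intro sum.cong) auto
    also have "\<dots> = (\<Sum>l<n. (\<Sum>g\<in>carrier G. \<Sum>k<n. cnj (\<rho> g $$ (k, i)) * \<rho> g $$ (k, l)) * \<rho> (inv h) $$ (l, j))"
      unfolding sum_distrib_left sum_distrib_right mult.assoc by (rule sum_rotate3[symmetric])
    also have "\<dots> = (H * \<rho> (inv h)) $$ (i, j)"
      unfolding mat_mult_entry[OF H c[OF inv_closed[OF h]] ij] using ij
      by (intro sum.cong arg_cong2[where f = "(*)"]) (auto simp: Hentry)
    finally show "(L * H) $$ (i, j) = (H * \<rho> (inv h)) $$ (i, j)" .
  qed (use H L c[of "inv h"] h in auto)
  \<comment> \<open>At a null vector \<open>v\<close> of \<open>H\<close> the Hermitian form takes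
    the value 0, but this value is the sum of the squared norms of all vectors
    \<open>\<rho> g v\<close>.\<close>
  have "det H \<noteq> 0"
  proof
    assume "det H = 0"
    then obtain v where v: "v \<in> carrier_vec n" "v \<noteq> 0\<^sub>v n" "H *\<^sub>v v = 0\<^sub>v n"
      using det_0_iff_vec_prod_zero_field[OF H] by auto
    have norm_sq: "cnj z * z = of_real ((cmod z)\<^sup>2)" for z
      by (simp only: complex_norm_square mult.commute)
    have "0 = (\<Sum>i<n. cnj (v $ i) * (H *\<^sub>v v) $ i)" using v by simp
    also have "\<dots> = (\<Sum>i<n. cnj (v $ i) * (\<Sum>j<n. (\<Sum>g\<in>carrier G. \<Sum>k<n. cnj (\<rho> g $$ (k, i)) * \<rho> g $$ (k, j)) * v $ j))"
      by (intro sum.cong arg_cong2[where f = "(*)"] refl)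
        (auto simp: mat_vec_entry[OF H v(1)] Hentry simp del: index_mult_mat_vec intro!: sum.cong)
    also have "\<dots> = (\<Sum>g\<in>carrier G. \<Sum>k<n. cnj (\<Sum>i<n. \<rho> g $$ (k, i) * v $ i) * (\<Sum>j<n. \<rho> g $$ (k, j) * v $ j))"
    proof -
      have "(\<Sum>i<n. cnj (v $ i) * (\<Sum>j<n. (\<Sum>g\<in>carrier G. \<Sum>k<n. cnj (\<rho> g $$ (k, i)) * \<rho> g $$ (k, j)) * v $ j))
        = (\<Sum>i<n. \<Sum>g\<in>carrier G. \<Sum>k<n. \<Sum>j<n. cnj (v $ i) * (cnj (\<rho> g $$ (k, i)) * (\<rho> g $$ (k, j) * v $ j)))"
        unfolding sum_distrib_left sum_distrib_right mult.assoc by (intro sum.cong refl sum_rotate3)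
      also have "\<dots> = (\<Sum>g\<in>carrier G. \<Sum>k<n. \<Sum>i<n. \<Sum>j<n. cnj (v $ i) * (cnj (\<rho> g $$ (k, i)) * (\<rho> g $$ (k, j) * v $ j)))"
        by (rule sum_rotate3)
      also have "\<dots> = (\<Sum>g\<in>carrier G. \<Sum>k<n. cnj (\<Sum>i<n. \<rho> g $$ (k, i) * v $ i) * (\<Sum>j<n. \<rho> g $$ (k, j) * v $ j))"
        unfolding cnj_sum complex_cnj_mult sum_distrib_right
        by (intro sum.cong refl) (simp add: sum_distrib_left mult_ac)
      finally show ?thesis .
    qed
    also have "\<dots> = of_real (\<Sum>g\<in>carrier G. \<Sum>k<n. (cmod (\<Sum>i<n. \<rho> g $$ (k, i) * v $ i))\<^sup>2)"
      unfolding of_real_sum by (intro sum.cong refl norm_sq)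
    finally have "(\<Sum>g\<in>carrier G. \<Sum>k<n. (cmod (\<Sum>i<n. \<rho> g $$ (k, i) * v $ i))\<^sup>2) = 0"
      by (rule of_real_eq_0_iff[where ?'a = complex, THEN iffD1, OF sym])
    then have "\<forall>g\<in>carrier G. (\<Sum>k<n. (cmod (\<Sum>i<n. \<rho> g $$ (k, i) * v $ i))\<^sup>2) = 0"
      by (subst (asm) sum_nonneg_eq_0_iff) (auto simp: finite_carrier intro!: sum_nonneg)
    \<comment> \<open>The summand at the identity of the group is the squared norm of
      \<open>v\<close> itself.\<close>
    then have "(\<Sum>k<n. (cmod (\<Sum>i<n. 1\<^sub>m n $$ (k, i) * v $ i))\<^sup>2) = 0"
      using rep_one[OF rep] by (auto dest!: bspec[OF _ one_closed])
    then have z: "\<forall>k<n. (\<Sum>i<n. 1\<^sub>m n $$ (k, i) * v $ i) = 0"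
      by (subst (asm) sum_nonneg_eq_0_iff) auto
    have "v $ k = 0" if k: "k < n" for k
    proof -
      have "(\<Sum>i<n. 1\<^sub>m n $$ (k, i) * v $ i) = (\<Sum>i<n. if i = k then v $ i else 0)"
        using k by (intro sum.cong) auto
      then show ?thesis using z k by simp
    qed
    then have "v = 0\<^sub>v n" using v(1) by (intro eq_vecI) auto
    with v(2) show False ..
  qed
  then obtain K where K: "K \<in> carrier_mat n n" "H * K = 1\<^sub>m n" "K * H = 1\<^sub>m n"
    using det_non_zero_imp_unit[OF H, of "()"] by (auto simp: Units_def ring_mat_def)
  \<comment> \<open>\<open>L\<close> is the conjugate transpose of \<open>\<rho> h\<close>;
    conjugation by the invertible \<open>H\<close> carries it to \<open>\<rho> (inv h)\<close> and
    preserves the trace.\<close>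
  have "cnj (tr (\<rho> h)) = tr L"
    using c[OF h] L by (simp add: tr_carrier Lentry)
  also have "\<dots> = tr (L * (H * K))" using K L by simp
  also have "\<dots> = tr (H * \<rho> (inv h) * K)"
    by (simp add: LH[symmetric] assoc_mult_mat[OF L H K(1)])
  also have "\<dots> = tr (K * (H * \<rho> (inv h)))"
    using tr_comm[of "H * \<rho> (inv h)" n n K] H K(1) c[of "inv h"] h by simp
  also have "\<dots> = tr (\<rho> (inv h))"
    using assoc_mult_mat[OF K(1) H c[of "inv h"]] K(3) c[of "inv h"] h by simp
  finally show ?thesis .
qed

end

section \<open>Bases adapted to an invariant subspace\<close>

definition fscale :: "complex \<Rightarrow> (nat \<Rightarrow> complex) \<Rightarrow> nat \<Rightarrow> complex" where
  "fscale c f = (\<lambda>i. c * f i)"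

interpretation fs: vector_space fscale
  by unfold_locales (auto simp: fscale_def algebra_simps)

lemma sum_fscale_apply: "(\<Sum>b\<in>B. fscale (u b) (w b)) i = (\<Sum>b\<in>B. u b * w b i)"
  by (induction B rule: infinite_finite_induct) (auto simp: fscale_def)

text \<open>A basis of \<open>W\<close> is extended to a basis of the whole space; its members are the columns of \<open>Q\<close>,
  those from \<open>W\<close> first.\<close>

lemma adapted_basis:
  assumes W: "vec_subspace n W" "W \<noteq> {0\<^sub>v n}" "W \<noteq> carrier_vec n"
  obtains r Q R where "0 < r" "r < n" "Q \<in> carrier_mat n n" "R \<in> carrier_mat n n"
    "Q * R = 1\<^sub>m n" "R * Q = 1\<^sub>m n"
    "\<And>v. v \<in> carrier_vec n \<Longrightarrow> v \<in> W \<longleftrightarrow> (\<forall>i<n. r \<le> i \<longrightarrow> (R *\<^sub>v v) $ i = 0)"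
proof -
  \<comment> \<open>Column vectors of one dimension form a carrier set and not a type. As functions
    vanishing from \<open>n\<close> on they live in the type-based vector space \<open>fs\<close>,
    where maximal independent sets and their extensions are available.\<close>
  define emb where "emb v = (\<lambda>i. if i < n then v $ i else 0)" for v :: "complex vec"
  have W_carrier: "v \<in> carrier_vec n" if "v \<in> W" for v
    using W(1) that by (auto simp: vec_subspace_def)
  have emb_inj: "v = w" if "emb v = emb w" "v \<in> carrier_vec n" "w \<in> carrier_vec n" for v w
    using that by (intro eq_vecI) (auto simp: emb_def fun_eq_iff, metis)
  define U where "U = {f :: nat \<Rightarrow> complex. \<forall>i\<ge>n. f i = 0}"
  define e where "e k = (\<lambda>i. if i = k then 1 else 0 :: complex)" for k :: nat
  have emb_U: "emb v \<in> U" for v by (simp add: emb_def U_def)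
  have U_span: "U \<subseteq> fs.span (e ` {..<n})"
  proof
    fix f assume f: "f \<in> U"
    have "f = (\<Sum>k<n. fscale (f k) (e k))"
    proof
      fix x
      have "(\<Sum>k<n. f k * e k x) = (\<Sum>k<n. if x = k then f k else 0)"
        by (intro sum.cong) (auto simp: e_def)
      then show "f x = (\<Sum>k<n. fscale (f k) (e k)) x"
        using f by (simp add: sum_fscale_apply U_def)
    qed
    also have "\<dots> \<in> fs.span (e ` {..<n})"
      by (intro fs.span_sum fs.span_scale fs.span_base) auto
    finally show "f \<in> fs.span (e ` {..<n})" .
  qed
  have "fs.subspace (emb ` W)"
  proof (rule fs.subspaceI)
    show "0 \<in> emb ` W"
      using W(1) by (intro image_eqI[of _ _ "0\<^sub>v n"]) (auto simp: emb_def vec_subspace_def)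
    fix x y c assume "x \<in> emb ` W"
    then obtain v where v: "v \<in> W" "x = emb v" by auto
    show "fscale c x \<in> emb ` W"
      using W(1) v W_carrier[OF v(1)]
      by (intro image_eqI[of _ _ "c \<cdot>\<^sub>v v"]) (auto simp: emb_def fscale_def vec_subspace_def)
    assume "y \<in> emb ` W"
    then obtain w where w: "w \<in> W" "y = emb w" by auto
    show "x + y \<in> emb ` W"
      using W(1) v w W_carrier[OF v(1)] W_carrier[OF w(1)]
      by (intro image_eqI[of _ _ "v + w"]) (auto simp: emb_def vec_subspace_def)
  qed
  obtain B1 where B1: "B1 \<subseteq> emb ` W" "fs.independent B1" "emb ` W \<subseteq> fs.span B1"
    using fs.maximal_independent_subset by blast
  have "B1 \<subseteq> U" using B1(1) emb_U by auto
  obtain B where B: "B1 \<subseteq> B" "B \<subseteq> U" "fs.independent B" "U \<subseteq> fs.span B"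
    using fs.maximal_independent_subset_extend[OF \<open>B1 \<subseteq> U\<close> B1(2)] by blast
  have finB: "finite B"
    using fs.independent_span_bound[of "e ` {..<n}" B] B U_span by auto
  then have finB1: "finite B1" using B(1) finite_subset by blast
  obtain bs1 bs2 where bs: "set bs1 = B1" "distinct bs1" "set bs2 = B - B1" "distinct bs2"
    using finB finB1 finite_distinct_list by (metis finite_Diff)
  define bs where "bs = bs1 @ bs2"
  define r where "r = length bs1"
  \<comment> \<open>The number \<open>N\<close> of basis vectors is identified with \<open>n\<close>
    only after \<open>Q * R\<close> and \<open>R * Q\<close> are both known to be identity matrices;
    until then \<open>Q\<close> and \<open>R\<close> are rectangular.\<close>
  define N where "N = length bs"
  have bsB: "set bs = B" "distinct bs" using bs B(1) by (auto simp: bs_def)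
  have bij: "bij_betw ((!) bs) {..<N} B"
    using bij_betw_nth[OF bsB(2) _ bsB(1)[symmetric]] by (auto simp: N_def)
  have nth_r: "bs ! j = bs1 ! j" if "j < r" for j using that by (simp add: bs_def r_def nth_append)
  have bij1: "bij_betw ((!) bs) {..<r} B1"
    using bij_betw_nth[OF bs(2) _ bs(1)[symmetric]]
    by (subst bij_betw_cong[of _ _ "(!) bs1"]) (auto simp: r_def nth_r[unfolded r_def])
  have rN: "r \<le> N" by (simp add: r_def N_def bs_def)
  define Q where "Q = mat n N (\<lambda>(i, j). (bs ! j) i)"
  have Q: "Q \<in> carrier_mat n N" by (simp add: Q_def)
  define R where "R = mat N n (\<lambda>(j, i). fs.representation B (e i) (bs ! j))"
  have R: "R \<in> carrier_mat N n" by (simp add: R_def)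
  have eU: "e k \<in> U" if "k < n" for k using that by (auto simp: e_def U_def)
  have QR: "Q * R = 1\<^sub>m n"
  proof (rule eq_matI)
    fix i j assume "i < dim_row (1\<^sub>m n)" "j < dim_col (1\<^sub>m n :: complex mat)"
    then have ij: "i < n" "j < n" by auto
    have "(Q * R) $$ (i, j) = (\<Sum>l<N. fs.representation B (e j) (bs ! l) * (bs ! l) i)"
      unfolding mat_mult_entry[OF Q R ij] using ij by (intro sum.cong) (auto simp: Q_def R_def)
    also have "\<dots> = (\<Sum>b\<in>B. fs.representation B (e j) b * b i)"
      by (rule sum.reindex_bij_betw[OF bij])
    also have "\<dots> = (\<Sum>b\<in>B. fscale (fs.representation B (e j) b) b) i"
      by (simp add: sum_fscale_apply)
    also have "(\<Sum>b\<in>B. fscale (fs.representation B (e j) b) b) = e j"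
      using fs.sum_representation_eq[OF B(3) _ finB] B(4) eU[OF ij(2)] by blast
    finally show "(Q * R) $$ (i, j) = 1\<^sub>m n $$ (i, j)" using ij by (simp add: e_def)
  qed (use Q R in auto)
  \<comment> \<open>Independence of \<open>B\<close> as injectivity of \<open>Q\<close>. Applied to
    the columns of \<open>R * Q - 1\<close>, which \<open>Q\<close> kills, it yields the second
    inverse equation.\<close>
  have Q_inj: "u l = 0" if "\<And>i. i < n \<Longrightarrow> (\<Sum>l<N. (bs ! l) i * u l) = 0" "l < N" for u :: "nat \<Rightarrow> complex" and l
  proof -
    define t where "t b = u (the_inv_into {..<N} ((!) bs) b)" for b
    have t: "t (bs ! l) = u l" if "l < N" for l
      unfolding t_def using the_inv_into_f_f[OF bij_betw_imp_inj_on[OF bij]] that by simp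
    have "(\<Sum>b\<in>B. fscale (t b) b) i = 0" for i
    proof (cases "i < n")
      case True
      have "(\<Sum>b\<in>B. fscale (t b) b) i = (\<Sum>l<N. t (bs ! l) * (bs ! l) i)"
        by (simp add: sum_fscale_apply sum.reindex_bij_betw[OF bij, of "\<lambda>b. t b * b i"])
      also have "\<dots> = 0" using that(1)[OF True] t by (simp add: mult.commute)
      finally show ?thesis .
    next
      case False
      then show ?thesis using B(2) by (auto simp: sum_fscale_apply U_def intro!: sum.neutral)
    qed
    then have "(\<Sum>b\<in>B. fscale (t b) b) = 0" by (simp add: fun_eq_iff)
    then have "t (bs ! l) = 0"
      using fs.independentD[OF B(3) finB subset_refl] bij that(2) by (auto simp: bij_betw_def)
    then show ?thesis using t that(2) by simp
  qed
  have RQc: "R * Q \<in> carrier_mat N N" using Q R by simp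
  have RQ: "R * Q = 1\<^sub>m N"
  proof (rule eq_matI)
    fix k j assume "k < dim_row (1\<^sub>m N)" "j < dim_col (1\<^sub>m N :: complex mat)"
    then have kj: "k < N" "j < N" by auto
    define u where "u l = (R * Q) $$ (l, j) - (if l = j then 1 else 0)" for l
    have "(\<Sum>l<N. (bs ! l) i * u l) = 0" if i: "i < n" for i
    proof -
      have "(\<Sum>l<N. (bs ! l) i * u l) = (\<Sum>l<N. Q $$ (i, l) * (R * Q) $$ (l, j)) - (\<Sum>l<N. if l = j then (bs ! l) i else 0)"
        unfolding sum_subtractf[symmetric] using i by (intro sum.cong) (auto simp: u_def Q_def algebra_simps)
      also have "(\<Sum>l<N. Q $$ (i, l) * (R * Q) $$ (l, j)) = (Q * (R * Q)) $$ (i, j)"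
        by (rule mat_mult_entry[OF Q RQc i kj(2), symmetric])
      also have "Q * (R * Q) = Q" using assoc_mult_mat[OF Q R Q] QR Q by simp
      finally show ?thesis using i kj by (simp add: Q_def)
    qed
    then have "u k = 0" using Q_inj kj by blast
    then show "(R * Q) $$ (k, j) = 1\<^sub>m N $$ (k, j)" using kj by (simp add: u_def del: index_mult_mat split: if_splits)
  qed (use Q R in auto)
  \<comment> \<open>The traces of the two identity matrices are their sizes, so the symmetry of the
    trace gives invariance of dimension.\<close>
  have "tr (Q * R) = tr (R * Q)" by (rule tr_comm[OF Q R])
  then have Nn: "N = n" by (simp add: QR RQ tr_one)
  have QN: "Q \<in> carrier_mat n n" and RN: "R \<in> carrier_mat n n" using Q R Nn by auto
  have W_iff: "v \<in> W \<longleftrightarrow> (\<forall>i<n. r \<le> i \<longrightarrow> (R *\<^sub>v v) $ i = 0)" if v: "v \<in> carrier_vec n" for v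
  proof
    assume "v \<in> W"
    then have "emb v \<in> fs.span B1" using B1(3) by auto
    then obtain u where u: "emb v = (\<Sum>b\<in>B1. fscale (u b) b)"
      using fs.span_finite[OF finB1] by auto
    define w where "w = vec n (\<lambda>j. if j < r then u (bs ! j) else 0)"
    have w: "w \<in> carrier_vec n" by (simp add: w_def)
    have "Q *\<^sub>v w = v"
    proof (rule eq_vecI)
      fix i assume "i < dim_vec v"
      then have i: "i < n" using v by simp
      have "(Q *\<^sub>v w) $ i = (\<Sum>l<n. if l \<in> {..<r} then u (bs ! l) * (bs ! l) i else 0)"
        unfolding mat_vec_entry[OF QN w i] using i Nn by (intro sum.cong) (auto simp: Q_def w_def)
      also have "\<dots> = (\<Sum>l<r. u (bs ! l) * (bs ! l) i)"
        using rN Nn by (subst sum.inter_restrict[symmetric]) (auto intro!: sum.cong)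
      also have "\<dots> = (\<Sum>b\<in>B1. u b * b i)" by (rule sum.reindex_bij_betw[OF bij1])
      also have "\<dots> = emb v i" by (simp add: u sum_fscale_apply)
      finally show "(Q *\<^sub>v w) $ i = v $ i" using i by (simp add: emb_def)
    qed (use QN v in auto)
    then have "R *\<^sub>v v = w"
      using assoc_mult_mat_vec[OF RN QN w] RQ Nn w by simp
    then show "\<forall>i<n. r \<le> i \<longrightarrow> (R *\<^sub>v v) $ i = 0" by (simp add: w_def)
  next
    assume tail: "\<forall>i<n. r \<le> i \<longrightarrow> (R *\<^sub>v v) $ i = 0"
    define w where "w = R *\<^sub>v v"
    have w: "w \<in> carrier_vec n" using mult_mat_vec_carrier[OF RN v] by (simp add: w_def)
    have "Q *\<^sub>v w = v" using assoc_mult_mat_vec[OF QN RN v] QR v by (simp add: w_def)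
    have "emb v = (\<Sum>l<r. fscale (w $ l) (bs ! l))"
    proof
      fix i
      show "emb v i = (\<Sum>l<r. fscale (w $ l) (bs ! l)) i"
      proof (cases "i < n")
        case True
        have "emb v i = (Q *\<^sub>v w) $ i" using True \<open>Q *\<^sub>v w = v\<close> by (simp add: emb_def)
        also have "\<dots> = (\<Sum>l<n. if l \<in> {..<r} then w $ l * (bs ! l) i else 0)"
          unfolding mat_vec_entry[OF QN w True] using True Nn tail
          by (intro sum.cong) (auto simp: Q_def w_def simp del: index_mult_mat_vec)
        also have "\<dots> = (\<Sum>l<r. w $ l * (bs ! l) i)"
          using rN Nn by (subst sum.inter_restrict[symmetric]) (auto intro!: sum.cong)
        finally show ?thesis by (simp add: sum_fscale_apply)
      next
        case False
        have "bs ! l \<in> U" if "l < r" for l using that rN bij B(2) by (auto simp: bij_betw_def)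
        then show ?thesis using False by (auto simp: sum_fscale_apply emb_def U_def)
      qed
    qed
    also have "\<dots> \<in> emb ` W"
      using bij1 B1(1) by (intro fs.subspace_sum[OF \<open>fs.subspace (emb ` W)\<close>]
          fs.subspace_scale[OF \<open>fs.subspace (emb ` W)\<close>]) (auto simp: bij_betw_def)
    finally show "v \<in> W" using emb_inj[OF _ v] W_carrier by auto
  qed
  have "0 < r"
  proof (rule ccontr)
    assume "\<not> 0 < r"
    have "v = 0\<^sub>v n" if "v \<in> W" for v
    proof -
      have v: "v \<in> carrier_vec n" using W_carrier that .
      have "R *\<^sub>v v = 0\<^sub>v n" using W_iff[OF v] that \<open>\<not> 0 < r\<close> RN by (intro eq_vecI) auto
      then have "Q *\<^sub>v (R *\<^sub>v v) = 0\<^sub>v n" using QN by auto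
      then show ?thesis using assoc_mult_mat_vec[OF QN RN v] QR v by simp
    qed
    then have "W = {0\<^sub>v n}" using W(1) by (auto simp: vec_subspace_def)
    with W(2) show False ..
  qed
  moreover have "r < n"
  proof (rule ccontr)
    assume "\<not> r < n"
    then have "W = carrier_vec n" using W_iff W_carrier by auto
    with W(3) show False ..
  qed
  ultimately show thesis using that QN RN QR RQ Nn W_iff by blast
qed

section \<open>Irreducible characters and class functions\<close>

lemma sum_lessThan_add:
  fixes f :: "nat \<Rightarrow> complex"
  shows "(\<Sum>k<r + d. f k) = (\<Sum>k<r. f k) + (\<Sum>k<d. f (r + k))"
  by (induction d) auto

lemma eq_smult_one_mat:
  "c \<cdot>\<^sub>m 1\<^sub>m n = d \<cdot>\<^sub>m 1\<^sub>m n \<Longrightarrow> n > 0 \<Longrightarrow> c = (d :: complex)"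
  by (drule arg_cong[of _ _ "\<lambda>A. A $$ (0, 0)"]) simp

section \<open>Decomposition into irreducible characters\<close>

context fin_group
begin

text \<open>In a basis adapted to a proper nonzero invariant subspace all matrices are block upper
  triangular. The diagonal blocks, which are the actions on the subspace and on the quotient, are
  multiplicative, and the trace sees only them.\<close>

lemma reducible_rep_split:
  assumes rep: "is_rep G n \<rho>" and n: "n > 0" and red: "\<not> irreducible_rep G n \<rho>"
  obtains m1 m2 \<rho>1 \<rho>2 where "m1 < n" "m2 < n" "is_rep G m1 \<rho>1" "is_rep G m2 \<rho>2"
    "\<And>g. g \<in> carrier G \<Longrightarrow> tr (\<rho> g) = tr (\<rho>1 g) + tr (\<rho>2 g)"
proof -
  from red rep n obtain W where W: "vec_subspace n W" "W \<noteq> {0\<^sub>v n}" "W \<noteq> carrier_vec n"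
    and inv: "\<And>g w. g \<in> carrier G \<Longrightarrow> w \<in> W \<Longrightarrow> \<rho> g *\<^sub>v w \<in> W"
    by (auto simp: irreducible_rep_def)
  obtain r Q R where r: "0 < r" "r < n" and Q: "Q \<in> carrier_mat n n" and R: "R \<in> carrier_mat n n"
    and QR: "Q * R = 1\<^sub>m n" and RQ: "R * Q = 1\<^sub>m n"
    and W_iff: "\<And>v. v \<in> carrier_vec n \<Longrightarrow> v \<in> W \<longleftrightarrow> (\<forall>i<n. r \<le> i \<longrightarrow> (R *\<^sub>v v) $ i = 0)"
    using adapted_basis[OF W] by blast
  note c = rep_carrier[OF rep]
  define P where "P g = R * (\<rho> g * Q)" for g
  have P: "P g \<in> carrier_mat n n" if "g \<in> carrier G" for g
    using c[OF that] Q R by (simp add: P_def)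
  have P_mult: "P (g \<otimes> h) = P g * P h" if g: "g \<in> carrier G" and h: "h \<in> carrier G" for g h
  proof -
    have cc: "\<rho> g * Q \<in> carrier_mat n n" "\<rho> h * Q \<in> carrier_mat n n"
      using c[OF g] c[OF h] Q by auto
    have "P g * P h = R * (\<rho> g * Q * (R * (\<rho> h * Q)))"
      unfolding P_def using R cc by (simp add: assoc_mult_mat[of _ n n _ n _ n])
    also have "\<rho> g * Q * (R * (\<rho> h * Q)) = \<rho> g * ((Q * R) * (\<rho> h * Q))"
      using R Q cc c[OF g] by (simp add: assoc_mult_mat[of _ n n _ n _ n])
    also have "\<dots> = \<rho> g * (\<rho> h * Q)" by (simp add: QR left_mult_one_mat[OF cc(2)])
    also have "\<dots> = \<rho> (g \<otimes> h) * Q"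
      unfolding rep_mult[OF rep g h] using c[OF g] c[OF h] Q by (simp add: assoc_mult_mat[of _ n n _ n _ n])
    finally show ?thesis by (simp add: P_def)
  qed
  have P_one: "P \<one> = 1\<^sub>m n" using R Q by (simp add: P_def rep_one[OF rep] RQ)
  have tr_P: "tr (P g) = tr (\<rho> g)" if g: "g \<in> carrier G" for g
  proof -
    have "tr (P g) = tr (\<rho> g * Q * R)"
      unfolding P_def by (rule tr_comm) (use R Q c[OF g] in auto)
    also have "\<rho> g * Q * R = \<rho> g" using R Q c[OF g] by (simp add: assoc_mult_mat[of _ n n _ n _ n] QR)
    finally show ?thesis .
  qed
  \<comment> \<open>Column \<open>j < r\<close> of \<open>Q\<close> lies in \<open>W\<close>, and so
    does its image under \<open>\<rho> g\<close>; the coordinates of that image from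
    \<open>r\<close> on are therefore 0.\<close>
  have P_zero: "P g $$ (i, j) = 0" if g: "g \<in> carrier G" and ij: "r \<le> i" "i < n" "j < r" for g i j
  proof -
    have jn: "j < n" using ij r by simp
    have e: "unit_vec n j \<in> carrier_vec n" by simp
    define w where "w = Q *\<^sub>v unit_vec n j"
    have w: "w \<in> carrier_vec n" using Q by (simp add: w_def)
    have "R *\<^sub>v w = unit_vec n j" unfolding w_def
      using assoc_mult_mat_vec[OF R Q e] by (simp add: RQ)
    then have "w \<in> W" using ij by (auto simp: W_iff[OF w])
    then have "\<rho> g *\<^sub>v w \<in> W" by (rule inv[OF g])
    moreover have "\<rho> g *\<^sub>v w \<in> carrier_vec n" using c[OF g] w by auto
    ultimately have z: "(R *\<^sub>v (\<rho> g *\<^sub>v w)) $ i = 0" using W_iff ij by blast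
    have rQ: "\<rho> g * Q \<in> carrier_mat n n" using c[OF g] Q by auto
    have "R *\<^sub>v (\<rho> g *\<^sub>v w) = P g *\<^sub>v unit_vec n j"
      unfolding w_def P_def assoc_mult_mat_vec[OF R rQ e] assoc_mult_mat_vec[OF c[OF g] Q e] ..
    then show ?thesis using z mat_unit_vec_entry[OF P[OF g] ij(2) jn] by simp
  qed
  define d where "d = n - r"
  have n_eq: "n = r + d" using r by (simp add: d_def)
  have P_entry: "P (g \<otimes> h) $$ (i, j) = (\<Sum>k<r. P g $$ (i, k) * P h $$ (k, j)) + (\<Sum>k<d. P g $$ (i, r + k) * P h $$ (r + k, j))"
    if "g \<in> carrier G" "h \<in> carrier G" "i < n" "j < n" for g h i j
    using mat_mult_entry[OF P[OF that(1)] P[OF that(2)] that(3,4)]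
    unfolding P_mult[OF that(1,2)] by (simp only: n_eq sum_lessThan_add)
  define A where "A g = mat r r (\<lambda>(i, j). P g $$ (i, j))" for g
  define D where "D g = mat d d (\<lambda>(i, j). P g $$ (r + i, r + j))" for g
  have A: "A g \<in> carrier_mat r r" and D: "D g \<in> carrier_mat d d" for g
    by (simp_all add: A_def D_def)
  have "is_rep G r A" unfolding is_rep_iff
  proof (intro conjI ballI)
    show "A \<one> = 1\<^sub>m r" using r by (intro eq_matI) (auto simp: A_def P_one)
    fix g h assume g: "g \<in> carrier G" and h: "h \<in> carrier G"
    show "A (g \<otimes> h) = A g * A h"
    proof (rule eq_matI)
      fix i j assume "i < dim_row (A g * A h)" "j < dim_col (A g * A h)"
      then have ij: "i < r" "j < r" using carrier_matD[OF A] by auto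
      have "A (g \<otimes> h) $$ (i, j) = (\<Sum>k<r. P g $$ (i, k) * P h $$ (k, j)) + (\<Sum>k<d. P g $$ (i, r + k) * P h $$ (r + k, j))"
        using P_entry[OF g h, of i j] ij r by (simp add: A_def)
      also have "(\<Sum>k<d. P g $$ (i, r + k) * P h $$ (r + k, j)) = 0"
        using P_zero[OF h] ij by (intro sum.neutral) (auto simp: n_eq)
      also have "(\<Sum>k<r. P g $$ (i, k) * P h $$ (k, j)) + 0 = (A g * A h) $$ (i, j)"
        unfolding mat_mult_entry[OF A A ij] using ij by (simp add: A_def)
      finally show "A (g \<otimes> h) $$ (i, j) = (A g * A h) $$ (i, j)" .
    qed (simp_all add: A_def)
  qed (simp add: A)
  moreover have "is_rep G d D" unfolding is_rep_iff
  proof (intro conjI ballI)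
    show "D \<one> = 1\<^sub>m d" using r by (intro eq_matI) (auto simp: D_def P_one n_eq)
    fix g h assume g: "g \<in> carrier G" and h: "h \<in> carrier G"
    show "D (g \<otimes> h) = D g * D h"
    proof (rule eq_matI)
      fix i j assume "i < dim_row (D g * D h)" "j < dim_col (D g * D h)"
      then have ij: "i < d" "j < d" using carrier_matD[OF D] by auto
      have "D (g \<otimes> h) $$ (i, j) = (\<Sum>k<r. P g $$ (r + i, k) * P h $$ (k, r + j)) + (\<Sum>k<d. P g $$ (r + i, r + k) * P h $$ (r + k, r + j))"
        using P_entry[OF g h, of "r + i" "r + j"] ij by (simp add: D_def n_eq)
      also have "(\<Sum>k<r. P g $$ (r + i, k) * P h $$ (k, r + j)) = 0"
        using P_zero[OF g] ij by (intro sum.neutral) (auto simp: n_eq)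
      also have "0 + (\<Sum>k<d. P g $$ (r + i, r + k) * P h $$ (r + k, r + j)) = (D g * D h) $$ (i, j)"
        unfolding mat_mult_entry[OF D D ij] using ij by (simp add: D_def)
      finally show "D (g \<otimes> h) $$ (i, j) = (D g * D h) $$ (i, j)" .
    qed (simp_all add: D_def)
  qed (simp add: D)
  moreover have "tr (\<rho> g) = tr (A g) + tr (D g)" if g: "g \<in> carrier G" for g
    unfolding tr_P[OF g, symmetric] tr_carrier[OF A] tr_carrier[OF D] tr_carrier[OF P[OF g]]
    by (subst n_eq, subst sum_lessThan_add) (simp add: A_def D_def)
  ultimately show thesis using that[of r d A D] r by (auto simp: d_def)
qed

text \<open>Induction on the degree by splitting off blocks. A list rather than a set records the
  multiplicities, and degree 0 yields the empty list.\<close>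

theorem rep_character_decompose:
  assumes "is_rep G n \<rho>"
  shows "\<exists>L. set L \<subseteq> Irr G \<and> (\<forall>g\<in>carrier G. tr (\<rho> g) = (\<Sum>\<psi>\<leftarrow>L. \<psi> g))"
  using assms
proof (induction n arbitrary: \<rho> rule: less_induct)
  case (less n)
  show ?case
  proof (cases "n = 0")
    case True
    then have "tr (\<rho> g) = 0" if "g \<in> carrier G" for g
      using rep_carrier[OF less.prems that] by (simp add: tr_carrier)
    then show ?thesis by (intro exI[of _ "[]"]) simp
  next
    case False
    show ?thesis
    proof (cases "irreducible_rep G n \<rho>")
      case True
      then show ?thesis
        by (intro exI[of _ "[rep_character G n \<rho>]"])
          (auto simp: Irr_def rep_character_eq[OF less.prems])
    next
      case red: False
      obtain m1 m2 \<rho>1 \<rho>2 where split: "m1 < n" "m2 < n" "is_rep G m1 \<rho>1" "is_rep G m2 \<rho>2"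
        "\<And>g. g \<in> carrier G \<Longrightarrow> tr (\<rho> g) = tr (\<rho>1 g) + tr (\<rho>2 g)"
        using reducible_rep_split[OF less.prems _ red] False by blast
      obtain L1 L2 where "set L1 \<subseteq> Irr G" "\<forall>g\<in>carrier G. tr (\<rho>1 g) = (\<Sum>\<psi>\<leftarrow>L1. \<psi> g)"
        "set L2 \<subseteq> Irr G" "\<forall>g\<in>carrier G. tr (\<rho>2 g) = (\<Sum>\<psi>\<leftarrow>L2. \<psi> g)"
        using less.IH split by meson
      then show ?thesis using split(5) by (intro exI[of _ "L1 @ L2"]) simp
    qed
  qed
qed

section \<open>Orthogonality relations for irreducible characters\<close>

lemma Irr_E:
  assumes "\<chi> \<in> Irr G"
  obtains n \<rho> where "irreducible_rep G n \<rho>" "\<chi> = rep_character G n \<rho>"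
    "\<And>g. g \<in> carrier G \<Longrightarrow> \<chi> g = tr (\<rho> g)" "\<chi> \<one> = of_nat n" "n > 0"
proof -
  from assms obtain n \<rho> where \<rho>: "irreducible_rep G n \<rho>" "\<chi> = rep_character G n \<rho>"
    by (auto simp: Irr_def)
  note rep = irreducible_is_rep[OF \<rho>(1)]
  show thesis
    using that[OF \<rho>] irreducible_pos[OF \<rho>(1)] rep_character_eq[OF rep] rep_character_one[OF rep] \<rho>(2)
    by simp
qed

text \<open>The trace products with identity matrices in place of \<open>A\<close> and
  \<open>B\<close>. Inverses stand where \<open>char_inner\<close> has complex conjugates;
  \<open>Irr_cnj\<close> mediates between the two.\<close>

lemma Irr_orthogonality:
  assumes "\<chi> \<in> Irr G" "\<psi> \<in> Irr G"
  shows "(\<Sum>g\<in>carrier G. \<chi> g * \<psi> (inv g)) = (if \<chi> = \<psi> then of_nat (card (carrier G)) else 0)"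
proof -
  obtain n \<rho> where \<rho>: "irreducible_rep G n \<rho>" "\<chi> = rep_character G n \<rho>" "\<And>g. g \<in> carrier G \<Longrightarrow> \<chi> g = tr (\<rho> g)" "n > 0"
    using Irr_E[OF assms(1)] by blast
  obtain m \<tau> where \<tau>: "irreducible_rep G m \<tau>" "\<psi> = rep_character G m \<tau>" "\<And>g. g \<in> carrier G \<Longrightarrow> \<psi> g = tr (\<tau> g)"
    using Irr_E[OF assms(2)] by blast
  note c = rep_carrier[OF irreducible_is_rep[OF \<rho>(1)]] rep_carrier[OF irreducible_is_rep[OF \<tau>(1)]]
  show ?thesis
  proof (cases "\<chi> = \<psi>")
    case True
    have "(\<Sum>g\<in>carrier G. \<chi> g * \<psi> (inv g)) = (\<Sum>g\<in>carrier G. tr (\<rho> g * 1\<^sub>m n) * tr (1\<^sub>m n * \<rho> (inv g)))"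
      by (intro sum.cong) (auto simp: \<rho>(3) True[symmetric] right_mult_one_mat[OF c(1)] left_mult_one_mat[OF c(1)])
    also have "\<dots> = of_nat (card (carrier G))"
      using tr_product_same[OF \<rho>(1), of "1\<^sub>m n" "1\<^sub>m n"] \<rho>(4) by (simp add: tr_one)
    finally show ?thesis using True by simp
  next
    case False
    have "(\<Sum>g\<in>carrier G. \<chi> g * \<psi> (inv g)) = (\<Sum>g\<in>carrier G. tr (\<rho> g * 1\<^sub>m n) * tr (1\<^sub>m m * \<tau> (inv g)))"
      by (intro sum.cong) (auto simp: \<rho>(3) \<tau>(3) right_mult_one_mat[OF c(1)] left_mult_one_mat[OF c(2)])
    also have "\<dots> = 0"
      using tr_product_distinct[OF \<rho>(1) \<tau>(1), of "1\<^sub>m n" "1\<^sub>m m"] False by (simp add: \<rho>(2) \<tau>(2))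
    finally show ?thesis using False by simp
  qed
qed

lemma Irr_cnj:
  assumes "\<chi> \<in> Irr G" "g \<in> carrier G"
  shows "cnj (\<chi> g) = \<chi> (inv g)"
proof -
  obtain n \<rho> where \<rho>: "irreducible_rep G n \<rho>" "\<And>g. g \<in> carrier G \<Longrightarrow> \<chi> g = tr (\<rho> g)"
    using Irr_E[OF assms(1)] by metis
  show ?thesis using cnj_tr_rep[OF irreducible_is_rep[OF \<rho>(1)] assms(2)] assms(2) by (simp add: \<rho>(2))
qed

lemma Irr_one_nonzero: "\<chi> \<in> Irr G \<Longrightarrow> \<chi> \<one> \<noteq> 0"
  by (erule Irr_E) simp

lemma char_inner_Irr:
  "\<psi> \<in> Irr G \<Longrightarrow> char_inner G \<phi> \<psi> = (\<Sum>g\<in>carrier G. \<phi> g * \<psi> (inv g)) / of_nat (card (carrier G))"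
  unfolding char_inner_def by (auto simp: Irr_cnj intro!: sum.cong)

lemma sum_list_orthogonality:
  assumes "set L \<subseteq> Irr G" "\<psi> \<in> Irr G"
  shows "(\<Sum>g\<in>carrier G. (\<Sum>\<phi>\<leftarrow>L. \<phi> g) * \<psi> (inv g)) = of_nat (card (carrier G)) * of_nat (count_list L \<psi>)"
  using assms(1)
  by (induction L) (auto simp: distrib_right sum.distrib Irr_orthogonality assms(2) algebra_simps)

text \<open>The list decomposes the regular representation, given by permutation matrices after
  \<open>e\<close> has numbered the group. Left multiplication by an element other than the identity
  has no fixed point, so the trace vanishes there.\<close>

lemma regular_character:
  "\<exists>L. set L \<subseteq> Irr G \<and> (\<forall>g\<in>carrier G. (\<Sum>\<psi>\<leftarrow>L. \<psi> g) = (if g = \<one> then of_nat (card (carrier G)) else 0))"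
proof -
  obtain e where e: "bij_betw e {..<card (carrier G)} (carrier G)"
    using ex_bij_betw_nat_finite[OF finite_carrier] by (auto simp: atLeast0LessThan)
  define N where "N = card (carrier G)"
  have eG: "e i \<in> carrier G" if "i < N" for i
    using e that by (auto simp: bij_betw_def N_def)
  have e_eq: "e i = e j \<longleftrightarrow> i = j" if "i < N" "j < N" for i j
    using e that by (auto simp: bij_betw_def N_def inj_on_def)
  define \<rho> where "\<rho> g = mat N N (\<lambda>(i, j). if e i = g \<otimes> e j then 1 else 0 :: complex)" for g
  have c: "\<rho> g \<in> carrier_mat N N" for g by (simp add: \<rho>_def)
  have "is_rep G N \<rho>" unfolding is_rep_iff
  proof (intro conjI ballI)
    show "\<rho> \<one> = 1\<^sub>m N" by (intro eq_matI) (auto simp: \<rho>_def eG e_eq)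
    fix g h assume g: "g \<in> carrier G" and h: "h \<in> carrier G"
    show "\<rho> (g \<otimes> h) = \<rho> g * \<rho> h"
    proof (rule eq_matI)
      fix i j assume "i < dim_row (\<rho> g * \<rho> h)" "j < dim_col (\<rho> g * \<rho> h)"
      then have ij: "i < N" "j < N" by (auto simp: \<rho>_def)
      have "(\<rho> g * \<rho> h) $$ (i, j) = (\<Sum>k<N. (if e i = g \<otimes> e k then 1 else 0) * (if e k = h \<otimes> e j then 1 else 0))"
        unfolding mat_mult_entry[OF c c ij] using ij by (intro sum.cong) (auto simp: \<rho>_def)
      also have "\<dots> = (\<Sum>y\<in>carrier G. (if e i = g \<otimes> y then 1 else 0) * (if y = h \<otimes> e j then 1 else 0))"
        unfolding N_def
        by (rule sum.reindex_bij_betw[OF e, of "\<lambda>y. (if e i = g \<otimes> y then 1 else 0) * (if y = h \<otimes> e j then 1 else 0)"])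
      also have "\<dots> = (\<Sum>y\<in>carrier G. if y = h \<otimes> e j then (if e i = g \<otimes> y then 1 else 0) else 0)"
        by (intro sum.cong) auto
      also have "\<dots> = (if e i = g \<otimes> (h \<otimes> e j) then 1 else 0)"
        using h eG[OF ij(2)] finite_carrier by (subst sum.delta) auto
      also have "\<dots> = \<rho> (g \<otimes> h) $$ (i, j)"
        using g h eG[OF ij(2)] ij by (simp add: \<rho>_def m_assoc)
      finally show "\<rho> (g \<otimes> h) $$ (i, j) = (\<rho> g * \<rho> h) $$ (i, j)" ..
    qed (simp_all add: \<rho>_def)
  qed (rule c)
  then obtain L where L: "set L \<subseteq> Irr G" "\<forall>g\<in>carrier G. tr (\<rho> g) = (\<Sum>\<psi>\<leftarrow>L. \<psi> g)"
    using rep_character_decompose by blast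
  have "tr (\<rho> g) = (if g = \<one> then of_nat N else 0)" if g: "g \<in> carrier G" for g
  proof -
    have "e i = g \<otimes> e i \<longleftrightarrow> g = \<one>" if "i < N" for i
      using eG[OF that] g by simp
    then show ?thesis unfolding tr_carrier[OF c] by (simp add: \<rho>_def)
  qed
  then have "(\<Sum>\<psi>\<leftarrow>L. \<psi> g) = (if g = \<one> then of_nat (card (carrier G)) else 0)" if "g \<in> carrier G" for g
    using L(2) that by (simp add: N_def)
  with L(1) show ?thesis by blast
qed

text \<open>Pairing the regular character with \<psi> shows that \<psi> occurs \<psi>(1) times in
  it. This number is not 0, so the list contains every irreducible character, and collecting equal
  entries gives the column relation.\<close>

lemma
  shows finite_Irr: "finite (Irr G)"
    and column_orthogonality: "g \<in> carrier G \<Longrightarrow>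
      (\<Sum>\<psi>\<in>Irr G. \<psi> \<one> * \<psi> g) = (if g = \<one> then of_nat (card (carrier G)) else 0)"
proof -
  obtain L where L: "set L \<subseteq> Irr G"
    "\<And>g. g \<in> carrier G \<Longrightarrow> (\<Sum>\<psi>\<leftarrow>L. \<psi> g) = (if g = \<one> then of_nat (card (carrier G)) else 0)"
    using regular_character by blast
  have mult: "of_nat (count_list L \<psi>) = \<psi> \<one>" if \<psi>: "\<psi> \<in> Irr G" for \<psi>
  proof -
    have "of_nat (card (carrier G)) * of_nat (count_list L \<psi>)
        = (\<Sum>g\<in>carrier G. (if g = \<one> then of_nat (card (carrier G)) * \<psi> (inv g) else 0))"
      unfolding sum_list_orthogonality[OF L(1) \<psi>, symmetric]
      by (intro sum.cong) (auto simp: L(2))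
    also have "\<dots> = of_nat (card (carrier G)) * \<psi> \<one>"
      using finite_carrier by (subst sum.delta) auto
    finally show ?thesis using card_pos by simp
  qed
  have "\<psi> \<in> set L" if "\<psi> \<in> Irr G" for \<psi>
    using mult[OF that] Irr_one_nonzero[OF that] count_notin by fastforce
  with L(1) have Irr: "Irr G = set L" by blast
  then show "finite (Irr G)" by simp
  have sum_count: "(\<Sum>\<psi>\<leftarrow>L'. \<psi> g) = (\<Sum>\<psi>\<in>S. of_nat (count_list L' \<psi>) * \<psi> g)"
    if "set L' \<subseteq> S" "finite S" for L' :: "('a \<Rightarrow> complex) list" and S g
    using that
  proof (induction L')
    case (Cons \<phi> L')
    have "(\<Sum>\<psi>\<in>S. of_nat (count_list (\<phi> # L') \<psi>) * \<psi> g)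
        = (\<Sum>\<psi>\<in>S. of_nat (count_list L' \<psi>) * \<psi> g + (if \<psi> = \<phi> then \<psi> g else 0))"
      by (intro sum.cong) (auto simp: algebra_simps)
    also have "\<dots> = (\<Sum>\<psi>\<in>S. of_nat (count_list L' \<psi>) * \<psi> g) + \<phi> g"
      using Cons.prems by (simp add: sum.distrib)
    finally show ?case using Cons by simp
  qed simp
  show "(\<Sum>\<psi>\<in>Irr G. \<psi> \<one> * \<psi> g) = (if g = \<one> then of_nat (card (carrier G)) else 0)" if "g \<in> carrier G"
    unfolding L(2)[OF that, symmetric] using sum_count[of L "Irr G" g] Irr mult by simp
qed

section \<open>Class functions that are idempotent up to the group order\<close>

lemma class_function_scalar:
  assumes cls: "\<And>x y. x \<in> carrier G \<Longrightarrow> y \<in> carrier G \<Longrightarrow> f (y \<otimes> x \<otimes> inv y) = f x"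
    and idem: "\<And>x. x \<in> carrier G \<Longrightarrow> (\<Sum>y\<in>carrier G. f y * f (inv y \<otimes> x)) = of_nat (card (carrier G)) * f x"
    and \<chi>: "\<chi> \<in> Irr G"
  obtains \<omega> where "\<And>x. x \<in> carrier G \<Longrightarrow> (\<Sum>y\<in>carrier G. f y * \<chi> (inv y \<otimes> x)) = \<omega> * \<chi> x"
    "\<omega> = 0 \<or> \<omega> = of_nat (card (carrier G))"
proof -
  obtain n \<rho> where \<rho>: "irreducible_rep G n \<rho>" "\<And>g. g \<in> carrier G \<Longrightarrow> \<chi> g = tr (\<rho> g)" "n > 0"
    using Irr_E[OF \<chi>] by blast
  note rep = irreducible_is_rep[OF \<rho>(1)]
  note c = rep_carrier[OF rep]
  \<comment> \<open>\<open>Z\<close> is the operator by which \<open>f\<close> acts on the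
    representation space. Invariance of \<open>f\<close> under conjugation makes it commute with
    \<open>\<rho>\<close>, so it is a scalar, and the convolution of \<open>f\<close> with \<chi> is
    that multiple of \<chi>.\<close>
  define Z where "Z = mat n n (\<lambda>(i, j). \<Sum>y\<in>carrier G. f y * \<rho> (inv y) $$ (i, j))"
  have Z: "Z \<in> carrier_mat n n" by (simp add: Z_def)
  have Zentry: "Z $$ (i, j) = (\<Sum>y\<in>carrier G. f y * \<rho> (inv y) $$ (i, j))" if "i < n" "j < n" for i j
    using that by (simp add: Z_def)
  have Zright: "(Z * \<rho> x) $$ (i, j) = (\<Sum>y\<in>carrier G. f y * \<rho> (inv y \<otimes> x) $$ (i, j))"
    if x: "x \<in> carrier G" and ij: "i < n" "j < n" for x i j
  proof -
    have "(Z * \<rho> x) $$ (i, j) = (\<Sum>k<n. \<Sum>y\<in>carrier G. f y * (\<rho> (inv y) $$ (i, k) * \<rho> x $$ (k, j)))"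
      unfolding mat_mult_entry[OF Z c[OF x] ij] using ij by (intro sum.cong) (auto simp: Zentry sum_distrib_right mult.assoc)
    also have "\<dots> = (\<Sum>y\<in>carrier G. f y * (\<Sum>k<n. \<rho> (inv y) $$ (i, k) * \<rho> x $$ (k, j)))"
      by (subst sum.swap) (simp add: sum_distrib_left)
    also have "\<dots> = (\<Sum>y\<in>carrier G. f y * \<rho> (inv y \<otimes> x) $$ (i, j))"
      using rep_mult_entry[OF rep _ x ij] by (intro sum.cong) auto
    finally show ?thesis .
  qed
  have Zleft: "(\<rho> x * Z) $$ (i, j) = (\<Sum>y\<in>carrier G. f y * \<rho> (x \<otimes> inv y) $$ (i, j))"
    if x: "x \<in> carrier G" and ij: "i < n" "j < n" for x i j
  proof -
    have "(\<rho> x * Z) $$ (i, j) = (\<Sum>k<n. \<Sum>y\<in>carrier G. f y * (\<rho> x $$ (i, k) * \<rho> (inv y) $$ (k, j)))"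
      unfolding mat_mult_entry[OF c[OF x] Z ij] using ij by (intro sum.cong) (auto simp: Zentry sum_distrib_left mult_ac)
    also have "\<dots> = (\<Sum>y\<in>carrier G. f y * (\<Sum>k<n. \<rho> x $$ (i, k) * \<rho> (inv y) $$ (k, j)))"
      by (subst sum.swap) (simp add: sum_distrib_left)
    also have "\<dots> = (\<Sum>y\<in>carrier G. f y * \<rho> (x \<otimes> inv y) $$ (i, j))"
      using rep_mult_entry[OF rep x _ ij] by (intro sum.cong) auto
    finally show ?thesis .
  qed
  have "\<rho> h * Z = Z * \<rho> h" if h: "h \<in> carrier G" for h
  proof (rule eq_matI)
    fix i j assume "i < dim_row (Z * \<rho> h)" "j < dim_col (Z * \<rho> h)"
    then have ij: "i < n" "j < n" using Z c[OF h] by auto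
    have "(\<rho> h * Z) $$ (i, j) = (\<Sum>y\<in>carrier G. f (h \<otimes> (y \<otimes> inv h)) * \<rho> (inv (h \<otimes> (y \<otimes> inv h)) \<otimes> h) $$ (i, j))"
      unfolding Zleft[OF h ij] using h cls[of _ h]
      by (intro sum.cong) (auto simp: inv_mult_group m_assoc)
    also have "\<dots> = (\<Sum>y\<in>carrier G. f (y \<otimes> inv h) * \<rho> (inv (y \<otimes> inv h) \<otimes> h) $$ (i, j))"
      using sum_right_translate[OF inv_closed[OF h], of "\<lambda>y. f (h \<otimes> y) * \<rho> (inv (h \<otimes> y) \<otimes> h) $$ (i, j)"]
        sum_left_translate[OF h, of "\<lambda>y. f y * \<rho> (inv y \<otimes> h) $$ (i, j)"]
        sum_right_translate[OF inv_closed[OF h], of "\<lambda>y. f y * \<rho> (inv y \<otimes> h) $$ (i, j)"] by simp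
    also have "\<dots> = (\<Sum>y\<in>carrier G. f y * \<rho> (inv y \<otimes> h) $$ (i, j))"
      by (rule sum_right_translate[OF inv_closed[OF h], of "\<lambda>y. f y * \<rho> (inv y \<otimes> h) $$ (i, j)"])
    also have "\<dots> = (Z * \<rho> h) $$ (i, j)" by (rule Zright[OF h ij, symmetric])
    finally show "(\<rho> h * Z) $$ (i, j) = (Z * \<rho> h) $$ (i, j)" .
  qed (use Z c[OF h] in auto)
  then obtain \<omega> where \<omega>: "Z = \<omega> \<cdot>\<^sub>m 1\<^sub>m n" using schur_scalar[OF \<rho>(1) Z] by blast
  have "(\<Sum>y\<in>carrier G. f y * \<chi> (inv y \<otimes> x)) = \<omega> * \<chi> x" if x: "x \<in> carrier G" for x
  proof -
    have "(\<Sum>y\<in>carrier G. f y * \<chi> (inv y \<otimes> x)) = (\<Sum>y\<in>carrier G. \<Sum>i<n. f y * \<rho> (inv y \<otimes> x) $$ (i, i))"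
      using x by (intro sum.cong) (auto simp: \<rho>(2) tr_carrier[OF c] sum_distrib_left)
    also have "\<dots> = (\<Sum>i<n. (Z * \<rho> x) $$ (i, i))"
      by (subst sum.swap) (simp add: Zright[OF x] del: index_mult_mat)
    also have "\<dots> = tr (Z * \<rho> x)" using Z c[OF x] by (subst tr_carrier) auto
    also have "Z * \<rho> x = \<omega> \<cdot>\<^sub>m \<rho> x"
      unfolding \<omega> using c[OF x] by (simp add: mult_smult_assoc_mat[OF one_carrier_mat])
    finally show ?thesis using c[OF x] x by (simp add: tr_smult \<rho>(2))
  qed
  \<comment> \<open>The convolution identity for \<open>f\<close> becomes \<open>Z * Z\<close> = |G|
    \<open>Z\<close>, a quadratic equation for the scalar.\<close>
  moreover have "\<omega> = 0 \<or> \<omega> = of_nat (card (carrier G))"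
  proof -
    have "(Z * Z) $$ (i, j) = of_nat (card (carrier G)) * Z $$ (i, j)" if ij: "i < n" "j < n" for i j
    proof -
      have "(Z * Z) $$ (i, j) = (\<Sum>k<n. \<Sum>z\<in>carrier G. f z * (Z $$ (i, k) * \<rho> (inv z) $$ (k, j)))"
        unfolding mat_mult_entry[OF Z Z ij] using ij
        by (intro sum.cong) (auto simp: Zentry[of _ j] sum_distrib_left mult_ac)
      also have "\<dots> = (\<Sum>z\<in>carrier G. f z * (Z * \<rho> (inv z)) $$ (i, j))"
        by (subst sum.swap, intro sum.cong refl)
          (simp add: mat_mult_entry[OF Z c[OF inv_closed] ij] sum_distrib_left del: index_mult_mat)
      also have "\<dots> = (\<Sum>z\<in>carrier G. \<Sum>y\<in>carrier G. f z * (f y * \<rho> (inv y \<otimes> inv z) $$ (i, j)))"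
        by (intro sum.cong) (auto simp: Zright[OF inv_closed ij] sum_distrib_left simp del: index_mult_mat)
      also have "\<dots> = (\<Sum>z\<in>carrier G. \<Sum>y\<in>carrier G. f z * (f (inv z \<otimes> y) * \<rho> (inv (inv z \<otimes> y) \<otimes> inv z) $$ (i, j)))"
      proof (rule sum.cong[OF refl])
        fix z assume "z \<in> carrier G"
        then show "(\<Sum>y\<in>carrier G. f z * (f y * \<rho> (inv y \<otimes> inv z) $$ (i, j)))
          = (\<Sum>y\<in>carrier G. f z * (f (inv z \<otimes> y) * \<rho> (inv (inv z \<otimes> y) \<otimes> inv z) $$ (i, j)))"
          using sum_left_translate[of "inv z" "\<lambda>y. f z * (f y * \<rho> (inv y \<otimes> inv z) $$ (i, j))"] by simp
      qed
      also have "\<dots> = (\<Sum>z\<in>carrier G. \<Sum>y\<in>carrier G. f z * f (inv z \<otimes> y) * \<rho> (inv y) $$ (i, j))"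
        by (intro sum.cong) (auto simp: inv_mult_group m_assoc)
      also have "\<dots> = (\<Sum>y\<in>carrier G. (\<Sum>z\<in>carrier G. f z * f (inv z \<otimes> y)) * \<rho> (inv y) $$ (i, j))"
        by (subst sum.swap) (simp add: sum_distrib_right)
      also have "\<dots> = of_nat (card (carrier G)) * Z $$ (i, j)"
        using ij by (simp add: idem Zentry sum_distrib_left mult.assoc)
      finally show ?thesis .
    qed
    from this[OF \<rho>(3) \<rho>(3)] have "\<omega> * \<omega> = of_nat (card (carrier G)) * \<omega>"
      using \<rho>(3) unfolding mat_mult_entry[OF Z Z \<rho>(3) \<rho>(3)]
      by (simp add: \<omega> sum.delta if_distrib cong: if_cong)
    then show ?thesis by simp
  qed
  ultimately show thesis using that by blast
qed

text \<open>By column orthogonality, convolving \<open>f\<close> with the sum of all \<chi>(1)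
  \<chi> gives |G| \<open>f\<close>. Each single \<chi> contributes |G| \<chi> or 0, and evaluating
  the convolution at the identity shows that the inner product decides which.\<close>

theorem idempotent_class_function_expansion:
  assumes cls: "\<And>x y. x \<in> carrier G \<Longrightarrow> y \<in> carrier G \<Longrightarrow> f (y \<otimes> x \<otimes> inv y) = f x"
    and idem: "\<And>x. x \<in> carrier G \<Longrightarrow> (\<Sum>y\<in>carrier G. f y * f (inv y \<otimes> x)) = of_nat (card (carrier G)) * f x"
    and x: "x \<in> carrier G"
  shows "f x = (\<Sum>\<chi>\<in>{\<chi> \<in> Irr G. char_inner G \<chi> f \<noteq> 0}. \<chi> \<one> * \<chi> x)"
proof -
  let ?N = "of_nat (card (carrier G)) :: complex"
  have N: "?N \<noteq> 0" using card_pos by simp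
  have conv: "(\<Sum>y\<in>carrier G. f y * \<chi> (inv y \<otimes> x)) = (if char_inner G \<chi> f \<noteq> 0 then ?N * \<chi> x else 0)"
    if \<chi>: "\<chi> \<in> Irr G" for \<chi>
  proof -
    obtain \<omega> where \<omega>: "\<And>x. x \<in> carrier G \<Longrightarrow> (\<Sum>y\<in>carrier G. f y * \<chi> (inv y \<otimes> x)) = \<omega> * \<chi> x"
      "\<omega> = 0 \<or> \<omega> = of_nat (card (carrier G))"
      using class_function_scalar[OF cls idem \<chi>] by blast
    have "(\<Sum>y\<in>carrier G. f y * \<chi> (inv y)) = \<omega> * \<chi> \<one>"
      using \<omega>(1)[OF one_closed] by simp
    moreover have "char_inner G \<chi> f = cnj (\<Sum>y\<in>carrier G. f y * \<chi> (inv y)) / ?N"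
      unfolding char_inner_def by (simp add: Irr_cnj[OF \<chi>, symmetric] mult.commute)
    ultimately have "char_inner G \<chi> f \<noteq> 0 \<longleftrightarrow> \<omega> \<noteq> 0"
      using N Irr_one_nonzero[OF \<chi>] by simp
    then show ?thesis using \<omega>(1)[OF x] \<omega>(2) by auto
  qed
  have "?N * f x = (\<Sum>y\<in>carrier G. if y = x then ?N * f y else 0)"
    using finite_carrier x by simp
  also have "\<dots> = (\<Sum>y\<in>carrier G. f y * (\<Sum>\<chi>\<in>Irr G. \<chi> \<one> * \<chi> (inv y \<otimes> x)))"
  proof (intro sum.cong refl)
    fix y assume y: "y \<in> carrier G"
    have "inv y \<otimes> x = \<one> \<longleftrightarrow> y = x" using x y by (metis inv_closed inv_inv inv_equality l_inv)
    then show "(if y = x then ?N * f y else 0) = f y * (\<Sum>\<chi>\<in>Irr G. \<chi> \<one> * \<chi> (inv y \<otimes> x))"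
      using x y by (simp add: column_orthogonality)
  qed
  also have "\<dots> = (\<Sum>\<chi>\<in>Irr G. \<chi> \<one> * (\<Sum>y\<in>carrier G. f y * \<chi> (inv y \<otimes> x)))"
    unfolding sum_distrib_left by (subst sum.swap) (simp add: mult_ac)
  also have "\<dots> = (\<Sum>\<chi>\<in>Irr G. if char_inner G \<chi> f \<noteq> 0 then ?N * (\<chi> \<one> * \<chi> x) else 0)"
    by (intro sum.cong) (auto simp: conv)
  also have "\<dots> = ?N * (\<Sum>\<chi>\<in>{\<chi> \<in> Irr G. char_inner G \<chi> f \<noteq> 0}. \<chi> \<one> * \<chi> x)"
    using finite_Irr by (simp add: sum.inter_filter[symmetric] sum_distrib_left)
  finally show ?thesis using N by simp
qed

end

section \<open>The Glauberman correspondence for an involution\<close>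

context fin_group
begin

text \<open>Were all averaged matrix units \<open>M a b\<close> zero, the pairing of the two
  characters would vanish, whereas the pairing of an irreducible character with itself is
  |G|.\<close>

lemma irreducible_intertwiner:
  assumes irr: "irreducible_rep G n \<rho>" "irreducible_rep G m \<tau>"
    and eq: "rep_character G n \<rho> = rep_character G m \<tau>"
  obtains M where "M \<in> carrier_mat n m" "\<And>g. g \<in> carrier G \<Longrightarrow> \<rho> g * M = M * \<tau> g" "M \<noteq> 0\<^sub>m n m"
proof -
  note rep = irr[THEN irreducible_is_rep]
  define M where "M a b = mat n m (\<lambda>(i, j). \<Sum>g\<in>carrier G. \<rho> g $$ (i, a) * \<tau> (inv g) $$ (b, j))" for a b
  have M: "M a b \<in> carrier_mat n m" for a b by (simp add: M_def)
  have "\<exists>a<n. \<exists>b<m. M a b \<noteq> 0\<^sub>m n m"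
  proof (rule ccontr)
    assume *: "\<not> (\<exists>a<n. \<exists>b<m. M a b \<noteq> 0\<^sub>m n m)"
    have z: "(\<Sum>g\<in>carrier G. \<rho> g $$ (i, a) * \<tau> (inv g) $$ (b, j)) = 0" if "i < n" "a < n" "b < m" "j < m" for i a b j
    proof -
      have "M a b $$ (i, j) = 0" using * that by simp
      then show ?thesis using that by (simp add: M_def)
    qed
    have "(\<Sum>g\<in>carrier G. tr (\<rho> g * 1\<^sub>m n) * tr (1\<^sub>m m * \<tau> (inv g))) = 0"
      unfolding tr_product[OF rep one_carrier_mat one_carrier_mat] by (intro sum.neutral ballI) (simp add: z)
    moreover have "(\<Sum>g\<in>carrier G. tr (\<rho> g * 1\<^sub>m n) * tr (1\<^sub>m m * \<tau> (inv g)))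
      = (\<Sum>g\<in>carrier G. rep_character G n \<rho> g * rep_character G m \<tau> (inv g))"
      using rep by (intro sum.cong)
        (auto simp: rep_character_eq right_mult_one_mat[OF rep_carrier[OF rep(1)]] left_mult_one_mat[OF rep_carrier[OF rep(2)]])
    moreover have "\<dots> = of_nat (card (carrier G))"
      using Irr_orthogonality[of "rep_character G n \<rho>" "rep_character G m \<tau>"] irr eq by (auto simp: Irr_def)
    ultimately show False using card_pos by simp
  qed
  then obtain a b where ab: "a < n" "b < m" "M a b \<noteq> 0\<^sub>m n m" by blast
  show thesis
    by (rule that[OF M _ ab(3)]) (unfold M_def, rule schur_average[OF rep ab(1,2)])
qed

text \<open>Direct product with a group of order two: \<open>True\<close> is the nontrivial element
  and exclusive or the multiplication. A representation together with a commuting involution becomes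
  one representation of this group.\<close>

definition sign_ext :: "('a \<times> bool) monoid" where
  "sign_ext = \<lparr>carrier = carrier G \<times> UNIV, monoid.mult = (\<lambda>(a, x) (b, y). (a \<otimes> b, x \<noteq> y)), one = (\<one>, False)\<rparr>"

lemma sign_ext_simps [simp]:
  "carrier sign_ext = carrier G \<times> UNIV"
  "(a, x) \<otimes>\<^bsub>sign_ext\<^esub> (b, y) = (a \<otimes> b, x \<noteq> y)"
  "\<one>\<^bsub>sign_ext\<^esub> = (\<one>, False)"
  by (simp_all add: sign_ext_def)

lemma fin_group_sign_ext: "fin_group sign_ext"
proof -
  have "group sign_ext"
  proof (rule groupI)
    show "\<exists>y\<in>carrier sign_ext. y \<otimes>\<^bsub>sign_ext\<^esub> x = \<one>\<^bsub>sign_ext\<^esub>" if "x \<in> carrier sign_ext" for x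
      using that by (intro bexI[of _ "(inv (fst x), snd x)"]) (cases x; auto)+
  qed (auto simp: m_assoc)
  then show ?thesis
    by (intro fin_group.intro fin_group_axioms.intro) (auto simp: finite_carrier)
qed

text \<open>The central element \<open>(\<one>, True)\<close> acts by a scalar whose square is 1. A
  subspace invariant under \<open>G\<close> is therefore invariant under the whole product, so the
  restriction to \<open>G\<close> stays irreducible.\<close>

lemma Irr_sign_ext:
  assumes "\<psi> \<in> Irr sign_ext"
  obtains \<phi> and e :: int where "\<phi> \<in> Irr G" "e = 1 \<or> e = -1"
    "\<And>g. g \<in> carrier G \<Longrightarrow> \<psi> (g, False) = \<phi> g" "\<And>g. g \<in> carrier G \<Longrightarrow> \<psi> (g, True) = of_int e * \<phi> g"
proof -
  interpret K: fin_group sign_ext by (rule fin_group_sign_ext)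
  obtain n \<tau> where \<tau>: "irreducible_rep sign_ext n \<tau>" "\<And>g. g \<in> carrier sign_ext \<Longrightarrow> \<psi> g = tr (\<tau> g)" "n > 0"
    using K.Irr_E[OF assms] by metis
  note Krep = K.irreducible_is_rep[OF \<tau>(1)]
  have c: "\<tau> (g, x) \<in> carrier_mat n n" if "g \<in> carrier G" for g x
    using K.rep_carrier[OF Krep] that by simp
  have mult: "\<tau> (g \<otimes> h, x \<noteq> y) = \<tau> (g, x) * \<tau> (h, y)" if "g \<in> carrier G" "h \<in> carrier G" for g h x y
    using K.rep_mult[OF Krep, of "(g, x)" "(h, y)"] that by simp
  have one: "\<tau> (\<one>, False) = 1\<^sub>m n" using K.rep_one[OF Krep] by simp
  define E where "E = \<tau> (\<one>, True)"
  have E: "E \<in> carrier_mat n n" using c by (simp add: E_def)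
  have "\<tau> g * E = E * \<tau> g" if g: "g \<in> carrier sign_ext" for g
    using g mult[of "fst g" \<one> "snd g" True] mult[of \<one> "fst g" True "snd g"]
    by (cases g) (auto simp: E_def)
  then obtain \<epsilon> where \<epsilon>: "E = \<epsilon> \<cdot>\<^sub>m 1\<^sub>m n" using K.schur_scalar[OF \<tau>(1) E] by blast
  have "E * E = 1\<^sub>m n" using mult[of \<one> \<one> True True] one by (simp add: E_def)
  moreover have "E * E = (\<epsilon> * \<epsilon>) \<cdot>\<^sub>m 1\<^sub>m n"
    unfolding \<epsilon> by (intro eq_matI) (auto simp: mult_smult_assoc_mat[OF one_carrier_mat])
  ultimately have "(\<epsilon> * \<epsilon>) \<cdot>\<^sub>m 1\<^sub>m n = 1 \<cdot>\<^sub>m (1\<^sub>m n :: complex mat)"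
    by (auto intro!: eq_matI)
  then have "\<epsilon> * \<epsilon> = 1" using \<tau>(3) by (rule eq_smult_one_mat)
  then have "\<epsilon> = 1 \<or> \<epsilon> = -1" by (simp add: square_eq_1_iff)
  then obtain e :: int where e: "e = 1 \<or> e = -1" "\<epsilon> = of_int e"
    by (metis of_int_1 of_int_minus)
  define \<rho> where "\<rho> g = \<tau> (g, False)" for g
  have \<tau>True: "\<tau> (g, True) = \<epsilon> \<cdot>\<^sub>m \<rho> g" if g: "g \<in> carrier G" for g
  proof -
    have "\<tau> (g, True) = E * \<rho> g" using mult[of \<one> g True False] g by (simp add: E_def \<rho>_def)
    also have "\<dots> = \<epsilon> \<cdot>\<^sub>m \<rho> g"
      unfolding \<epsilon> using c[OF g, of False] by (simp add: \<rho>_def mult_smult_assoc_mat[OF one_carrier_mat])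
    finally show ?thesis .
  qed
  have rep: "is_rep G n \<rho>"
    unfolding is_rep_iff using c mult[of _ _ False False] one by (simp add: \<rho>_def)
  have "irreducible_rep G n \<rho>"
    unfolding irreducible_rep_def
  proof (intro conjI allI impI rep \<tau>(3))
    fix W assume W: "vec_subspace n W \<and> (\<forall>g\<in>carrier G. \<forall>w\<in>W. \<rho> g *\<^sub>v w \<in> W)"
    have "\<tau> g *\<^sub>v w \<in> W" if g: "g \<in> carrier sign_ext" and w: "w \<in> W" for g w
    proof -
      obtain h x where gh: "g = (h, x)" "h \<in> carrier G" using g by (cases g) auto
      have \<rho>w: "\<rho> h *\<^sub>v w \<in> W" using W gh w by blast
      have wc: "w \<in> carrier_vec n" using W w by (auto simp: vec_subspace_def)
      have "\<tau> (h, True) *\<^sub>v w = \<epsilon> \<cdot>\<^sub>v (\<rho> h *\<^sub>v w)"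
        unfolding \<tau>True[OF gh(2)] using c[OF gh(2), of False] wc
        by (intro eq_vecI) (auto simp: \<rho>_def scalar_prod_def sum_distrib_left mult.assoc)
      also have "\<dots> \<in> W" using W \<rho>w by (auto simp: vec_subspace_def)
      finally show ?thesis using \<rho>w gh by (cases x) (auto simp: \<rho>_def)
    qed
    then show "W = {0\<^sub>v n} \<or> W = carrier_vec n"
      using \<tau>(1) W by (auto simp: irreducible_rep_def)
  qed
  then have "rep_character G n \<rho> \<in> Irr G" by (auto simp: Irr_def)
  moreover have "\<psi> (g, False) = rep_character G n \<rho> g" if "g \<in> carrier G" for g
    using that by (simp add: \<tau>(2) rep_character_eq[OF rep] \<rho>_def)
  moreover have "\<psi> (g, True) = of_int e * rep_character G n \<rho> g" if g: "g \<in> carrier G" for g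
    using g c[OF g, of False] by (simp add: \<tau>(2) rep_character_eq[OF rep] \<tau>True e(2) tr_smult \<rho>_def)
  ultimately show thesis using that e(1) by blast
qed

text \<open>Applied to the group \<open>G \<times> {1, -1}\<close>, on whose irreducible representations \<open>-1\<close> acts by a sign.\<close>

lemma signed_decompose:
  assumes rep: "is_rep G n \<rho>" and S: "S \<in> carrier_mat n n" "S * S = 1\<^sub>m n"
    and comm: "\<And>g. g \<in> carrier G \<Longrightarrow> \<rho> g * S = S * \<rho> g"
  obtains L :: "(('a \<Rightarrow> complex) \<times> int) list" where "fst ` set L \<subseteq> Irr G" "snd ` set L \<subseteq> {1, -1}"
    "\<And>g. g \<in> carrier G \<Longrightarrow> tr (\<rho> g) = (\<Sum>(\<psi>, e)\<leftarrow>L. \<psi> g)"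
    "\<And>g. g \<in> carrier G \<Longrightarrow> tr (\<rho> g * S) = (\<Sum>(\<psi>, e)\<leftarrow>L. of_int e * \<psi> g)"
proof -
  interpret K: fin_group sign_ext by (rule fin_group_sign_ext)
  note c = rep_carrier[OF rep]
  define \<tau> where "\<tau> = (\<lambda>(g, x). if x then \<rho> g * S else \<rho> g)"
  have "is_rep sign_ext n \<tau>"
    unfolding K.is_rep_iff
  proof (intro conjI ballI)
    show "\<tau> \<one>\<^bsub>sign_ext\<^esub> = 1\<^sub>m n" by (simp add: \<tau>_def rep_one[OF rep])
    show "\<tau> g \<in> carrier_mat n n" if "g \<in> carrier sign_ext" for g
      using that c mult_carrier_mat[OF c S(1)] by (auto simp: \<tau>_def)
    fix g h assume "g \<in> carrier sign_ext" "h \<in> carrier sign_ext"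
    then obtain a x b y where gh: "g = (a, x)" "h = (b, y)" and a: "a \<in> carrier G" and b: "b \<in> carrier G"
      by (cases g, cases h) auto
    note ca = c[OF a] and cb = c[OF b]
    have 1: "\<rho> a * \<rho> b * S = \<rho> a * (\<rho> b * S)" by (rule assoc_mult_mat[OF ca cb S(1)])
    have 2: "\<rho> a * S * \<rho> b = \<rho> a * \<rho> b * S"
      unfolding 1 comm[OF b] by (rule assoc_mult_mat[OF ca S(1) cb])
    have "\<rho> a * S * (\<rho> b * S) = \<rho> a * S * \<rho> b * S"
      by (rule assoc_mult_mat[OF _ cb S(1), symmetric]) (use ca S in auto)
    also have "\<dots> = \<rho> a * \<rho> b * (S * S)"
      unfolding 2 by (rule assoc_mult_mat[OF _ S(1) S(1)]) (use ca cb in auto)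
    also have "\<dots> = \<rho> a * \<rho> b" unfolding S(2) by (rule right_mult_one_mat) (use ca cb in auto)
    finally have 3: "\<rho> a * S * (\<rho> b * S) = \<rho> a * \<rho> b" .
    show "\<tau> (g \<otimes>\<^bsub>sign_ext\<^esub> h) = \<tau> g * \<tau> h"
      using 1 2 3 rep_mult[OF rep a b] unfolding gh by (cases x; cases y) (simp_all add: \<tau>_def)
  qed
  then obtain L0 where L0: "set L0 \<subseteq> Irr sign_ext" "\<And>g. g \<in> carrier sign_ext \<Longrightarrow> tr (\<tau> g) = (\<Sum>\<psi>\<leftarrow>L0. \<psi> g)"
    using K.rep_character_decompose by blast
  have "\<exists>L :: (('a \<Rightarrow> complex) \<times> int) list. fst ` set L \<subseteq> Irr G \<and> snd ` set L \<subseteq> {1, -1}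
     \<and> (\<forall>g\<in>carrier G. (\<Sum>\<psi>\<leftarrow>L0. \<psi> (g, False)) = (\<Sum>(\<psi>, e)\<leftarrow>L. \<psi> g)
          \<and> (\<Sum>\<psi>\<leftarrow>L0. \<psi> (g, True)) = (\<Sum>(\<psi>, e)\<leftarrow>L. of_int e * \<psi> g))"
    using L0(1)
  proof (induction L0)
    case Nil
    show ?case by (intro exI[of _ "[]"]) simp
  next
    case (Cons \<psi> L0)
    then obtain L :: "(('a \<Rightarrow> complex) \<times> int) list" where L: "fst ` set L \<subseteq> Irr G" "snd ` set L \<subseteq> {1, -1}"
      "\<forall>g\<in>carrier G. (\<Sum>\<psi>\<leftarrow>L0. \<psi> (g, False)) = (\<Sum>(\<psi>, e)\<leftarrow>L. \<psi> g)
          \<and> (\<Sum>\<psi>\<leftarrow>L0. \<psi> (g, True)) = (\<Sum>(\<psi>, e)\<leftarrow>L. of_int e * \<psi> g)"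
      by auto
    obtain \<phi> e where "\<phi> \<in> Irr G" "e = 1 \<or> e = -1"
      "\<And>g. g \<in> carrier G \<Longrightarrow> \<psi> (g, False) = \<phi> g" "\<And>g. g \<in> carrier G \<Longrightarrow> \<psi> (g, True) = of_int e * \<phi> g"
      using Irr_sign_ext[of \<psi>] Cons.prems by auto
    with L show ?case by (intro exI[of _ "(\<phi>, e) # L"]) auto
  qed
  then obtain L :: "(('a \<Rightarrow> complex) \<times> int) list" where L: "fst ` set L \<subseteq> Irr G" "snd ` set L \<subseteq> {1, -1}"
      "\<forall>g\<in>carrier G. (\<Sum>\<psi>\<leftarrow>L0. \<psi> (g, False)) = (\<Sum>(\<psi>, e)\<leftarrow>L. \<psi> g)
          \<and> (\<Sum>\<psi>\<leftarrow>L0. \<psi> (g, True)) = (\<Sum>(\<psi>, e)\<leftarrow>L. of_int e * \<psi> g)"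
    by blast
  have "tr (\<rho> g) = (\<Sum>(\<psi>, e)\<leftarrow>L. \<psi> g) \<and> tr (\<rho> g * S) = (\<Sum>(\<psi>, e)\<leftarrow>L. of_int e * \<psi> g)" if "g \<in> carrier G" for g
  proof
    have "(g, False) \<in> carrier sign_ext" "(g, True) \<in> carrier sign_ext" using that by auto
    note eqs = L0(2)[OF this(1)] L0(2)[OF this(2)] bspec[OF L(3) that]
    show "tr (\<rho> g) = (\<Sum>(\<psi>, e)\<leftarrow>L. \<psi> g)"
      using eqs(1) conjunct1[OF eqs(3)] unfolding \<tau>_def prod.case if_False by (rule trans)
    show "tr (\<rho> g * S) = (\<Sum>(\<psi>, e)\<leftarrow>L. of_int e * \<psi> g)"
      using eqs(2) conjunct2[OF eqs(3)] unfolding \<tau>_def prod.case if_True by (rule trans)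
  qed
  then show thesis using that[OF L(1,2)] by blast
qed

text \<open>Orthogonality turns the norm into the sum of the squares of the integers
  \<open>m \<psi>\<close>, and integer squares with sum 1 have exactly one nonzero term.\<close>

lemma norm_one_combination:
  assumes \<beta>: "\<And>g. g \<in> carrier G \<Longrightarrow> \<beta> g = (\<Sum>\<psi>\<in>Irr G. of_int (m \<psi>) * \<psi> g)"
    and norm: "(\<Sum>g\<in>carrier G. \<beta> g * \<beta> (inv g)) = of_nat (card (carrier G))"
  obtains \<psi> where "\<psi> \<in> Irr G" "m \<psi> = 1 \<or> m \<psi> = -1" "\<And>\<phi>. \<phi> \<in> Irr G \<Longrightarrow> \<phi> \<noteq> \<psi> \<Longrightarrow> m \<phi> = (0::int)"
proof -
  have "(\<Sum>g\<in>carrier G. \<beta> g * \<beta> (inv g))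
    = (\<Sum>g\<in>carrier G. \<Sum>\<psi>\<in>Irr G. \<Sum>\<phi>\<in>Irr G. of_int (m \<psi> * m \<phi>) * (\<psi> g * \<phi> (inv g)))"
    by (intro sum.cong) (auto simp: \<beta> sum_product mult_ac)
  also have "\<dots> = (\<Sum>\<psi>\<in>Irr G. \<Sum>\<phi>\<in>Irr G. of_int (m \<psi> * m \<phi>) * (\<Sum>g\<in>carrier G. \<psi> g * \<phi> (inv g)))"
    unfolding sum_distrib_left by (rule sum_rotate3)
  also have "\<dots> = (\<Sum>\<psi>\<in>Irr G. \<Sum>\<phi>\<in>Irr G. if \<psi> = \<phi> then of_int (m \<psi> * m \<phi>) * of_nat (card (carrier G)) else 0)"
    by (intro sum.cong) (auto simp: Irr_orthogonality)
  also have "\<dots> = (\<Sum>\<psi>\<in>Irr G. of_int (m \<psi> * m \<psi>) * of_nat (card (carrier G)))"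
    using finite_Irr by (intro sum.cong) (auto simp: sum.delta)
  also have "\<dots> = of_int (\<Sum>\<psi>\<in>Irr G. m \<psi> * m \<psi>) * of_nat (card (carrier G))"
    by (simp add: sum_distrib_right)
  finally have "of_int (\<Sum>\<psi>\<in>Irr G. m \<psi> * m \<psi>) = (1 :: complex)" using norm card_pos by simp
  then have sq: "(\<Sum>\<psi>\<in>Irr G. m \<psi> * m \<psi>) = 1" by (simp only: of_int_eq_1_iff)
  then have "\<exists>\<psi>\<in>Irr G. m \<psi> \<noteq> 0" by (rule contrapos_pp) simp
  then obtain \<psi> where \<psi>: "\<psi> \<in> Irr G" "m \<psi> \<noteq> 0" by blast
  have split: "m \<psi> * m \<psi> + (\<Sum>\<phi>\<in>Irr G - {\<psi>}. m \<phi> * m \<phi>) = 1"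
    using sq sum.remove[OF finite_Irr \<psi>(1), of "\<lambda>\<psi>. m \<psi> * m \<psi>"] by simp
  have nonneg: "(\<Sum>\<phi>\<in>Irr G - {\<psi>}. m \<phi> * m \<phi>) \<ge> 0" by (intro sum_nonneg) simp
  have "m \<psi> * m \<psi> > 0" using \<psi>(2) by (simp add: zero_less_mult_iff linorder_neq_iff disj_commute)
  with split nonneg have 1: "m \<psi> * m \<psi> = 1" and 0: "(\<Sum>\<phi>\<in>Irr G - {\<psi>}. m \<phi> * m \<phi>) = 0" by linarith+
  have "m \<phi> = 0" if "\<phi> \<in> Irr G" "\<phi> \<noteq> \<psi>" for \<phi>
    using 0 that finite_Irr by (subst (asm) sum_nonneg_eq_0_iff) auto
  moreover have "m \<psi> = 1 \<or> m \<psi> = -1" using 1 by (simp add: square_eq_1_iff)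
  ultimately show thesis using that \<psi>(1) by blast
qed

text \<open>Each list entry adds 1 to \<open>N\<close> and 1 or -1 to \<open>m\<close>, so the two
  agree modulo 2. This carries information on signed sums over to the parity of
  multiplicities.\<close>

lemma list_multiplicities:
  fixes L :: "(('a \<Rightarrow> complex) \<times> int) list"
  assumes "fst ` set L \<subseteq> Irr G" "snd ` set L \<subseteq> {1, -1}"
  obtains N m where
    "\<And>g. (\<Sum>(\<psi>, e)\<leftarrow>L. \<psi> g) = (\<Sum>\<psi>\<in>Irr G. of_nat (N \<psi>) * \<psi> g)"
    "\<And>g. (\<Sum>(\<psi>, e)\<leftarrow>L. of_int e * \<psi> g) = (\<Sum>\<psi>\<in>Irr G. of_int (m \<psi>) * \<psi> g)"
    "\<And>\<psi>. odd (N \<psi>) \<longleftrightarrow> odd (m \<psi> :: int)"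
proof -
  have "\<exists>N m. (\<forall>g. (\<Sum>(\<psi>, e)\<leftarrow>L. \<psi> g) = (\<Sum>\<psi>\<in>Irr G. of_nat (N \<psi>) * \<psi> g)) \<and>
    (\<forall>g. (\<Sum>(\<psi>, e)\<leftarrow>L. of_int e * \<psi> g) = (\<Sum>\<psi>\<in>Irr G. of_int (m \<psi>) * \<psi> g)) \<and>
    (\<forall>\<psi>. odd (N \<psi> :: nat) \<longleftrightarrow> odd (m \<psi> :: int))"
    using assms
  proof (induction L)
    case Nil
    show ?case by (intro exI[of _ "\<lambda>_. 0"]) simp
  next
    case (Cons p L)
    obtain \<phi> e where p: "p = (\<phi>, e)" "\<phi> \<in> Irr G" "e = 1 \<or> e = -1"
      using Cons.prems by (cases p) auto
    obtain N m where IH: "\<And>g. (\<Sum>(\<psi>, e)\<leftarrow>L. \<psi> g) = (\<Sum>\<psi>\<in>Irr G. of_nat (N \<psi>) * \<psi> g)"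
      "\<And>g. (\<Sum>(\<psi>, e)\<leftarrow>L. of_int e * \<psi> g) = (\<Sum>\<psi>\<in>Irr G. of_int (m \<psi>) * \<psi> g)"
      "\<And>\<psi>. odd (N \<psi> :: nat) \<longleftrightarrow> odd (m \<psi> :: int)"
      using Cons.IH Cons.prems by auto
    let ?N = "N(\<phi> := N \<phi> + 1)" and ?m = "m(\<phi> := m \<phi> + e)"
    have "(\<Sum>\<psi>\<in>Irr G. of_nat (?N \<psi>) * \<psi> g) = (\<Sum>\<psi>\<in>Irr G. of_nat (N \<psi>) * \<psi> g + (if \<psi> = \<phi> then \<psi> g else 0))" for g
      by (intro sum.cong) (auto simp: algebra_simps)
    then have 1: "(\<Sum>\<psi>\<in>Irr G. of_nat (?N \<psi>) * \<psi> g) = \<phi> g + (\<Sum>\<psi>\<in>Irr G. of_nat (N \<psi>) * \<psi> g)" for g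
      using finite_Irr p(2) by (simp add: sum.distrib)
    have "(\<Sum>\<psi>\<in>Irr G. of_int (?m \<psi>) * \<psi> g) = (\<Sum>\<psi>\<in>Irr G. of_int (m \<psi>) * \<psi> g + (if \<psi> = \<phi> then of_int e * \<psi> g else 0))" for g
      by (intro sum.cong) (auto simp: algebra_simps)
    then have 2: "(\<Sum>\<psi>\<in>Irr G. of_int (?m \<psi>) * \<psi> g) = of_int e * \<phi> g + (\<Sum>\<psi>\<in>Irr G. of_int (m \<psi>) * \<psi> g)" for g
      using finite_Irr p(2) by (simp add: sum.distrib)
    show ?case
    proof (intro exI conjI allI)
      show "(\<Sum>(\<psi>, e)\<leftarrow>p # L. \<psi> g) = (\<Sum>\<psi>\<in>Irr G. of_nat (?N \<psi>) * \<psi> g)" for g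
        unfolding 1 by (simp add: p IH)
      show "(\<Sum>(\<psi>, e)\<leftarrow>p # L. of_int e * \<psi> g) = (\<Sum>\<psi>\<in>Irr G. of_int (?m \<psi>) * \<psi> g)" for g
        unfolding 2 by (simp add: p IH)
      show "odd (?N \<psi>) \<longleftrightarrow> odd (?m \<psi>)" for \<psi>
        using IH(3)[of \<psi>] p(3) by auto
    qed
  qed
  then show thesis using that by blast
qed

lemma char_inner_combination:
  assumes "\<And>g. g \<in> carrier G \<Longrightarrow> \<alpha> g = (\<Sum>\<psi>\<in>Irr G. a \<psi> * \<psi> g)" "\<psi> \<in> Irr G"
  shows "char_inner G \<alpha> \<psi> = a \<psi>"
proof -
  have "(\<Sum>g\<in>carrier G. \<alpha> g * \<psi> (inv g)) = (\<Sum>g\<in>carrier G. \<Sum>\<phi>\<in>Irr G. a \<phi> * (\<phi> g * \<psi> (inv g)))"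
    by (intro sum.cong) (auto simp: assms(1) sum_distrib_right mult.assoc)
  also have "\<dots> = (\<Sum>\<phi>\<in>Irr G. a \<phi> * (\<Sum>g\<in>carrier G. \<phi> g * \<psi> (inv g)))"
    by (subst sum.swap) (simp add: sum_distrib_left)
  also have "\<dots> = (\<Sum>\<phi>\<in>Irr G. if \<phi> = \<psi> then a \<phi> * of_nat (card (carrier G)) else 0)"
    by (intro sum.cong) (auto simp: Irr_orthogonality assms(2))
  also have "\<dots> = a \<psi> * of_nat (card (carrier G))" using finite_Irr assms(2) by simp
  finally show ?thesis using card_pos by (simp add: char_inner_Irr[OF assms(2)])
qed

text \<open>To be used with the fixed-point subgroup as \<open>G\<close>. Norm one leaves a single
  nonzero signed multiplicity, and it is odd; by parity a single ordinary multiplicity is odd, which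
  gives existence and uniqueness for the definite description.\<close>

lemma glauberman_from_signed:
  assumes rep: "is_rep G n \<rho>" and S: "S \<in> carrier_mat n n" "S * S = 1\<^sub>m n"
    and comm: "\<And>g. g \<in> carrier G \<Longrightarrow> \<rho> g * S = S * \<rho> g"
    and norm: "(\<Sum>g\<in>carrier G. tr (\<rho> g * S) * tr (\<rho> (inv g) * S)) = of_nat (card (carrier G))"
    and \<chi>: "\<And>g. g \<in> carrier G \<Longrightarrow> \<chi> g = tr (\<rho> g)"
  obtains \<epsilon> :: complex where "glauberman G \<chi> \<in> Irr G" "\<epsilon> = 1 \<or> \<epsilon> = -1"
    "\<And>g. g \<in> carrier G \<Longrightarrow> tr (\<rho> g * S) = \<epsilon> * glauberman G \<chi> g"
proof -
  obtain L where L: "fst ` set L \<subseteq> Irr G" "snd ` set L \<subseteq> {1, -1 :: int}"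
    "\<And>g. g \<in> carrier G \<Longrightarrow> tr (\<rho> g) = (\<Sum>(\<psi>, e)\<leftarrow>L. \<psi> g)"
    "\<And>g. g \<in> carrier G \<Longrightarrow> tr (\<rho> g * S) = (\<Sum>(\<psi>, e)\<leftarrow>L. of_int e * \<psi> g)"
    using signed_decompose[OF rep S comm] by blast
  obtain N m where N: "\<And>g. (\<Sum>(\<psi>, e)\<leftarrow>L. \<psi> g) = (\<Sum>\<psi>\<in>Irr G. of_nat (N \<psi>) * \<psi> g)"
    and m: "\<And>g. (\<Sum>(\<psi>, e)\<leftarrow>L. of_int e * \<psi> g) = (\<Sum>\<psi>\<in>Irr G. of_int (m \<psi>) * \<psi> g)"
    and parity: "\<And>\<psi>. odd (N \<psi>) \<longleftrightarrow> odd (m \<psi> :: int)"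
    using list_multiplicities[OF L(1,2)] by blast
  have \<beta>: "tr (\<rho> g * S) = (\<Sum>\<psi>\<in>Irr G. of_int (m \<psi>) * \<psi> g)" if "g \<in> carrier G" for g
    using that by (simp add: L(4) m)
  obtain \<psi> where \<psi>: "\<psi> \<in> Irr G" "m \<psi> = 1 \<or> m \<psi> = -1" "\<And>\<phi>. \<phi> \<in> Irr G \<Longrightarrow> \<phi> \<noteq> \<psi> \<Longrightarrow> m \<phi> = 0"
    using norm_one_combination[OF \<beta> norm] by blast
  have inner: "char_inner G (restrict \<chi> (carrier G)) \<phi> = of_nat (N \<phi>)" if "\<phi> \<in> Irr G" for \<phi>
    by (rule char_inner_combination[OF _ that]) (simp add: \<chi> L(3) N)
  have "glauberman G \<chi> = \<psi>"
    unfolding glauberman_def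
  proof (rule the_equality)
    show "\<psi> \<in> Irr G \<and> (\<exists>k::nat. odd k \<and> char_inner G (restrict \<chi> (carrier G)) \<psi> = of_nat k)"
      using \<psi>(1,2) inner[OF \<psi>(1)] parity[of \<psi>] by auto
    fix \<phi> assume "\<phi> \<in> Irr G \<and> (\<exists>k::nat. odd k \<and> char_inner G (restrict \<chi> (carrier G)) \<phi> = of_nat k)"
    then have \<phi>: "\<phi> \<in> Irr G" and "odd (N \<phi>)" by (auto simp: inner)
    then have "m \<phi> \<noteq> 0" using parity[of \<phi>] by auto
    then show "\<phi> = \<psi>" using \<psi>(3)[OF \<phi>] by blast
  qed
  moreover have "tr (\<rho> g * S) = of_int (m \<psi>) * \<psi> g" if "g \<in> carrier G" for g
  proof -
    have "tr (\<rho> g * S) = (\<Sum>\<phi>\<in>Irr G. if \<phi> = \<psi> then of_int (m \<phi>) * \<phi> g else 0)"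
      unfolding \<beta>[OF that] using \<psi>(3) by (intro sum.cong) auto
    then show ?thesis using finite_Irr \<psi>(1) by simp
  qed
  ultimately show thesis using that[of "of_int (m \<psi>)"] \<psi> by auto
qed

end

section \<open>Groups of odd order with an automorphism whose square is the identity\<close>

locale odd_involution_group = fin_group +
  fixes s :: "'a \<Rightarrow> 'a"
  assumes s_closed: "x \<in> carrier G \<Longrightarrow> s x \<in> carrier G"
    and s_mult: "x \<in> carrier G \<Longrightarrow> y \<in> carrier G \<Longrightarrow> s (x \<otimes> y) = s x \<otimes> s y"
    and s_s: "x \<in> carrier G \<Longrightarrow> s (s x) = x"
    and odd_card: "odd (card (carrier G))"
begin

definition fixed :: "'a set" where
  "fixed = {x \<in> carrier G. s x = x}"

abbreviation C :: "('a, 'b) monoid_scheme" where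
  "C \<equiv> G\<lparr>carrier := fixed\<rparr>"

lemma s_one: "s \<one> = \<one>"
  using s_mult[OF one_closed one_closed] s_closed[OF one_closed] by simp

lemma s_inv: "x \<in> carrier G \<Longrightarrow> s (inv x) = inv (s x)"
  using s_mult[of x "inv x"] s_closed by (intro inv_equality[symmetric]) (auto simp: s_one s_mult[symmetric])

lemma fixed_subgroup: "subgroup fixed G"
  by (rule subgroup.intro) (auto simp: fixed_def s_mult s_one s_inv)

lemma fixedD: "x \<in> fixed \<Longrightarrow> x \<in> carrier G" "x \<in> fixed \<Longrightarrow> s x = x"
  by (auto simp: fixed_def)

lemma fin_group_C: "fin_group C"
  using subgroup.subgroup_is_group[OF fixed_subgroup is_group] finite_subset[OF _ finite_carrier, of fixed]
  by (intro fin_group.intro fin_group_axioms.intro) (auto simp: fixed_def)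

lemma inv_C: "x \<in> fixed \<Longrightarrow> inv\<^bsub>C\<^esub> x = inv x"
  using m_inv_consistent[OF fixed_subgroup] .

lemma card_C_pos: "card fixed > 0"
  using fin_group.card_pos[OF fin_group_C] by simp

text \<open>The exponent \<open>(card (carrier G) + 1) div 2\<close> is the inverse of 2 modulo the
  odd group order, so raising to it extracts square roots.\<close>

lemma square_root_power:
  assumes "x \<in> carrier G"
  shows "x [^] (2 * ((card (carrier G) + 1) div 2)) = x"
proof -
  have "2 * ((card (carrier G) + 1) div 2) = card (carrier G) + 1"
    using odd_card by simp
  then show ?thesis
    using pow_order_eq_1[OF assms] assms by (simp add: order_def)
qed

lemma square_inj:
  assumes "x \<in> carrier G" "y \<in> carrier G" "x \<otimes> x = y \<otimes> y"
  shows "x = y"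
proof -
  let ?k = "(card (carrier G) + 1) div 2"
  have "x = (x \<otimes> x) [^] ?k" if "x \<in> carrier G" for x
  proof -
    have "x \<otimes> x = x [^] (2 :: nat)" using that by (simp add: numeral_2_eq_2)
    then show ?thesis using square_root_power[OF that] nat_pow_pow[OF that] by (simp only:)
  qed
  then show ?thesis using assms by metis
qed

text \<open>In the semidirect product with \<open>s\<close> the hypothesis says that \<open>z\<close> conjugates \<open>c s\<close> to \<open>c' s\<close>, hence
  \<open>c\<^sup>2\<close> to \<open>c'\<^sup>2\<close>; square roots being unique, it conjugates \<open>c\<close> to \<open>c'\<close>.\<close>

lemma twisted_conjugate_fixed:
  assumes z: "z \<in> carrier G" and c: "c \<in> fixed" "c' \<in> fixed"
    and eq: "z \<otimes> c = c' \<otimes> s z"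
  shows "z \<in> fixed"
proof -
  note [simp] = fixedD[OF c(1)] fixedD[OF c(2)] z s_closed
  have "s z \<otimes> c = c' \<otimes> z"
    using arg_cong[OF eq, of s] by (simp add: s_mult s_s)
  then have zcc: "z \<otimes> (c \<otimes> c) = c' \<otimes> c' \<otimes> z"
    using eq by (metis (full_types) fixedD(1) c m_assoc s_closed z)
  have "(z \<otimes> c \<otimes> inv z) \<otimes> (z \<otimes> c \<otimes> inv z) = z \<otimes> (c \<otimes> c) \<otimes> inv z"
    by (simp add: m_assoc inv_cancel)
  also have "\<dots> = c' \<otimes> c'" unfolding zcc by (simp add: m_assoc)
  finally have "(z \<otimes> c \<otimes> inv z) \<otimes> (z \<otimes> c \<otimes> inv z) = c' \<otimes> c'" .
  then have "z \<otimes> c \<otimes> inv z = c'" by (rule square_inj[rotated 2]) auto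
  then have "z \<otimes> c \<otimes> inv z \<otimes> z = c' \<otimes> z" by simp
  then have "z \<otimes> c = c' \<otimes> z" by (simp add: m_assoc)
  then have "c' \<otimes> z = c' \<otimes> s z" using eq by simp
  then show ?thesis by (simp add: fixed_def)
qed

text \<open>All fibres of the map (y, c) |-> y c s(y)^-1 on pairs with \<open>c\<close> in
  \<open>fixed\<close> have |\<open>fixed\<close>| elements. By counting, the map is onto: every
  element is twisted conjugate to a fixed one.\<close>

lemma twisted_sum:
  fixes F :: "'a \<Rightarrow> complex"
  assumes F: "\<And>x y. x \<in> carrier G \<Longrightarrow> y \<in> carrier G \<Longrightarrow> F (y \<otimes> x \<otimes> inv (s y)) = F x"
  shows "of_nat (card fixed) * (\<Sum>x\<in>carrier G. F x) = of_nat (card (carrier G)) * (\<Sum>c\<in>fixed. F c)"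
proof -
  define T where "T = carrier G \<times> fixed"
  define q where "q = (\<lambda>(y, c). y \<otimes> c \<otimes> inv (s y))"
  have finT: "finite T"
    using finite_carrier finite_subset[of fixed "carrier G"] by (auto simp: T_def fixed_def)
  have qT: "q ` T \<subseteq> carrier G" by (auto simp: T_def q_def fixed_def s_closed)
  have fiber: "card {t \<in> T. q t = q t0} = card fixed" if t0: "t0 \<in> T" for t0
  proof -
    obtain y0 c0 where t0_eq: "t0 = (y0, c0)" and y0: "y0 \<in> carrier G" and c0: "c0 \<in> fixed"
      using t0 by (auto simp: T_def)
    note c0G = fixedD[OF c0]
    \<comment> \<open>Parametrises the fibre through \<open>(y0, c0)\<close> by
      \<open>fixed\<close>. That it contains no further points is where
      \<open>twisted_conjugate_fixed\<close>, and with it the odd order, is used.\<close>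
    define \<phi> where "\<phi> z = (y0 \<otimes> z, inv z \<otimes> c0 \<otimes> z)" for z
    have "{t \<in> T. q t = q t0} = \<phi> ` fixed"
    proof (intro equalityI subsetI)
      fix t assume "t \<in> {t \<in> T. q t = q t0}"
      then obtain y c where t: "t = (y, c)" "y \<in> carrier G" "c \<in> fixed"
        and eq: "y \<otimes> c \<otimes> inv (s y) = y0 \<otimes> c0 \<otimes> inv (s y0)"
        by (auto simp: T_def q_def t0_eq)
      note cG = fixedD[OF t(3)]
      define z where "z = inv y0 \<otimes> y"
      have z: "z \<in> carrier G" using y0 t by (simp add: z_def)
      have sz: "s z = inv (s y0) \<otimes> s y" using y0 t by (simp add: z_def s_mult s_inv)
      have y: "y = y0 \<otimes> z" using y0 t by (simp add: z_def m_assoc[symmetric])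
      have "y \<otimes> c = y0 \<otimes> c0 \<otimes> inv (s y0) \<otimes> s y"
        using eq t cG y0 c0G s_closed by (metis inv_closed inv_solve_right m_closed)
      then have "z \<otimes> c = c0 \<otimes> s z"
        unfolding sz using y0 t(2) cG c0G s_closed by (simp add: z_def m_assoc inv_cancel)
      then have zf: "z \<in> fixed" by (rule twisted_conjugate_fixed[OF z t(3) c0])
      with \<open>z \<otimes> c = c0 \<otimes> s z\<close> have "z \<otimes> c = c0 \<otimes> z" by (simp add: fixedD)
      then have "c = inv z \<otimes> c0 \<otimes> z"
        using z cG c0G inv_cancel(1)[of z c] by (simp add: m_assoc)
      then show "t \<in> \<phi> ` fixed" using zf y t by (auto simp: \<phi>_def)
    next
      fix t assume "t \<in> \<phi> ` fixed"
      then obtain z where z: "z \<in> fixed" "t = \<phi> z" by auto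
      note zG = fixedD[OF z(1)]
      have "inv z \<otimes> c0 \<otimes> z \<in> fixed"
        by (intro subgroup.m_closed[OF fixed_subgroup] subgroup.m_inv_closed[OF fixed_subgroup] z(1) c0)
      moreover have "y0 \<otimes> z \<otimes> (inv z \<otimes> c0 \<otimes> z) \<otimes> inv (s (y0 \<otimes> z)) = y0 \<otimes> c0 \<otimes> inv (s y0)"
      proof -
        have 1: "inv (s (y0 \<otimes> z)) = inv z \<otimes> inv (s y0)"
          using y0 zG s_closed by (simp add: s_mult inv_mult_group)
        have 2: "z \<otimes> (inv z \<otimes> c0 \<otimes> z) = c0 \<otimes> z"
          using zG c0G by (simp add: m_assoc[symmetric])
        have 3: "z \<otimes> (inv z \<otimes> inv (s y0)) = inv (s y0)"
          using zG y0 s_closed by (simp add: m_assoc[symmetric])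
        show ?thesis unfolding 1 using 2 3 y0 zG c0G s_closed by (simp add: m_assoc)
      qed
      ultimately show "t \<in> {t \<in> T. q t = q t0}"
        using y0 zG c0G z by (simp add: T_def q_def t0_eq \<phi>_def)
    qed
    moreover have "inj_on \<phi> fixed"
      using y0 by (auto simp: inj_on_def \<phi>_def fixed_def)
    ultimately show ?thesis by (simp add: card_image)
  qed
  have sumT: "(\<Sum>t\<in>T. h (q t)) = (\<Sum>x\<in>q ` T. of_nat (card fixed) * h x)" for h :: "'a \<Rightarrow> complex"
  proof -
    have "(\<Sum>t\<in>T. h (q t)) = (\<Sum>x\<in>q ` T. \<Sum>t\<in>{t \<in> T. q t = x}. h (q t))"
      using sum.group[OF finT finite_imageI[OF finT] subset_refl, of "\<lambda>t. h (q t)" q] by simp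
    also have "\<dots> = (\<Sum>x\<in>q ` T. of_nat (card fixed) * h x)"
      using fiber by (intro sum.cong) auto
    finally show ?thesis .
  qed
  have "of_nat (card fixed) * of_nat (card (q ` T)) = (of_nat (card T) :: complex)"
    using sumT[of "\<lambda>_. 1"] by (simp add: mult.commute)
  also have "card T = card (carrier G) * card fixed" by (simp add: T_def card_cartesian_product)
  finally have "card (q ` T) = card (carrier G)" using card_C_pos by (simp flip: of_nat_mult)
  then have img: "q ` T = carrier G" using qT finite_carrier by (intro card_subset_eq)
  have "of_nat (card fixed) * (\<Sum>x\<in>carrier G. F x) = (\<Sum>t\<in>T. F (q t))"
    unfolding sumT img by (simp add: sum_distrib_left)
  also have "\<dots> = (\<Sum>y\<in>carrier G. \<Sum>c\<in>fixed. F (y \<otimes> c \<otimes> inv (s y)))"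
    by (simp add: T_def q_def sum.cartesian_product split_def)
  also have "\<dots> = (\<Sum>y\<in>carrier G. \<Sum>c\<in>fixed. F c)"
    using F fixedD(1) by (intro sum.cong) auto
  finally show ?thesis by simp
qed

text \<open>The fibres of x |-> s(x) x^-1 are left cosets of \<open>fixed\<close>. Each y with s(y)
  = y^-1 is attained at the inverse of its square root, which \<open>s\<close> inverts as
  well.\<close>

lemma twisted_square_sum:
  fixes F :: "'a \<Rightarrow> complex"
  shows "(\<Sum>x\<in>carrier G. F (s x \<otimes> inv x))
    = of_nat (card fixed) * (\<Sum>y\<in>{y \<in> carrier G. s y = inv y}. F y)"
proof -
  let ?I = "{y \<in> carrier G. s y = inv y}"
  define q where "q x = s x \<otimes> inv x" for x
  have qI: "q x \<in> ?I" if "x \<in> carrier G" for x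
    using that by (simp add: q_def s_closed s_mult s_s s_inv inv_mult_group)
  have surj: "\<exists>x\<in>carrier G. q x = y" if y: "y \<in> ?I" for y
  proof -
    let ?k = "(card (carrier G) + 1) div 2"
    define v where "v = y [^] ?k"
    have yG: "y \<in> carrier G" and sy: "s y = inv y" using y by auto
    have v: "v \<in> carrier G" using yG by (simp add: v_def)
    have vv: "v \<otimes> v = y"
      unfolding v_def nat_pow_mult[OF yG] using square_root_power[OF yG] by (simp add: mult_2)
    have s_pow: "s (y [^] k) = inv (y [^] k)" for k :: nat
    proof (induction k)
      case (Suc k)
      have "y [^] k \<otimes> y = y \<otimes> y [^] k" using yG nat_pow_Suc2[OF yG] by simp
      then show ?case using Suc yG by (simp add: s_mult sy inv_mult_group[symmetric])
    qed (simp add: s_one)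
    have "s v = inv v" unfolding v_def by (rule s_pow)
    then have "q (inv v) = y" using v by (simp add: q_def s_inv vv)
    then show ?thesis using v by blast
  qed
  have fiber: "card {x \<in> carrier G. q x = y} = card fixed" if y: "y \<in> ?I" for y
  proof -
    obtain x0 where x0: "x0 \<in> carrier G" "q x0 = y" using surj[OF y] by blast
    have "bij_betw (\<lambda>c. x0 \<otimes> c) fixed {x \<in> carrier G. q x = y}"
    proof (rule bij_betw_byWitness[of _ "\<lambda>x. inv x0 \<otimes> x"])
      show "\<forall>c\<in>fixed. inv x0 \<otimes> (x0 \<otimes> c) = c" using x0 by (simp add: inv_cancel fixedD)
      show "\<forall>x\<in>{x \<in> carrier G. q x = y}. x0 \<otimes> (inv x0 \<otimes> x) = x" using x0 by (simp add: inv_cancel)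
      show "(\<lambda>c. x0 \<otimes> c) ` fixed \<subseteq> {x \<in> carrier G. q x = y}"
        using x0 by (auto simp: fixedD q_def s_mult inv_mult_group m_assoc inv_cancel s_closed)
      show "(\<lambda>x. inv x0 \<otimes> x) ` {x \<in> carrier G. q x = y} \<subseteq> fixed"
      proof (intro image_subsetI)
        fix x assume "x \<in> {x \<in> carrier G. q x = y}"
        then have x: "x \<in> carrier G" and eq: "s x \<otimes> inv x = s x0 \<otimes> inv x0" using x0 by (auto simp: q_def)
        have "inv (s x0) \<otimes> (s x \<otimes> inv x) \<otimes> x = inv x0 \<otimes> x"
          unfolding eq using x0 x s_closed by (simp add: inv_cancel)
        then have "inv (s x0) \<otimes> s x = inv x0 \<otimes> x" using x0 x s_closed by (simp add: m_assoc)
        then show "inv x0 \<otimes> x \<in> fixed" using x0 x by (simp add: fixed_def s_mult s_inv)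
      qed
    qed
    then show ?thesis by (simp add: bij_betw_same_card)
  qed
  have "(\<Sum>x\<in>carrier G. F (q x)) = (\<Sum>y\<in>?I. \<Sum>x\<in>{x \<in> carrier G. q x = y}. F (q x))"
    using sum.group[OF finite_carrier, of ?I q "\<lambda>x. F (q x)"] qI finite_carrier by (simp add: image_subset_iff)
  also have "\<dots> = (\<Sum>y\<in>?I. of_nat (card fixed) * F y)"
    using fiber by (intro sum.cong) auto
  finally show ?thesis by (simp add: q_def sum_distrib_left)
qed

section \<open>Representations twisted by the automorphism and their correspondents\<close>

lemma rep_twist:
  assumes "is_rep G n \<rho>"
  shows "is_rep G n (\<lambda>x. \<rho> (s x))"
  using assms by (simp add: is_rep_iff s_closed s_mult s_one)

lemma irreducible_twist:
  assumes irr: "irreducible_rep G n \<rho>"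
  shows "irreducible_rep G n (\<lambda>x. \<rho> (s x))"
  unfolding irreducible_rep_def
proof (intro conjI allI impI)
  fix W assume W: "vec_subspace n W \<and> (\<forall>g\<in>carrier G. \<forall>w\<in>W. \<rho> (s g) *\<^sub>v w \<in> W)"
  then have "\<forall>g\<in>carrier G. \<forall>w\<in>W. \<rho> g *\<^sub>v w \<in> W" by (metis s_closed s_s)
  with W irr show "W = {0\<^sub>v n} \<or> W = carrier_vec n" by (auto simp: irreducible_rep_def)
qed (use irr rep_twist in \<open>auto simp: irreducible_rep_def\<close>)

definition invariant :: "('a \<Rightarrow> complex) \<Rightarrow> bool" where
  "invariant \<chi> \<longleftrightarrow> (\<forall>x\<in>carrier G. \<chi> (s x) = \<chi> x)"

text \<open>Equal characters give an intertwiner of the representation with its twist. Its square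
  commutes with the representation and is a nonzero scalar, so division by a complex square root
  turns it into an involution.\<close>

lemma invariant_intertwiner:
  assumes irr: "irreducible_rep G n \<rho>" and inv: "invariant (rep_character G n \<rho>)"
  obtains S where "S \<in> carrier_mat n n" "S * S = 1\<^sub>m n"
    "\<And>x. x \<in> carrier G \<Longrightarrow> \<rho> x * S = S * \<rho> (s x)"
proof -
  note rep = irreducible_is_rep[OF irr] and irr' = irreducible_twist[OF irr]
  note c = rep_carrier[OF rep]
  have "rep_character G n \<rho> = rep_character G n (\<lambda>x. \<rho> (s x))"
  proof
    fix x
    show "rep_character G n \<rho> x = rep_character G n (\<lambda>x. \<rho> (s x)) x"
      using inv by (cases "x \<in> carrier G")
        (auto simp: invariant_def rep_character_eq[OF rep] rep_character_eq[OF rep_twist[OF rep]] s_closed rep_character_def)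
  qed
  then obtain M where M: "M \<in> carrier_mat n n" "\<And>x. x \<in> carrier G \<Longrightarrow> \<rho> x * M = M * \<rho> (s x)" "M \<noteq> 0\<^sub>m n n"
    using irreducible_intertwiner[OF irr irr'] by blast
  obtain R where R: "R \<in> carrier_mat n n" "R * M = 1\<^sub>m n"
    using schur_inverse[OF irr irr' M] by blast
  have MM: "M * M \<in> carrier_mat n n" using M by simp
  have "\<rho> x * (M * M) = M * M * \<rho> x" if x: "x \<in> carrier G" for x
  proof -
    note cx = c[OF x] c[OF s_closed[OF x]]
    have "\<rho> x * (M * M) = M * \<rho> (s x) * M"
      unfolding M(2)[OF x, symmetric] using assoc_mult_mat[OF cx(1) M(1) M(1)] by simp
    also have "\<dots> = M * (M * \<rho> x)"
      using assoc_mult_mat[OF M(1) cx(2) M(1)] M(2)[OF s_closed[OF x]] by (simp add: s_s[OF x])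
    also have "\<dots> = M * M * \<rho> x" using assoc_mult_mat[OF M(1) M(1) cx(1)] by simp
    finally show ?thesis .
  qed
  then obtain d where d: "M * M = d \<cdot>\<^sub>m 1\<^sub>m n" using schur_scalar[OF irr MM] by blast
  have "d \<noteq> 0"
  proof
    assume "d = 0"
    then have "M * M = 0\<^sub>m n n" unfolding d by (intro eq_matI) auto
    then have "R * (M * M) = 0\<^sub>m n n" using R by simp
    then have "M = 0\<^sub>m n n" using assoc_mult_mat[OF R(1) M(1) M(1)] R(2) M(1) by simp
    with M(3) show False ..
  qed
  define e where "e = inverse (csqrt d)"
  have e: "e * e * d = 1"
  proof -
    have "d = csqrt d * csqrt d" by (metis power2_csqrt power2_eq_square)
    then show ?thesis using \<open>d \<noteq> 0\<close> by (simp add: e_def field_simps)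
  qed
  define S where "S = e \<cdot>\<^sub>m M"
  have "S * S = 1\<^sub>m n"
  proof -
    have "S * S = e \<cdot>\<^sub>m (e \<cdot>\<^sub>m (M * M))"
      unfolding S_def using M(1)
      by (simp add: mult_smult_assoc_mat[of _ n n _ n] mult_smult_distrib[of _ n n _ n])
    also have "\<dots> = 1\<^sub>m n" unfolding d using e by (intro eq_matI) (auto simp: mult.assoc)
    finally show ?thesis .
  qed
  moreover have "\<rho> x * S = S * \<rho> (s x)" if x: "x \<in> carrier G" for x
    unfolding S_def using M(1) M(2)[OF x] c[OF x] c[OF s_closed[OF x]]
    by (simp add: mult_smult_assoc_mat[of _ n n _ n] mult_smult_distrib[of _ n n _ n])
  moreover have "S \<in> carrier_mat n n" using M(1) by (simp add: S_def)
  ultimately show thesis using that by blast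
qed

text \<open>\<open>x \<mapsto> tr (\<rho>(x) S)\<close> is the restriction of an extension of the character to the coset of \<open>s\<close>.\<close>

lemma twisted_character_orthogonality:
  assumes rep: "is_rep G n \<rho>" "is_rep G m \<tau>"
    and S: "S \<in> carrier_mat n n" "\<And>x. x \<in> carrier G \<Longrightarrow> \<rho> x * S = S * \<rho> (s x)"
    and T: "T \<in> carrier_mat m m" "\<And>x. x \<in> carrier G \<Longrightarrow> \<tau> x * T = T * \<tau> (s x)"
  shows "of_nat (card (carrier G)) * (\<Sum>c\<in>fixed. tr (\<rho> c * S) * tr (\<tau> (inv c) * T))
    = of_nat (card fixed) * (\<Sum>x\<in>carrier G. tr (\<rho> x * S) * tr (T * \<tau> (inv x)))"
proof -
  note c = rep_carrier[OF rep(1)] and c' = rep_carrier[OF rep(2)]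
  \<comment> \<open>\<open>F\<close> is constant on twisted conjugacy classes, the signs of
    \<open>S\<close> and \<open>T\<close> being immaterial; \<open>twisted_sum\<close> then carries
    the sum from the fixed points to the whole group.\<close>
  define F where "F x = tr (\<rho> x * S) * tr (T * \<tau> (inv x))" for x
  have "F (y \<otimes> x \<otimes> inv (s y)) = F x" if x: "x \<in> carrier G" and y: "y \<in> carrier G" for x y
  proof -
    note G = x y s_closed[OF y]
    have "\<rho> (y \<otimes> x \<otimes> inv (s y)) * S = \<rho> y * (\<rho> x * (\<rho> (inv (s y)) * S))"
      using G c S(1) by (simp add: rep_mult[OF rep(1)] assoc_mult_mat[of _ n n _ n _ n] mult_carrier_mat[of _ n n _ n])
    also have "\<rho> (inv (s y)) * S = S * \<rho> (inv y)"
      using S(2)[of "inv (s y)"] G by (simp add: s_inv s_s)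
    finally have "tr (\<rho> (y \<otimes> x \<otimes> inv (s y)) * S) = tr (\<rho> y * (\<rho> x * (S * \<rho> (inv y))))" by simp
    also have "\<dots> = tr (\<rho> x * (S * \<rho> (inv y)) * \<rho> y)"
      by (rule tr_comm) (use c[OF x] c[OF y] c[of "inv y"] S(1) y in auto)
    also have "\<rho> x * (S * \<rho> (inv y)) * \<rho> y = \<rho> x * (S * (\<rho> (inv y) * \<rho> y))"
      using c[OF x] c[OF y] c[of "inv y"] S(1) y by (simp add: assoc_mult_mat[of _ n n _ n _ n] mult_carrier_mat[of _ n n _ n])
    also have "\<rho> (inv y) * \<rho> y = 1\<^sub>m n"
      using y by (simp add: rep_mult[OF rep(1), symmetric] rep_one[OF rep(1)])
    also have "\<rho> x * (S * 1\<^sub>m n) = \<rho> x * S" using S(1) by simp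
    finally have 1: "tr (\<rho> (y \<otimes> x \<otimes> inv (s y)) * S) = tr (\<rho> x * S)" .
    have "inv (y \<otimes> x \<otimes> inv (s y)) = s y \<otimes> (inv x \<otimes> inv y)"
      using G by (simp add: inv_mult_group m_assoc)
    then have "T * \<tau> (inv (y \<otimes> x \<otimes> inv (s y))) = T * \<tau> (s y) * (\<tau> (inv x) * \<tau> (inv y))"
      using G c' T(1) by (simp add: rep_mult[OF rep(2)] assoc_mult_mat[of _ m m _ m _ m] mult_carrier_mat[of _ m m _ m])
    also have "\<dots> = \<tau> y * (T * (\<tau> (inv x) * \<tau> (inv y)))"
      unfolding T(2)[OF y, symmetric] using G c' T(1) by (simp add: assoc_mult_mat[of _ m m _ m _ m] mult_carrier_mat[of _ m m _ m])
    finally have "tr (T * \<tau> (inv (y \<otimes> x \<otimes> inv (s y)))) = tr (\<tau> y * (T * (\<tau> (inv x) * \<tau> (inv y))))" by simp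
    also have "\<dots> = tr (T * (\<tau> (inv x) * \<tau> (inv y)) * \<tau> y)"
      by (rule tr_comm) (use c'[of "inv x"] c'[OF y] c'[of "inv y"] T(1) y x in auto)
    also have "T * (\<tau> (inv x) * \<tau> (inv y)) * \<tau> y = T * (\<tau> (inv x) * (\<tau> (inv y) * \<tau> y))"
      using c'[of "inv x"] c'[OF y] c'[of "inv y"] T(1) x y by (simp add: assoc_mult_mat[of _ m m _ m _ m] mult_carrier_mat[of _ m m _ m])
    also have "\<tau> (inv y) * \<tau> y = 1\<^sub>m m"
      using y by (simp add: rep_mult[OF rep(2), symmetric] rep_one[OF rep(2)])
    also have "T * (\<tau> (inv x) * 1\<^sub>m m) = T * \<tau> (inv x)" using x c'[of "inv x"] by simp
    finally show ?thesis using 1 by (simp add: F_def)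
  qed
  from twisted_sum[OF this]
  have "of_nat (card (carrier G)) * (\<Sum>c\<in>fixed. F c) = of_nat (card fixed) * (\<Sum>x\<in>carrier G. F x)" by simp
  moreover have "(\<Sum>c\<in>fixed. F c) = (\<Sum>c\<in>fixed. tr (\<rho> c * S) * tr (\<tau> (inv c) * T))"
  proof (intro sum.cong refl)
    fix c assume c: "c \<in> fixed"
    note cG = fixedD[OF c]
    have "tr (T * \<tau> (inv c)) = tr (\<tau> (inv c) * T)"
      by (rule tr_comm) (use c'[of "inv c"] cG T in auto)
    then show "F c = tr (\<rho> c * S) * tr (\<tau> (inv c) * T)" by (simp add: F_def)
  qed
  ultimately show ?thesis by (simp add: F_def)
qed

text \<open>Orthogonality with \<open>\<rho>\<close> in both places gives norm one on the fixed
  points: the sum over \<open>G\<close> is |G|/n times tr (S S), and S S = 1 has trace n.\<close>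

lemma glauberman_signed:
  assumes irr: "irreducible_rep G n \<rho>"
    and S: "S \<in> carrier_mat n n" "S * S = 1\<^sub>m n" "\<And>x. x \<in> carrier G \<Longrightarrow> \<rho> x * S = S * \<rho> (s x)"
  obtains \<epsilon> :: complex where "glauberman C (rep_character G n \<rho>) \<in> Irr C" "\<epsilon> = 1 \<or> \<epsilon> = -1"
    "\<And>c. c \<in> fixed \<Longrightarrow> tr (\<rho> c * S) = \<epsilon> * glauberman C (rep_character G n \<rho>) c"
proof -
  interpret C: fin_group C by (rule fin_group_C)
  note rep = irreducible_is_rep[OF irr] and n = irreducible_pos[OF irr]
  have repC: "is_rep C n \<rho>"
    unfolding C.is_rep_iff using rep by (simp add: is_rep_iff fixed_def)
  have "of_nat (card (carrier G)) * (\<Sum>c\<in>fixed. tr (\<rho> c * S) * tr (\<rho> (inv c) * S))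
      = of_nat (card fixed) * of_nat (card (carrier G))"
    using n by (simp add: twisted_character_orthogonality[OF rep rep S(1,3) S(1,3)]
        tr_product_same[OF irr S(1) S(1)] S(2) tr_one)
  then have "(\<Sum>c\<in>fixed. tr (\<rho> c * S) * tr (\<rho> (inv c) * S)) = of_nat (card fixed)"
    using card_pos by simp
  then have norm: "(\<Sum>c\<in>carrier C. tr (\<rho> c * S) * tr (\<rho> (inv\<^bsub>C\<^esub> c) * S)) = of_nat (card (carrier C))"
    by (simp add: inv_C)
  have comm: "\<rho> c * S = S * \<rho> c" if "c \<in> carrier C" for c
    using S(3)[of c] that by (simp add: fixed_def)
  have \<chi>: "rep_character G n \<rho> c = tr (\<rho> c)" if "c \<in> carrier C" for c
    using that by (simp add: rep_character_eq[OF rep] fixed_def)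
  show thesis
    using C.glauberman_from_signed[OF repC S(1,2) comm norm \<chi>] that by auto
qed

text \<open>For distinct invariant characters the pairing of the twisted characters over
  \<open>fixed\<close> is 0. If the correspondents coincided, it would be |\<open>fixed\<close>| up
  to sign.\<close>

lemma glauberman_inj:
  "inj_on (glauberman C) {\<chi> \<in> Irr G. invariant \<chi>}"
proof (rule inj_onI, rule ccontr)
  interpret C: fin_group C by (rule fin_group_C)
  fix \<chi> \<psi> assume "\<chi> \<in> {\<chi> \<in> Irr G. invariant \<chi>}" "\<psi> \<in> {\<chi> \<in> Irr G. invariant \<chi>}"
    and eq: "glauberman C \<chi> = glauberman C \<psi>" and ne: "\<chi> \<noteq> \<psi>"
  then obtain n \<rho> m \<tau> where \<rho>: "irreducible_rep G n \<rho>" "\<chi> = rep_character G n \<rho>" "invariant \<chi>"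
    and \<tau>: "irreducible_rep G m \<tau>" "\<psi> = rep_character G m \<tau>" "invariant \<psi>"
    by (auto simp: Irr_def)
  obtain S where S: "S \<in> carrier_mat n n" "S * S = 1\<^sub>m n" "\<And>x. x \<in> carrier G \<Longrightarrow> \<rho> x * S = S * \<rho> (s x)"
    using invariant_intertwiner[OF \<rho>(1)] \<rho>(2,3) by blast
  obtain T where T: "T \<in> carrier_mat m m" "T * T = 1\<^sub>m m" "\<And>x. x \<in> carrier G \<Longrightarrow> \<tau> x * T = T * \<tau> (s x)"
    using invariant_intertwiner[OF \<tau>(1)] \<tau>(2,3) by blast
  obtain \<epsilon> :: complex where \<epsilon>: "glauberman C \<chi> \<in> Irr C" "\<epsilon> = 1 \<or> \<epsilon> = -1"
    "\<And>c. c \<in> fixed \<Longrightarrow> tr (\<rho> c * S) = \<epsilon> * glauberman C \<chi> c"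
    using glauberman_signed[OF \<rho>(1) S] \<rho>(2) by metis
  obtain \<delta> :: complex where \<delta>: "\<delta> = 1 \<or> \<delta> = -1"
    "\<And>c. c \<in> fixed \<Longrightarrow> tr (\<tau> c * T) = \<delta> * glauberman C \<psi> c"
    using glauberman_signed[OF \<tau>(1) T] \<tau>(2) by metis
  have "(\<Sum>c\<in>fixed. tr (\<rho> c * S) * tr (\<tau> (inv c) * T)) = 0"
    using twisted_character_orthogonality[OF \<rho>(1)[THEN irreducible_is_rep] \<tau>(1)[THEN irreducible_is_rep] S(1,3) T(1,3)]
      tr_product_distinct[OF \<rho>(1) \<tau>(1) _ S(1) T(1)] ne \<rho>(2) \<tau>(2) card_pos by simp
  moreover have "(\<Sum>c\<in>fixed. tr (\<rho> c * S) * tr (\<tau> (inv c) * T))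
    = (\<Sum>c\<in>fixed. \<epsilon> * \<delta> * (glauberman C \<chi> c * glauberman C \<chi> (inv\<^bsub>C\<^esub> c)))"
    using subgroup.m_inv_closed[OF fixed_subgroup]
    by (intro sum.cong) (auto simp: \<epsilon>(3) \<delta>(2) eq inv_C)
  ultimately have "\<epsilon> * \<delta> * (\<Sum>c\<in>fixed. glauberman C \<chi> c * glauberman C \<chi> (inv\<^bsub>C\<^esub> c)) = 0"
    by (simp add: sum_distrib_left)
  moreover have "(\<Sum>c\<in>fixed. glauberman C \<chi> c * glauberman C \<chi> (inv\<^bsub>C\<^esub> c)) = of_nat (card fixed)"
    using C.Irr_orthogonality[OF \<epsilon>(1) \<epsilon>(1)] by simp
  ultimately show False using \<epsilon>(2) \<delta>(1) card_C_pos by auto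
qed

text \<open>As S^2 = 1, \<rho>(s(x)) = S \<rho>(x) S, so every summand is a trace sandwich and the
  sum factors into tr (\<rho>(c) S) and tr S. Both factors carry the same sign \<epsilon>, whose
  square is 1.\<close>

lemma glauberman_twisted_sum:
  assumes \<chi>: "\<chi> \<in> Irr G" "invariant \<chi>" and c: "c \<in> fixed"
  shows "\<chi> \<one> * (\<Sum>x\<in>carrier G. \<chi> (c \<otimes> s x \<otimes> inv x))
    = of_nat (card (carrier G)) * (glauberman C \<chi> \<one> * glauberman C \<chi> c)"
proof -
  obtain n \<rho> where \<rho>: "irreducible_rep G n \<rho>" "\<chi> = rep_character G n \<rho>"
    "\<And>g. g \<in> carrier G \<Longrightarrow> \<chi> g = tr (\<rho> g)" "\<chi> \<one> = of_nat n" "n > 0"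
    using Irr_E[OF \<chi>(1)] by blast
  note rep = irreducible_is_rep[OF \<rho>(1)]
  note cr = rep_carrier[OF rep]
  obtain S where S: "S \<in> carrier_mat n n" "S * S = 1\<^sub>m n" "\<And>x. x \<in> carrier G \<Longrightarrow> \<rho> x * S = S * \<rho> (s x)"
    using invariant_intertwiner[OF \<rho>(1)] \<rho>(2) \<chi>(2) by blast
  obtain \<epsilon> :: complex where \<epsilon>: "\<epsilon> = 1 \<or> \<epsilon> = -1"
    "\<And>c. c \<in> fixed \<Longrightarrow> tr (\<rho> c * S) = \<epsilon> * glauberman C \<chi> c"
    using glauberman_signed[OF \<rho>(1) S] \<rho>(2) by metis
  note cG = fixedD[OF c]
  have one: "\<one> \<in> fixed" by (simp add: fixed_def s_one)
  have A: "\<rho> c * S \<in> carrier_mat n n" using cr[OF cG(1)] S(1) by simp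
  have "\<chi> (c \<otimes> s x \<otimes> inv x) = tr (\<rho> c * S * \<rho> x * S * \<rho> (inv x))" if x: "x \<in> carrier G" for x
  proof -
    note cc = cr[OF cG(1)] cr[OF x] cr[OF s_closed[OF x]] cr[OF inv_closed[OF x]]
    have "\<rho> c * S * \<rho> x * S * \<rho> (inv x) = \<rho> c * (S * (\<rho> x * S) * \<rho> (inv x))"
      using cc S(1) by (simp add: assoc_mult_mat[of _ n n _ n _ n] mult_carrier_mat[of _ n n _ n])
    also have "S * (\<rho> x * S) = S * S * \<rho> (s x)"
      unfolding S(3)[OF x] using cc S(1) by (simp add: assoc_mult_mat[of _ n n _ n _ n] mult_carrier_mat[of _ n n _ n])
    also have "\<dots> = \<rho> (s x)" unfolding S(2) using cc by simp
    also have "\<rho> c * (\<rho> (s x) * \<rho> (inv x)) = \<rho> (c \<otimes> s x \<otimes> inv x)"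
      using x cG s_closed by (simp add: rep_mult[OF rep, symmetric] m_assoc)
    finally show ?thesis using x cG s_closed by (simp add: \<rho>(3))
  qed
  then have "(\<Sum>x\<in>carrier G. \<chi> (c \<otimes> s x \<otimes> inv x)) = of_nat (card (carrier G)) / of_nat n * tr (\<rho> c * S) * tr S"
    using tr_sandwich_same[OF \<rho>(1) A S(1)] by simp
  moreover have "tr S = \<epsilon> * glauberman C \<chi> \<one>"
    using \<epsilon>(2)[OF one] S(1) by (simp add: rep_one[OF rep])
  ultimately show ?thesis
    using \<rho>(4,5) \<epsilon> c by auto
qed

text \<open>The representation and its twist now have different characters, so the sandwich of the
  two sums to 0 by Schur orthogonality.\<close>

lemma noninvariant_twisted_sum:
  assumes \<chi>: "\<chi> \<in> Irr G" "\<not> invariant \<chi>" and c: "c \<in> fixed"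
  shows "(\<Sum>x\<in>carrier G. \<chi> (c \<otimes> s x \<otimes> inv x)) = 0"
proof -
  obtain n \<rho> where \<rho>: "irreducible_rep G n \<rho>" "\<chi> = rep_character G n \<rho>"
    "\<And>g. g \<in> carrier G \<Longrightarrow> \<chi> g = tr (\<rho> g)"
    using Irr_E[OF \<chi>(1)] by blast
  note rep = irreducible_is_rep[OF \<rho>(1)]
  note cr = rep_carrier[OF rep] and cG = fixedD[OF c]
  have ne: "rep_character G n (\<lambda>x. \<rho> (s x)) \<noteq> rep_character G n \<rho>"
  proof
    assume "rep_character G n (\<lambda>x. \<rho> (s x)) = rep_character G n \<rho>"
    note eq = fun_cong[OF this]
    have "\<chi> (s x) = \<chi> x" if x: "x \<in> carrier G" for x
      using eq[of x] unfolding rep_character_eq[OF rep_twist[OF rep] x] \<rho>(2)[symmetric] \<rho>(3)[OF s_closed[OF x]] .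
    then have "invariant \<chi>" by (simp add: invariant_def)
    with \<chi>(2) show False ..
  qed
  \<comment> \<open>The identity matrix is inserted as the second coefficient matrix of the
    sandwich.\<close>
  have "(\<Sum>x\<in>carrier G. \<chi> (c \<otimes> s x \<otimes> inv x)) = (\<Sum>x\<in>carrier G. tr (\<rho> c * \<rho> (s x) * 1\<^sub>m n * \<rho> (inv x)))"
  proof (intro sum.cong refl)
    fix x assume x: "x \<in> carrier G"
    have "\<rho> c * \<rho> (s x) * 1\<^sub>m n = \<rho> (c \<otimes> s x)"
      unfolding rep_mult[OF rep cG(1) s_closed[OF x]]
      by (rule right_mult_one_mat[OF mult_carrier_mat[OF cr[OF cG(1)] cr[OF s_closed[OF x]]]])
    then show "\<chi> (c \<otimes> s x \<otimes> inv x) = tr (\<rho> c * \<rho> (s x) * 1\<^sub>m n * \<rho> (inv x))"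
      using x cG s_closed by (simp add: \<rho>(3) rep_mult[OF rep])
  qed
  also have "\<dots> = 0"
    by (rule tr_sandwich_distinct[OF irreducible_twist[OF \<rho>(1)] \<rho>(1) ne]) (use cr[OF cG(1)] in auto)
  finally show ?thesis .
qed

text \<open>The expansion of \<open>f\<close> over its constituents is summed term by term.
  Injectivity of the correspondence is what allows the sum over the image set to be read as a sum
  over characters of \<open>G\<close>.\<close>

theorem glauberman_sum:
  assumes cls: "\<And>x y. x \<in> carrier G \<Longrightarrow> y \<in> carrier G \<Longrightarrow> f (y \<otimes> x \<otimes> inv y) = f x"
    and idem: "\<And>x. x \<in> carrier G \<Longrightarrow> (\<Sum>y\<in>carrier G. f y * f (inv y \<otimes> x)) = of_nat (card (carrier G)) * f x"
    and c: "c \<in> fixed"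
  shows "of_nat (card (carrier G)) *
      (\<Sum>\<psi>\<in>glauberman C ` {\<chi> \<in> Irr G. invariant \<chi> \<and> char_inner G \<chi> f \<noteq> 0}. \<psi> \<one> * \<psi> c)
    = (\<Sum>x\<in>carrier G. f (c \<otimes> s x \<otimes> inv x))"
proof -
  let ?X = "{\<chi> \<in> Irr G. char_inner G \<chi> f \<noteq> 0}"
  let ?Y = "{\<chi> \<in> Irr G. invariant \<chi> \<and> char_inner G \<chi> f \<noteq> 0}"
  note cG = fixedD[OF c]
  have "(\<Sum>x\<in>carrier G. f (c \<otimes> s x \<otimes> inv x)) = (\<Sum>x\<in>carrier G. \<Sum>\<chi>\<in>?X. \<chi> \<one> * \<chi> (c \<otimes> s x \<otimes> inv x))"
    using cG s_closed by (intro sum.cong refl idempotent_class_function_expansion[OF cls idem]) auto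
  also have "\<dots> = (\<Sum>\<chi>\<in>?X. \<chi> \<one> * (\<Sum>x\<in>carrier G. \<chi> (c \<otimes> s x \<otimes> inv x)))"
    by (subst sum.swap) (simp add: sum_distrib_left)
  also have "\<dots> = (\<Sum>\<chi>\<in>?Y. \<chi> \<one> * (\<Sum>x\<in>carrier G. \<chi> (c \<otimes> s x \<otimes> inv x)))"
    using finite_Irr noninvariant_twisted_sum[OF _ _ c] by (intro sum.mono_neutral_right) auto
  also have "\<dots> = (\<Sum>\<chi>\<in>?Y. of_nat (card (carrier G)) * (glauberman C \<chi> \<one> * glauberman C \<chi> c))"
    using glauberman_twisted_sum[OF _ _ c] by (intro sum.cong) auto
  also have "\<dots> = of_nat (card (carrier G)) * (\<Sum>\<psi>\<in>glauberman C ` ?Y. \<psi> \<one> * \<psi> c)"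
    using inj_on_subset[OF glauberman_inj, of ?Y]
    by (subst sum.reindex) (auto simp: sum_distrib_left)
  finally show ?thesis ..
qed

end

section \<open>Algebra groups with involution\<close>

lemma mult_monoid_simps [simp]:
  "carrier mult_monoid = UNIV" "x \<otimes>\<^bsub>mult_monoid\<^esub> y = x * y" "\<one>\<^bsub>mult_monoid\<^esub> = 1"
  by (simp_all add: mult_monoid_def)

lemma algebra_group_simps [simp]:
  "carrier (algebra_group J) = (\<lambda>a. 1 + a) ` J" "x \<otimes>\<^bsub>algebra_group J\<^esub> y = x * y" "\<one>\<^bsub>algebra_group J\<^esub> = 1"
  by (simp_all add: algebra_group_def mult_monoid_def)

lemma minv_eq:
  fixes x y :: "'a::monoid_mult"
  assumes "x * y = 1" "y * x = 1"
  shows "minv x = y"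
  unfolding m_inv_def
proof (rule the_equality)
  show "y \<in> carrier mult_monoid \<and> x \<otimes>\<^bsub>mult_monoid\<^esub> y = \<one>\<^bsub>mult_monoid\<^esub> \<and> y \<otimes>\<^bsub>mult_monoid\<^esub> x = \<one>\<^bsub>mult_monoid\<^esub>"
    using assms by simp
  fix z assume "z \<in> carrier mult_monoid \<and> x \<otimes>\<^bsub>mult_monoid\<^esub> z = \<one>\<^bsub>mult_monoid\<^esub> \<and> z \<otimes>\<^bsub>mult_monoid\<^esub> x = \<one>\<^bsub>mult_monoid\<^esub>"
  then have z: "x * z = 1" by simp
  have "z = y * x * z" using assms by simp
  also have "\<dots> = y" using z by (simp add: mult.assoc)
  finally show "z = y" .
qed

text \<open>Pairs \<open>x\<close>, \<open>f x\<close> are removed one after the other. Negation on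
  the nonzero elements of \<open>J\<close> is the case of interest: it makes the order of
  \<open>P\<close> odd.\<close>

lemma even_card_fixpoint_free_involution:
  assumes "finite S" "\<And>x. x \<in> S \<Longrightarrow> f x \<in> S" "\<And>x. x \<in> S \<Longrightarrow> f (f x) = x" "\<And>x. x \<in> S \<Longrightarrow> f x \<noteq> x"
  shows "even (card S)"
  using assms
proof (induction "card S" arbitrary: S rule: less_induct)
  case less
  show ?case
  proof (cases "S = {}")
    case False
    then obtain x where x: "x \<in> S" by blast
    let ?T = "S - {x, f x}"
    have sub: "{x, f x} \<subseteq> S" using x less.prems by auto
    have two: "card {x, f x} = 2" using less.prems(4)[OF x] by auto
    have card: "card S = card ?T + 2"
      using card_Diff_subset[OF _ sub] card_mono[OF less.prems(1) sub] two by simp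
    have "even (card ?T)"
    proof (rule less.hyps)
      show "card ?T < card S" using card by simp
      show "f y \<in> ?T" if "y \<in> ?T" for y
        using that less.prems(2,3)[of y] less.prems(3)[OF x] by auto
    qed (use less.prems in auto)
    then show ?thesis using card by simp
  qed simp
qed

text \<open>Scalars enter the argument through division by 2, which is kept as the map
  \<open>h\<close>. By \<open>half_double\<close> and \<open>double_inj\<close> a half is determined
  by its double, so identities for \<open>h\<close> are checked after doubling.\<close>

locale nilpotent_involution_ring =
  fixes \<sigma> :: "'a::ring_1 \<Rightarrow> 'a" and J :: "'a set" and h :: "'a \<Rightarrow> 'a"
  assumes finite_J: "finite J"
    and J_zero: "0 \<in> J" and J_add: "a \<in> J \<Longrightarrow> b \<in> J \<Longrightarrow> a + b \<in> J"
    and J_minus: "a \<in> J \<Longrightarrow> - a \<in> J" and J_mult: "a \<in> J \<Longrightarrow> b \<in> J \<Longrightarrow> a * b \<in> J"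
    and J_half: "a \<in> J \<Longrightarrow> h a \<in> J" and J_nil: "a \<in> J \<Longrightarrow> \<exists>n>0. a ^ n = 0"
    and half_double: "h x + h x = x" and double_inj: "x + x = y + y \<Longrightarrow> x = y"
    and \<sigma>_add: "\<sigma> (a + b) = \<sigma> a + \<sigma> b" and \<sigma>_mult: "\<sigma> (a * b) = \<sigma> b * \<sigma> a"
    and \<sigma>_\<sigma>: "\<sigma> (\<sigma> a) = a" and \<sigma>_J: "a \<in> J \<Longrightarrow> \<sigma> a \<in> J"
begin

lemma J_diff: "a \<in> J \<Longrightarrow> b \<in> J \<Longrightarrow> a - b \<in> J"
  using J_add[of a "- b"] J_minus by simp

lemma half_add: "h (a + b) = h a + h b"
  by (rule double_inj) (metis half_double add.assoc add.commute)

lemma half_minus: "h (- a) = - h a"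
  by (rule double_inj) (metis half_double minus_add_distrib)

lemma half_diff: "h (a - b) = h a - h b"
  using half_add[of a "- b"] by (simp add: half_minus)

lemma half_mult_right: "h (a * b) = h a * b"
  by (rule double_inj) (metis half_double distrib_right)

lemma half_mult_left: "h (a * b) = a * h b"
  by (rule double_inj) (metis half_double distrib_left)

lemma half_of_double: "h (a + a) = a"
  by (rule double_inj) (rule half_double)

lemma \<sigma>_zero: "\<sigma> 0 = 0"
  using \<sigma>_add[of 0 0] by simp

lemma \<sigma>_minus: "\<sigma> (- a) = - \<sigma> a"
  using \<sigma>_add[of a "- a"] by (simp add: \<sigma>_zero eq_neg_iff_add_eq_0 add.commute)

lemma \<sigma>_diff: "\<sigma> (a - b) = \<sigma> a - \<sigma> b"
  using \<sigma>_add[of a "- b"] by (simp add: \<sigma>_minus)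

text \<open>Halves are determined by their doubles, so additivity of \<sigma> suffices to preserve
  them, whatever \<sigma> does to scalars.\<close>

lemma \<sigma>_half: "\<sigma> (h a) = h (\<sigma> a)"
  by (rule double_inj) (simp add: half_double flip: \<sigma>_add)

lemma \<sigma>_one: "\<sigma> 1 = 1"
  using \<sigma>_mult[of "\<sigma> 1" 1] \<sigma>_\<sigma>[of 1] by (simp add: \<sigma>_\<sigma>)

definition P :: "'a set" where "P = (\<lambda>a. 1 + a) ` J"

abbreviation G :: "'a monoid" where "G \<equiv> algebra_group J"

lemma carrier_G: "carrier G = P" by (simp add: P_def)

lemma P_iff: "x \<in> P \<longleftrightarrow> x - 1 \<in> J"
  unfolding P_def by (auto simp: image_iff intro: bexI[of _ "x - 1"])

lemma P_one_add: "a \<in> J \<Longrightarrow> 1 + a \<in> P" and P_one_diff: "a \<in> J \<Longrightarrow> 1 - a \<in> P"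
  by (auto simp: P_iff J_minus)

lemma P_one: "1 \<in> P"
  by (simp add: P_iff J_zero)

lemma P_mult: "x \<in> P \<Longrightarrow> y \<in> P \<Longrightarrow> x * y \<in> P"
proof -
  assume "x \<in> P" "y \<in> P"
  then have "(x - 1) * (y - 1) + (x - 1) + (y - 1) \<in> J" by (simp add: P_iff J_add J_mult)
  then show ?thesis by (simp add: P_iff algebra_simps)
qed

lemma P_J: "x \<in> P \<Longrightarrow> a \<in> J \<Longrightarrow> x * a \<in> J"
  using J_add[OF J_mult[of "x - 1" a], of a] by (simp add: P_iff left_diff_distrib)

lemma J_P: "x \<in> P \<Longrightarrow> a \<in> J \<Longrightarrow> a * x \<in> J"
  using J_add[OF J_mult[of a "x - 1"], of a] by (simp add: P_iff right_diff_distrib)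

lemma P_J_P: "x \<in> P \<Longrightarrow> y \<in> P \<Longrightarrow> a \<in> J \<Longrightarrow> x * a * y \<in> J"
  by (simp add: P_J J_P)

text \<open>The geometric series in \<open>1 - x\<close> terminates by nilpotency, and its terms
  after the first lie in \<open>J\<close>.\<close>

lemma P_inverse:
  assumes "x \<in> P"
  shows "\<exists>y\<in>P. x * y = 1 \<and> y * x = 1"
proof -
  define c where "c = 1 - x"
  have c: "c \<in> J" using assms J_minus[of "x - 1"] by (simp add: c_def P_iff)
  obtain n where n: "c ^ Suc n = 0" using J_nil[OF c] by (metis gr0_conv_Suc)
  define y where "y = (\<Sum>i<Suc n. c ^ i)"
  have pow: "c ^ Suc i \<in> J" for i
    by (induction i) (use c J_mult in auto)
  have sum: "(\<Sum>i<k. c ^ Suc i) \<in> J" for k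
    by (induction k) (use pow J_add J_zero in auto)
  have "y = 1 + (\<Sum>i<n. c ^ Suc i)"
    unfolding y_def by (subst sum.lessThan_Suc_shift) simp
  then have y: "y \<in> P" using sum by (simp add: P_iff)
  have l: "(1 - c) * (\<Sum>i<k. c ^ i) = 1 - c ^ k" for k
  proof (induction k)
    case (Suc k)
    have "(1 - c) * (\<Sum>i<Suc k. c ^ i) = (1 - c) * (\<Sum>i<k. c ^ i) + (1 - c) * c ^ k"
      by (simp only: sum.lessThan_Suc distrib_left)
    also have "\<dots> = 1 - c ^ Suc k" unfolding Suc.IH by (simp add: left_diff_distrib)
    finally show ?case .
  qed simp
  have r: "(\<Sum>i<k. c ^ i) * (1 - c) = 1 - c ^ k" for k
  proof (induction k)
    case (Suc k)
    have "(\<Sum>i<Suc k. c ^ i) * (1 - c) = (\<Sum>i<k. c ^ i) * (1 - c) + c ^ k * (1 - c)"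
      by (simp only: sum.lessThan_Suc distrib_right)
    also have "\<dots> = 1 - c ^ Suc k" unfolding Suc.IH power_Suc2 by (simp add: right_diff_distrib)
    finally show ?case .
  qed simp
  have "x * y = 1" "y * x = 1"
    using l[of "Suc n"] r[of "Suc n"] n by (simp_all only: y_def c_def) simp_all
  with y show ?thesis by blast
qed

lemma P_minv: "x \<in> P \<Longrightarrow> minv x \<in> P" and minv_right: "x \<in> P \<Longrightarrow> x * minv x = 1"
  and minv_left: "x \<in> P \<Longrightarrow> minv x * x = 1"
  using P_inverse[of x] minv_eq[of x] by auto

lemma minv_cancel:
  assumes "x \<in> P"
  shows "minv x * (x * y) = y" "x * (minv x * y) = y"
  using assms by (simp_all add: mult.assoc[symmetric] minv_left minv_right)

lemma minv_minv: "x \<in> P \<Longrightarrow> minv (minv x) = x"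
  by (rule minv_eq) (simp_all add: minv_left minv_right)

lemma minv_mult: "x \<in> P \<Longrightarrow> y \<in> P \<Longrightarrow> minv (x * y) = minv y * minv x"
  by (rule minv_eq) (simp_all add: mult.assoc minv_cancel minv_left minv_right)

lemma \<sigma>_P: "x \<in> P \<Longrightarrow> \<sigma> x \<in> P"
  using \<sigma>_J[of "x - 1"] by (simp add: P_iff \<sigma>_diff \<sigma>_one)

lemma \<sigma>_minv: "x \<in> P \<Longrightarrow> \<sigma> (minv x) = minv (\<sigma> x)"
  by (rule minv_eq[symmetric]) (simp_all add: \<sigma>_one minv_left minv_right flip: \<sigma>_mult)

lemma finite_P: "finite P"
  using finite_J by (simp add: P_def)

lemma card_P: "card P = card J"
  by (simp add: P_def card_image inj_on_def)

lemma odd_card_J: "odd (card J)"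
proof -
  have "even (card (J - {0}))"
  proof (rule even_card_fixpoint_free_involution[where f = uminus])
    fix x assume x: "x \<in> J - {0}"
    show "- x \<noteq> x"
    proof
      assume "- x = x"
      then have "x + x = 0 + 0" by (metis add.right_inverse add_0)
      then have "x = 0" by (rule double_inj)
      with x show False by simp
    qed
  qed (use finite_J J_minus in auto)
  then show ?thesis using card_Suc_Diff1[OF finite_J J_zero] by (metis even_Suc)
qed

lemma group_G: "group G"
proof (rule groupI)
  show "\<exists>y\<in>carrier G. y \<otimes>\<^bsub>G\<^esub> x = \<one>\<^bsub>G\<^esub>" if "x \<in> carrier G" for x
    using that P_inverse[of x] unfolding carrier_G by auto
  show "x \<otimes>\<^bsub>G\<^esub> y \<in> carrier G" if "x \<in> carrier G" "y \<in> carrier G" for x y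
    using that P_mult unfolding carrier_G by simp
  show "\<one>\<^bsub>G\<^esub> \<in> carrier G" using P_one unfolding carrier_G by simp
qed (simp_all add: mult.assoc)

lemma inv_G: "x \<in> P \<Longrightarrow> inv\<^bsub>G\<^esub> x = minv x"
  using group.inv_equality[OF group_G, of "minv x" x] P_minv minv_left
  unfolding carrier_G by simp

lemma group_act_eq: "x \<in> P \<Longrightarrow> group_act \<sigma> x = minv (\<sigma> x)"
  by (simp add: group_act_def \<sigma>_minv)

sublocale G: odd_involution_group G "group_act \<sigma>"
proof (intro odd_involution_group.intro odd_involution_group_axioms.intro fin_group.intro fin_group_axioms.intro)
  show "group G" by (rule group_G)
  show "finite (carrier G)" unfolding carrier_G by (rule finite_P)
  show "odd (card (carrier G))" unfolding carrier_G card_P by (rule odd_card_J)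
  fix x assume "x \<in> carrier G"
  then have x: "x \<in> P" unfolding carrier_G .
  show "group_act \<sigma> x \<in> carrier G" using x by (simp only: carrier_G group_act_eq P_minv \<sigma>_P)
  show "group_act \<sigma> (group_act \<sigma> x) = x"
    using x by (simp add: group_act_eq P_minv \<sigma>_P \<sigma>_minv \<sigma>_\<sigma> minv_minv)
  fix y assume "y \<in> carrier G"
  then have y: "y \<in> P" unfolding carrier_G .
  show "group_act \<sigma> (x \<otimes>\<^bsub>G\<^esub> y) = group_act \<sigma> x \<otimes>\<^bsub>G\<^esub> group_act \<sigma> y"
    using x y by (simp add: group_act_eq P_mult \<sigma>_P \<sigma>_mult minv_mult)
qed

lemma fixed_group_eq: "fixed_group \<sigma> J = G.C"
  by (simp only: fixed_group_def G.fixed_def) (simp add: algebra_group_def)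

text \<open>\<open>x + 1\<close> is twice \<open>1 + h (x - 1)\<close>, so it need not lie in
  \<open>P\<close>, but it is inverted by half of an inverse taken in \<open>P\<close>. In this form
  Psi(x) differs from (x - 1)/2 only by a right factor from \<open>P\<close>.\<close>

lemma inv_cayley_eq:
  assumes "x \<in> P"
  shows "inv_cayley x = h (x - 1) * minv (1 + h (x - 1))"
proof -
  define a where "a = h (x - 1)"
  have a: "a \<in> J" using assms by (simp add: a_def P_iff J_half)
  define w where "w = minv (1 + a)"
  have w: "(1 + a) * w = 1" "w * (1 + a) = 1"
    using P_one_add[OF a] by (simp_all add: w_def minv_left minv_right)
  have x: "x + 1 = (1 + a) + (1 + a)"
    using half_double[of "x - 1"] by (simp add: a_def algebra_simps)
  have "minv (x + 1) = h w"
  proof (rule minv_eq)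
    show "(x + 1) * h w = 1"
    proof -
      have "(x + 1) * h w = (1 + a) * (h w + h w)" unfolding x by (simp add: distrib_left distrib_right add_ac)
      then show ?thesis by (simp only: half_double w)
    qed
    show "h w * (x + 1) = 1"
    proof -
      have "h w * (x + 1) = (h w + h w) * (1 + a)" unfolding x by (simp add: distrib_left distrib_right add_ac)
      then show ?thesis by (simp only: half_double w)
    qed
  qed
  then have "inv_cayley x = h ((x - 1) * w)" by (simp add: inv_cayley_def half_mult_left)
  then show ?thesis by (simp add: half_mult_right a_def w_def)
qed

section \<open>Linear characters of J and their two-sided orbits\<close>

lemma dual_zero: "\<mu> \<in> dual J \<Longrightarrow> \<mu> 0 = 1"
  using J_zero unfolding dual_def by (metis (mono_tags, lifting) add_0 mem_Collect_eq mult_cancel_right1)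

lemma dual_add: "\<mu> \<in> dual J \<Longrightarrow> a \<in> J \<Longrightarrow> b \<in> J \<Longrightarrow> \<mu> (a + b) = \<mu> a * \<mu> b"
  and dual_nonzero: "\<mu> \<in> dual J \<Longrightarrow> a \<in> J \<Longrightarrow> \<mu> a \<noteq> 0"
  by (auto simp: dual_def)

lemma dual_diff: "\<mu> \<in> dual J \<Longrightarrow> a \<in> J \<Longrightarrow> b \<in> J \<Longrightarrow> \<mu> (a - b) = \<mu> a / \<mu> b"
  using dual_add[of \<mu> "a - b" b] dual_nonzero[of \<mu> b] by (simp add: J_diff field_simps)

lemma dual_eqI: "\<mu> \<in> dual J \<Longrightarrow> \<nu> \<in> dual J \<Longrightarrow> (\<And>a. a \<in> J \<Longrightarrow> \<mu> a = \<nu> a) \<Longrightarrow> \<mu> = \<nu>"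
  unfolding dual_def by (auto intro: extensionalityI)

text \<open>If \<mu> is not 1 at some \<open>c\<close> in \<open>K\<close>, translating the
  summation by \<open>c\<close> multiplies the sum by \<mu>(c), so the sum is 0.\<close>

lemma dual_sum:
  assumes \<mu>: "\<mu> \<in> dual J" and K: "K \<subseteq> J" "\<And>a b. a \<in> K \<Longrightarrow> b \<in> K \<Longrightarrow> a + b \<in> K" "\<And>a. a \<in> K \<Longrightarrow> - a \<in> K"
  shows "(\<Sum>b\<in>K. \<mu> b) = (if \<forall>b\<in>K. \<mu> b = 1 then of_nat (card K) else 0)"
proof (cases "\<forall>b\<in>K. \<mu> b = 1")
  case False
  then obtain c where c: "c \<in> K" "\<mu> c \<noteq> 1" by blast
  have sub: "b - c \<in> K" if "b \<in> K" for b using K(2)[OF that K(3)[OF c(1)]] by simp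
  have "(\<Sum>b\<in>K. \<mu> b) = (\<Sum>b\<in>K. \<mu> (c + b))"
    by (rule sum.reindex_bij_witness[of _ "\<lambda>b. c + b" "\<lambda>b. b - c"]) (use c K sub in auto)
  also have "\<dots> = \<mu> c * (\<Sum>b\<in>K. \<mu> b)"
    using c by (simp add: sum_distrib_left dual_add[OF \<mu> subsetD[OF K(1)] subsetD[OF K(1)]])
  finally have "(1 - \<mu> c) * (\<Sum>b\<in>K. \<mu> b) = 0" by (simp add: algebra_simps)
  with c(2) False show ?thesis by auto
qed simp

text \<open>Pullback of \<mu> along \<open>a \<mapsto> u * a * v\<close>, free of the inverses in
  \<open>left_act\<close> and \<open>right_act\<close>. Its orbits are still those of
  \<open>two_sided_orbit\<close>, because \<open>P\<close> is closed under inverses.\<close>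

definition act :: "'a \<Rightarrow> ('a \<Rightarrow> complex) \<Rightarrow> 'a \<Rightarrow> 'a \<Rightarrow> complex" where
  "act u \<mu> v = (\<lambda>a\<in>J. \<mu> (u * a * v))"

lemma act_dual: "\<mu> \<in> dual J \<Longrightarrow> u \<in> P \<Longrightarrow> v \<in> P \<Longrightarrow> act u \<mu> v \<in> dual J"
  by (auto simp: dual_def act_def J_add P_J_P distrib_left distrib_right)

lemma act_act:
  assumes "u \<in> P" "v \<in> P" "u' \<in> P" "v' \<in> P"
  shows "act u (act u' \<mu> v') v = act (u' * u) \<mu> (v * v')"
  using assms by (auto simp: act_def P_J_P mult.assoc fun_eq_iff restrict_def) (simp add: P_J_P mult.assoc[symmetric])

lemma act_one: "\<mu> \<in> dual J \<Longrightarrow> act 1 \<mu> 1 = \<mu>"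
  by (auto simp: act_def dual_def intro: extensional_restrict)

lemma two_sided_orbit_eq: "two_sided_orbit J \<theta> = {act u \<theta> v | u v. u \<in> P \<and> v \<in> P}"
proof -
  have "right_act J (left_act J x \<theta>) y = act (minv x) \<theta> (minv y)" if "x \<in> P" "y \<in> P" for x y
    using that by (auto simp: right_act_def left_act_def act_def fun_eq_iff J_P P_minv mult.assoc)
  then have "two_sided_orbit J \<theta> = {act (minv x) \<theta> (minv y) | x y. x \<in> P \<and> y \<in> P}"
    unfolding two_sided_orbit_def carrier_G by metis
  also have "\<dots> = {act u \<theta> v | u v. u \<in> P \<and> v \<in> P}"
    using P_minv minv_minv by (auto; metis)
  finally show ?thesis .
qed

end

section \<open>Orbit sums of linear characters\<close>

context nilpotent_involution_ring
begin

definition orbit_sum :: "('a \<Rightarrow> complex) \<Rightarrow> 'a \<Rightarrow> complex" where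
  "orbit_sum \<theta> a = (\<Sum>\<mu>\<in>two_sided_orbit J \<theta>. \<mu> a)"

text \<open>The function f of the overview with Psi(x) replaced by (x - 1)/2. The two versions agree
  on \<open>P\<close> by \<open>orbit_sum_inv_cayley\<close>, and this one has an argument affine in
  \<open>x\<close>.\<close>

definition orbit_class_fun :: "('a \<Rightarrow> complex) \<Rightarrow> 'a \<Rightarrow> complex" where
  "orbit_class_fun \<theta> x = orbit_sum \<theta> (h (x - 1))"

text \<open>The action on \<open>J\<close> is \<open>- \<sigma> a\<close>, so these are the elements
  that it negates; its fixed points are the skew elements.\<close>

definition J_plus :: "'a set" where
  "J_plus = {a \<in> J. \<sigma> a = a}"

text \<open>The quotient of two linear characters is a linear character of \<open>J\<close>, trivial
  exactly when they agree.\<close>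

lemma dual_orthogonality:
  assumes "\<mu> \<in> dual J" "\<nu> \<in> dual J"
  shows "(\<Sum>c\<in>J. \<mu> c / \<nu> c) = (if \<mu> = \<nu> then of_nat (card J) else 0)"
proof -
  define \<kappa> where "\<kappa> = (\<lambda>a\<in>J. \<mu> a / \<nu> a)"
  have "\<kappa> \<in> dual J"
    using assms by (auto simp: dual_def \<kappa>_def J_add)
  then have "(\<Sum>c\<in>J. \<kappa> c) = (if \<forall>c\<in>J. \<kappa> c = 1 then of_nat (card J) else 0)"
    by (rule dual_sum) (auto simp: J_add J_minus)
  moreover have "(\<forall>c\<in>J. \<kappa> c = 1) \<longleftrightarrow> \<mu> = \<nu>"
    using assms dual_nonzero dual_eqI[OF assms] by (auto simp: \<kappa>_def)
  ultimately show ?thesis by (simp add: \<kappa>_def)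
qed

lemma sum_over_P: "(\<Sum>x\<in>P. F x) = (\<Sum>b\<in>J. F (1 + b))"
  unfolding P_def by (subst sum.reindex) (auto simp: inj_on_def)

context
  fixes \<theta>
  assumes \<theta>: "\<theta> \<in> dual J"
begin

abbreviation "orb \<equiv> two_sided_orbit J \<theta>"

lemma orbit_dual: "\<mu> \<in> orb \<Longrightarrow> \<mu> \<in> dual J"
  using act_dual[OF \<theta>] by (auto simp: two_sided_orbit_eq)

lemma finite_orbit: "finite orb"
proof -
  have "orb = (\<lambda>(u, v). act u \<theta> v) ` (P \<times> P)" by (auto simp: two_sided_orbit_eq)
  then show ?thesis using finite_P by simp
qed

lemma act_orbit: "\<mu> \<in> orb \<Longrightarrow> u \<in> P \<Longrightarrow> v \<in> P \<Longrightarrow> act u \<mu> v \<in> orb"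
  unfolding two_sided_orbit_eq using act_act P_mult by blast

lemma act_inverse:
  assumes "\<mu> \<in> orb" "u \<in> P" "v \<in> P"
  shows "act (minv u) (act u \<mu> v) (minv v) = \<mu>" "act u (act (minv u) \<mu> (minv v)) v = \<mu>"
  using assms by (simp_all add: act_act P_minv minv_left minv_right act_one orbit_dual)

lemma orbit_sum_invariant:
  assumes "a \<in> J" "u \<in> P" "v \<in> P"
  shows "orbit_sum \<theta> (u * a * v) = orbit_sum \<theta> a"
  unfolding orbit_sum_def
  by (rule sum.reindex_bij_witness[of _ "\<lambda>\<mu>. act (minv u) \<mu> (minv v)" "\<lambda>\<mu>. act u \<mu> v"])
    (use assms in \<open>simp_all add: act_inverse act_orbit P_minv\<close>, simp add: act_def)

text \<open>An orbit sum is a sum of distinct linear characters, each an idempotent for additive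
  convolution up to the factor |J|, with vanishing cross terms.\<close>

lemma orbit_sum_convolution:
  assumes a: "a \<in> J"
  shows "(\<Sum>c\<in>J. orbit_sum \<theta> c * orbit_sum \<theta> (a - c)) = of_nat (card J) * orbit_sum \<theta> a"
proof -
  have "(\<Sum>c\<in>J. orbit_sum \<theta> c * orbit_sum \<theta> (a - c)) = (\<Sum>c\<in>J. \<Sum>\<mu>\<in>orb. \<Sum>\<nu>\<in>orb. \<nu> a * (\<mu> c / \<nu> c))"
    unfolding orbit_sum_def sum_product
    by (intro sum.cong refl) (simp add: dual_diff[OF orbit_dual a])
  also have "\<dots> = (\<Sum>\<mu>\<in>orb. \<Sum>\<nu>\<in>orb. \<nu> a * (\<Sum>c\<in>J. \<mu> c / \<nu> c))"
    unfolding sum_distrib_left by (rule sum_rotate3)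
  also have "\<dots> = (\<Sum>\<mu>\<in>orb. \<Sum>\<nu>\<in>orb. if \<mu> = \<nu> then \<nu> a * of_nat (card J) else 0)"
    by (intro sum.cong refl) (simp add: dual_orthogonality orbit_dual)
  also have "\<dots> = (\<Sum>\<mu>\<in>orb. \<mu> a * of_nat (card J))"
    using finite_orbit by (intro sum.cong refl) simp
  finally show ?thesis by (simp add: orbit_sum_def sum_distrib_right sum_distrib_left mult.commute)
qed

lemma orbit_class_fun_conj:
  assumes "x \<in> P" "y \<in> P"
  shows "orbit_class_fun \<theta> (y * x * minv y) = orbit_class_fun \<theta> x"
proof -
  have "y * x * minv y - 1 = y * (x - 1) * minv y"
    using assms by (simp add: left_diff_distrib right_diff_distrib minv_right)
  then have "h (y * x * minv y - 1) = y * h (x - 1) * minv y"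
    by (simp only: half_mult_right half_mult_left) (simp flip: half_mult_left half_mult_right)
  then show ?thesis
    using assms by (simp add: orbit_class_fun_def orbit_sum_invariant P_minv P_iff[of x] J_half)
qed

text \<open>Since y^-1 x - 1 = y^-1 ((x - 1) - (y - 1)) and orbit sums ignore the factor y^-1, the
  second argument becomes a difference of halves. Convolution over \<open>P\<close> thus turns into
  additive convolution over \<open>J\<close>.\<close>

lemma orbit_class_fun_convolution:
  assumes x: "x \<in> P"
  shows "(\<Sum>y\<in>P. orbit_class_fun \<theta> y * orbit_class_fun \<theta> (minv y * x)) = of_nat (card P) * orbit_class_fun \<theta> x"
proof -
  define a where "a = h (x - 1)"
  have a: "a \<in> J" using x by (simp add: a_def P_iff J_half)
  have "(\<Sum>y\<in>P. orbit_class_fun \<theta> y * orbit_class_fun \<theta> (minv y * x))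
      = (\<Sum>y\<in>P. orbit_sum \<theta> (h (y - 1)) * orbit_sum \<theta> (a - h (y - 1)))"
  proof (intro sum.cong refl)
    fix y assume y: "y \<in> P"
    have "minv y * x - 1 = minv y * (x - y)" using y by (simp add: right_diff_distrib minv_left)
    also have "x - y = (x - 1) - (y - 1)" by simp
    finally have eq: "h (minv y * x - 1) = minv y * (a - h (y - 1)) * 1"
      by (simp only: half_mult_left half_diff a_def mult_1_right)
    have "a - h (y - 1) \<in> J" using J_diff[OF a J_half[of "y - 1"]] y by (simp add: P_iff)
    then have "orbit_class_fun \<theta> (minv y * x) = orbit_sum \<theta> (a - h (y - 1))"
      unfolding orbit_class_fun_def eq by (rule orbit_sum_invariant[OF _ P_minv[OF y] P_one])
    then show "orbit_class_fun \<theta> y * orbit_class_fun \<theta> (minv y * x) = orbit_sum \<theta> (h (y - 1)) * orbit_sum \<theta> (a - h (y - 1))"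
      by (simp add: orbit_class_fun_def)
  qed
  also have "\<dots> = (\<Sum>b\<in>J. orbit_sum \<theta> (h b) * orbit_sum \<theta> (a - h b))"
    by (simp add: sum_over_P)
  \<comment> \<open>Halving permutes \<open>J\<close>, with doubling as its inverse.\<close>
  also have "\<dots> = (\<Sum>c\<in>J. orbit_sum \<theta> c * orbit_sum \<theta> (a - c))"
    by (rule sum.reindex_bij_witness[of _ "\<lambda>c. c + c" h]) (simp_all add: half_double half_of_double J_half J_add)
  also have "\<dots> = of_nat (card P) * orbit_class_fun \<theta> x"
    unfolding orbit_sum_convolution[OF a] by (simp add: orbit_class_fun_def a_def card_P)
  finally show ?thesis .
qed

lemma orbit_sum_inv_cayley:
  assumes "x \<in> P"
  shows "orbit_sum \<theta> (inv_cayley x) = orbit_class_fun \<theta> x"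
proof -
  have J: "h (x - 1) \<in> J" using assms by (simp add: P_iff J_half)
  then show ?thesis
    using orbit_sum_invariant[OF J P_one P_minv[OF P_one_add[OF J]]]
    by (simp add: inv_cayley_eq[OF assms] orbit_class_fun_def)
qed

text \<open>On \<open>P\<close> the two functions differ by the nonzero factor |P\<lambda>| /
  |P\<lambda>P|, so they have the same irreducible constituents.\<close>

lemma char_inner_supercharacter:
  "char_inner G \<chi> (supercharacter J \<theta>) \<noteq> 0 \<longleftrightarrow> char_inner G \<chi> (orbit_class_fun \<theta>) \<noteq> 0"
proof -
  define k where "k = of_nat (card (left_orbit J \<theta>)) / (of_nat (card orb) :: complex)"
  have "left_orbit J \<theta> = (\<lambda>x. left_act J x \<theta>) ` P" unfolding left_orbit_def carrier_G by auto
  then have "card (left_orbit J \<theta>) > 0" using finite_P P_one by (auto simp: card_gt_0_iff)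
  moreover have "orb \<noteq> {}" unfolding two_sided_orbit_eq using P_one by auto
  then have "card orb > 0" using finite_orbit by (auto simp: card_gt_0_iff)
  ultimately have k: "k \<noteq> 0" by (simp add: k_def)
  have "supercharacter J \<theta> x = k * orbit_class_fun \<theta> x" if "x \<in> P" for x
    using that orbit_sum_inv_cayley[OF that] unfolding supercharacter_def carrier_G orbit_sum_def k_def by simp
  then have "char_inner G \<chi> (supercharacter J \<theta>) = (\<Sum>x\<in>P. cnj k * (\<chi> x * cnj (orbit_class_fun \<theta> x))) / of_nat (card P)"
    unfolding char_inner_def carrier_G by (simp add: mult_ac)
  also have "\<dots> = cnj k * char_inner G \<chi> (orbit_class_fun \<theta>)"
    unfolding char_inner_def carrier_G by (simp add: sum_distrib_left)
  finally show ?thesis using k by simp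
qed

text \<open>For symmetric c, invariance gives \<mu>(c) = \<mu>(c)^-1 and so \<mu>(2c) = 1; every
  symmetric b is such a 2c. Conversely, -\<sigma>(a) differs from a by the symmetric element a +
  \<sigma>(a).\<close>

lemma Omega_eq: "Omega \<sigma> J \<theta> = {\<mu> \<in> orb. \<forall>b\<in>J_plus. \<mu> b = 1}"
proof -
  have "dual_act \<sigma> J \<mu> = \<mu> \<longleftrightarrow> (\<forall>b\<in>J_plus. \<mu> b = 1)" if "\<mu> \<in> orb" for \<mu>
  proof -
    have \<mu>: "\<mu> \<in> dual J" using orbit_dual that .
    show ?thesis
    proof
      assume inv: "dual_act \<sigma> J \<mu> = \<mu>"
      show "\<forall>b\<in>J_plus. \<mu> b = 1"
      proof
        fix b assume b: "b \<in> J_plus"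
        define c where "c = h b"
        have c: "c \<in> J" "\<sigma> c = c" using b by (simp_all add: c_def J_plus_def J_half \<sigma>_half)
        have "\<mu> (- c) = \<mu> c"
          using fun_cong[OF inv, of c] c by (simp add: dual_act_def alg_act_def)
        moreover have "\<mu> (- c) = 1 / \<mu> c" using dual_diff[OF \<mu> J_zero c(1)] dual_zero[OF \<mu>] by simp
        ultimately have "\<mu> c * \<mu> c = 1" using dual_nonzero[OF \<mu> c(1)] by (simp add: field_simps)
        then show "\<mu> b = 1" using dual_add[OF \<mu> c(1) c(1)] by (simp add: c_def half_double)
      qed
    next
      assume triv: "\<forall>b\<in>J_plus. \<mu> b = 1"
      show "dual_act \<sigma> J \<mu> = \<mu>"
      proof
        fix a
        show "dual_act \<sigma> J \<mu> a = \<mu> a"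
        proof (cases "a \<in> J")
          case True
          have "a + \<sigma> a \<in> J_plus" using True by (simp add: J_plus_def J_add \<sigma>_J \<sigma>_add \<sigma>_\<sigma> add.commute)
          then have "\<mu> (a + \<sigma> a) = 1" and J: "a + \<sigma> a \<in> J" using triv by (auto simp: J_plus_def)
          moreover have "- \<sigma> a = a - (a + \<sigma> a)" by simp
          ultimately have "\<mu> (- \<sigma> a) = \<mu> a" using dual_diff[OF \<mu> True J] by simp
          then show ?thesis using True by (simp add: dual_act_def alg_act_def)
        next
          case False
          then show ?thesis using \<mu> by (simp add: dual_act_def dual_def extensional_def)
        qed
      qed
    qed
  qed
  then show ?thesis by (auto simp: Omega_def)
qed

text \<open>The congruence b |-> u b \<sigma>(u) preserves symmetric elements, hence also triviality
  on them.\<close>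

lemma act_Omega:
  assumes "\<mu> \<in> Omega \<sigma> J \<theta>" "u \<in> P"
  shows "act u \<mu> (\<sigma> u) \<in> Omega \<sigma> J \<theta>"
proof -
  have "u * b * \<sigma> u \<in> J_plus" if "b \<in> J_plus" for b
  proof -
    have "\<sigma> (u * b * \<sigma> u) = u * b * \<sigma> u"
      using that by (simp add: J_plus_def \<sigma>_mult \<sigma>_\<sigma> mult.assoc)
    then show ?thesis using that assms(2) by (simp add: J_plus_def P_J_P \<sigma>_P)
  qed
  then show ?thesis
    using assms by (auto simp: Omega_eq act_orbit \<sigma>_P) (simp add: act_def J_plus_def)
qed

lemma Omega_sum_invariant:
  assumes "a \<in> J" "u \<in> P"
  shows "(\<Sum>\<mu>\<in>Omega \<sigma> J \<theta>. \<mu> (u * a * \<sigma> u)) = (\<Sum>\<mu>\<in>Omega \<sigma> J \<theta>. \<mu> a)"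
proof -
  have sub: "\<mu> \<in> orb" if "\<mu> \<in> Omega \<sigma> J \<theta>" for \<mu> using that by (simp add: Omega_def)
  have mv: "minv (\<sigma> u) = \<sigma> (minv u)" using assms by (simp add: \<sigma>_minv)
  show ?thesis
  proof (rule sum.reindex_bij_witness[of _ "\<lambda>\<mu>. act (minv u) \<mu> (\<sigma> (minv u))" "\<lambda>\<mu>. act u \<mu> (\<sigma> u)"])
    fix \<mu> assume \<mu>: "\<mu> \<in> Omega \<sigma> J \<theta>"
    show "act (minv u) (act u \<mu> (\<sigma> u)) (\<sigma> (minv u)) = \<mu>" "act u (act (minv u) \<mu> (\<sigma> (minv u))) (\<sigma> u) = \<mu>"
      using act_inverse[OF sub[OF \<mu>] assms(2) \<sigma>_P[OF assms(2)]] by (simp_all only: mv)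
    show "act u \<mu> (\<sigma> u) \<in> Omega \<sigma> J \<theta>" "act (minv u) \<mu> (\<sigma> (minv u)) \<in> Omega \<sigma> J \<theta>"
      using \<mu> assms P_minv by (simp_all add: act_Omega)
    show "act u \<mu> (\<sigma> u) a = \<mu> (u * a * \<sigma> u)" using assms by (simp add: act_def)
  qed
qed

lemma orbit_sum_plus_translates:
  assumes "a \<in> J"
  shows "(\<Sum>b\<in>J_plus. orbit_sum \<theta> (a + b)) = of_nat (card J_plus) * (\<Sum>\<mu>\<in>Omega \<sigma> J \<theta>. \<mu> a)"
proof -
  have sub: "J_plus \<subseteq> J" by (auto simp: J_plus_def)
  have "(\<Sum>b\<in>J_plus. orbit_sum \<theta> (a + b)) = (\<Sum>b\<in>J_plus. \<Sum>\<mu>\<in>orb. \<mu> a * \<mu> b)"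
    unfolding orbit_sum_def by (intro sum.cong refl dual_add orbit_dual assms subsetD[OF sub])
  also have "\<dots> = (\<Sum>\<mu>\<in>orb. \<mu> a * (\<Sum>b\<in>J_plus. \<mu> b))"
    unfolding sum_distrib_left by (rule sum.swap)
  also have "\<dots> = (\<Sum>\<mu>\<in>orb. if \<forall>b\<in>J_plus. \<mu> b = 1 then \<mu> a * of_nat (card J_plus) else 0)"
  proof (intro sum.cong refl)
    fix \<mu> assume "\<mu> \<in> orb"
    then have "(\<Sum>b\<in>J_plus. \<mu> b) = (if \<forall>b\<in>J_plus. \<mu> b = 1 then of_nat (card J_plus) else 0)"
      by (intro dual_sum orbit_dual sub) (auto simp: J_plus_def J_add J_minus \<sigma>_add \<sigma>_minus)
    then show "\<mu> a * (\<Sum>b\<in>J_plus. \<mu> b) = (if \<forall>b\<in>J_plus. \<mu> b = 1 then \<mu> a * of_nat (card J_plus) else 0)" by simp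
  qed
  also have "\<dots> = (\<Sum>\<mu>\<in>Omega \<sigma> J \<theta>. \<mu> a * of_nat (card J_plus))"
    unfolding Omega_eq using finite_orbit by (simp add: sum.inter_filter)
  finally show ?thesis by (simp add: sum_distrib_left mult.commute)
qed

end

section \<open>Inverse Cayley transforms of fixed points and the twisted sum of the orbit
  function\<close>

lemma inv_cayley_fixed:
  assumes "c \<in> G.fixed"
  defines "a \<equiv> inv_cayley c"
  shows "a \<in> J" "\<sigma> a = - a" "(1 - a) * c = 1 + a"
proof -
  have c: "c \<in> P" "minv (\<sigma> c) = c"
    using assms(1) G.fixedD[OF assms(1)] unfolding carrier_G by (auto simp: group_act_eq)
  have \<sigma>c: "\<sigma> c = minv c" using c \<sigma>_P[OF c(1)] minv_minv by metis
  define b where "b = h (c - 1)"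
  have b: "b \<in> J" using c(1) by (simp add: b_def P_iff J_half)
  have bP: "1 + b \<in> P" using b by (rule P_one_add)
  have ab: "a = b * minv (1 + b)" unfolding a_def b_def by (rule inv_cayley_eq[OF c(1)])
  show J: "a \<in> J" unfolding ab by (rule J_P[OF P_minv[OF bP] b])
  \<comment> \<open>As b = (c - 1)/2, this gives 1 + b = (c + 1)/2; clearing the denominator of a
    leaves a (1 + b) = b.\<close>
  have cb: "c = 1 + b + b" using half_double[of "c - 1"] by (simp add: b_def add.assoc)
  have abb: "a * (1 + b) = b" unfolding ab by (simp add: mult.assoc minv_left[OF bP])
  then have "a + a * b = b" by (simp add: distrib_left)
  then have "a + (a * b + a * b) = b + b - a" by (metis add_diff_cancel_left' diff_add_eq add.assoc add.commute)
  then show eq: "(1 - a) * c = 1 + a"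
    unfolding cb by (simp add: algebra_simps)
  \<comment> \<open>A fixed point satisfies \<sigma>(c) = c^-1, so \<sigma> sends (1 + c)/2 to (1 +
    c^-1)/2, which is c^-1 times (1 + c)/2.\<close>
  have \<sigma>b: "\<sigma> (1 + b) = minv c * (1 + b)"
  proof -
    have "\<sigma> (1 + b) = 1 + h (minv c - 1)" by (simp add: b_def \<sigma>_add \<sigma>_one \<sigma>_half \<sigma>_diff \<sigma>c)
    also have "minv c - 1 = minv c * (1 - c)" using c by (simp add: right_diff_distrib minv_left)
    also have "h \<dots> = minv c * (- b)" unfolding half_mult_left using half_minus[of "c - 1"] by (simp add: b_def)
    also have "1 + minv c * (- b) = minv c * (c - b)" using c by (simp add: right_diff_distrib minv_left)
    also have "c - b = 1 + b" by (simp add: cb)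
    finally show ?thesis .
  qed
  have \<sigma>b': "\<sigma> b = minv c * (- b)"
  proof -
    have "\<sigma> b = \<sigma> (1 + b) - 1" by (simp add: \<sigma>_add \<sigma>_one)
    also have "\<dots> = minv c * ((1 + b) - c)" unfolding \<sigma>b using c by (simp add: right_diff_distrib minv_left)
    also have "(1 + b) - c = - b" by (simp add: cb)
    finally show ?thesis .
  qed
  have "\<sigma> (1 + b) * \<sigma> a = \<sigma> b" using abb by (metis \<sigma>_mult)
  then have "minv c * ((1 + b) * \<sigma> a) = minv c * (- b)" unfolding \<sigma>b \<sigma>b' by (simp add: mult.assoc)
  then have "(1 + b) * \<sigma> a = - b" using c(1) by (metis minv_cancel(2))
  then have "\<sigma> a = minv (1 + b) * (- b)" using minv_cancel(1)[OF bP, of "\<sigma> a"] by simp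
  \<comment> \<open>Applying \<sigma> reversed the factors; \<open>b\<close> commutes with
    \<open>1 + b\<close> and so with its inverse, which brings them back into the order of
    \<open>ab\<close>.\<close>
  moreover have "minv (1 + b) * b = b * minv (1 + b)"
  proof -
    have "minv (1 + b) * b * (1 + b) = minv (1 + b) * ((1 + b) * b)"
      by (simp add: distrib_left distrib_right mult.assoc)
    then have "minv (1 + b) * b * (1 + b) = b" using minv_cancel(1)[OF bP] by simp
    then have "minv (1 + b) * b * ((1 + b) * minv (1 + b)) = b * minv (1 + b)" by (metis mult.assoc)
    then show ?thesis using minv_right[OF bP] by simp
  qed
  ultimately show "\<sigma> a = - a" by (simp add: ab)
qed

text \<open>Inverting both sides turns the condition into \<open>\<sigma> y = y\<close>. This
  identifies the range of x |-> x^\<sigma> x^-1 in \<open>twisted_square_sum\<close>.\<close>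

lemma J_plus_group: "{y \<in> carrier G. group_act \<sigma> y = inv\<^bsub>G\<^esub> y} = (\<lambda>b. 1 + b) ` J_plus"
proof -
  have "minv (\<sigma> y) = minv y \<longleftrightarrow> \<sigma> y = y" if "y \<in> P" for y
    using that minv_minv \<sigma>_P by metis
  then have "{y \<in> carrier G. group_act \<sigma> y = inv\<^bsub>G\<^esub> y} = {y \<in> P. \<sigma> y = y}"
    unfolding carrier_G by (auto simp: group_act_eq inv_G)
  also have "\<dots> = (\<lambda>b. 1 + b) ` J_plus"
    by (auto simp: P_def J_plus_def \<sigma>_add \<sigma>_one)
  finally show ?thesis .
qed

text \<open>With \<open>c = (1 + a) / (1 - a)\<close> and \<open>u = 1 / (1 - a)\<close>, the element \<open>(c (1 + b) - 1) / 2\<close> lies in the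
  same two-sided orbit as \<open>u a \<sigma>(u)\<close> plus a \<open>\<sigma>\<close>-symmetric element, which runs through all of
  \<open>J_plus\<close> together with \<open>b\<close>.\<close>

lemma orbit_class_fun_twisted_sum:
  assumes \<theta>: "\<theta> \<in> dual J" and c: "c \<in> G.fixed"
  shows "(\<Sum>b\<in>J_plus. orbit_class_fun \<theta> (c * (1 + b)))
    = of_nat (card J_plus) * (\<Sum>\<mu>\<in>Omega \<sigma> J \<theta>. \<mu> (inv_cayley c))"
proof -
  define a where "a = inv_cayley c"
  have a: "a \<in> J" "\<sigma> a = - a" "(1 - a) * c = 1 + a"
    using inv_cayley_fixed[OF c] by (simp_all add: a_def)
  define u where "u = minv (1 - a)"
  define v where "v = minv (1 + a)"
  have P: "1 - a \<in> P" "1 + a \<in> P" using a(1) by (simp_all add: P_one_diff P_one_add)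
  have uv: "u \<in> P" "v \<in> P" using P by (simp_all add: u_def v_def P_minv)
  have \<sigma>u: "\<sigma> u = v" using P by (simp add: u_def v_def \<sigma>_minv \<sigma>_diff \<sigma>_one a(2))
  have \<sigma>v: "\<sigma> v = u" using \<sigma>u \<sigma>_\<sigma> by metis
  have u1: "u * (1 - a) = 1" "(1 - a) * u = 1" using P by (simp_all add: u_def minv_left minv_right)
  have v1: "v * (1 + a) = 1" "(1 + a) * v = 1" using P by (simp_all add: v_def minv_left minv_right)
  have ua: "u * a = a * u"
  proof -
    have "u * a = u * (a * (1 - a)) * u" using u1(2) by (simp add: mult.assoc)
    also have "a * (1 - a) = (1 - a) * a" by (simp add: algebra_simps)
    also have "u * ((1 - a) * a) * u = a * u" using u1(1) by (simp add: mult.assoc[symmetric])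
    finally show ?thesis .
  qed
  have va: "v * a = a * v"
  proof -
    have "v * a = v * (a * (1 + a)) * v" using v1(2) by (simp add: mult.assoc)
    also have "a * (1 + a) = (1 + a) * a" by (simp add: algebra_simps)
    also have "v * ((1 + a) * a) * v = a * v" using v1(1) by (simp add: mult.assoc[symmetric])
    finally show ?thesis .
  qed
  have uv_comm: "u * v = v * u"
  proof -
    have "(1 - a) * (1 + a) = (1 + a) * (1 - a)" by (simp add: algebra_simps)
    then have "minv ((1 - a) * (1 + a)) = minv ((1 + a) * (1 - a))" by simp
    then show ?thesis using P by (simp add: minv_mult u_def v_def)
  qed
  \<comment> \<open>Correction term: from 1 = u (1 - a) one gets a v = u a v - u a^2 v. It is
    symmetric, as \<sigma> exchanges \<open>u\<close> and \<open>v\<close> and negates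
    \<open>a\<close>, so the summation over \<open>J_plus\<close> can absorb it.\<close>
  define d where "d = u * a * a * v"
  have d: "d \<in> J_plus"
  proof -
    have "d \<in> J" unfolding d_def using uv a(1) by (intro J_P P_J J_mult) 
    moreover have "\<sigma> d = d" by (simp add: d_def \<sigma>_mult \<sigma>u \<sigma>v a(2) mult.assoc)
    ultimately show ?thesis by (simp add: J_plus_def)
  qed
  have va_eq: "v * a = u * a * v - d"
  proof -
    have "v * a = a * v" by (rule va)
    also have "\<dots> = u * (1 - a) * a * v" using u1(1) by simp
    also have "\<dots> = u * a * v - d" by (simp add: d_def right_diff_distrib left_diff_distrib)
    finally show ?thesis .
  qed
  have summand: "orbit_class_fun \<theta> (c * (1 + b)) = orbit_sum \<theta> (u * a * v + (h b - d))" if b: "b \<in> J_plus" for b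
  proof -
    have bJ: "b \<in> J" using b by (simp add: J_plus_def)
    have cP: "c \<in> P" using G.fixedD(1)[OF c] unfolding carrier_G .
    have J: "h (c * (1 + b) - 1) \<in> J"
      using P_mult[OF cP P_one_add[OF bJ]] by (intro J_half) (simp add: P_iff)
    have "(1 - a) * (c * (1 + b) - 1) = (1 - a) * c * (1 + b) - (1 - a)"
      by (simp only: right_diff_distrib mult.assoc mult_1_right)
    also have "\<dots> = (a + a) + (1 + a) * b"
      unfolding a(3) by (simp add: algebra_simps)
    finally have eq: "(1 - a) * h (c * (1 + b) - 1) = a + (1 + a) * h b"
      by (simp only: half_mult_left[symmetric] half_add half_double)
    \<comment> \<open>Orbit sums do not change under the left factor v (1 - a) from
      \<open>P\<close>. It is chosen to cancel the factor 1 + a in front of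
      \<open>h b\<close>.\<close>
    have "v * (1 - a) * h (c * (1 + b) - 1) = v * a + v * (1 + a) * h b"
      unfolding mult.assoc[of v] eq by (simp only: distrib_left[of v a])
    then have "v * (1 - a) * h (c * (1 + b) - 1) * 1 = u * a * v + (h b - d)"
      by (simp add: v1(1) va_eq)
    then show ?thesis
      unfolding orbit_class_fun_def
      using orbit_sum_invariant[OF \<theta> J P_mult[OF uv(2) P(1)] P_one] by simp
  qed
  have "(\<Sum>b\<in>J_plus. orbit_class_fun \<theta> (c * (1 + b))) = (\<Sum>b\<in>J_plus. orbit_sum \<theta> (u * a * v + (h b - d)))"
    by (intro sum.cong refl summand)
  \<comment> \<open>The map \<open>b \<mapsto> h b - d\<close> permutes \<open>J_plus\<close>; its
    inverse doubles \<open>b + d\<close>.\<close>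
  also have "\<dots> = (\<Sum>b\<in>J_plus. orbit_sum \<theta> (u * a * v + b))"
    by (rule sum.reindex_bij_witness[of _ "\<lambda>b. (b + d) + (b + d)" "\<lambda>b. h b - d"])
      (use d in \<open>auto simp: J_plus_def half_of_double half_double J_half J_add J_diff \<sigma>_add \<sigma>_diff \<sigma>_half\<close>)
  also have "\<dots> = of_nat (card J_plus) * (\<Sum>\<mu>\<in>Omega \<sigma> J \<theta>. \<mu> (u * a * v))"
    by (rule orbit_sum_plus_translates[OF \<theta> P_J_P[OF uv a(1)]])
  \<comment> \<open>As v = \<sigma>(u), the argument is congruent to \<open>a\<close>, and the sum
    over \<open>Omega\<close> is invariant under congruence.\<close>
  also have "(\<Sum>\<mu>\<in>Omega \<sigma> J \<theta>. \<mu> (u * a * v)) = (\<Sum>\<mu>\<in>Omega \<sigma> J \<theta>. \<mu> a)"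
    using Omega_sum_invariant[OF \<theta> a(1) uv(1)] by (simp only: \<sigma>u)
  finally show ?thesis by (simp add: a_def)
qed

section \<open>The character formula and constancy on superclasses\<close>

theorem sigma_character_eq:
  assumes \<theta>: "\<theta> \<in> dual J" and c: "c \<in> carrier (fixed_group \<sigma> J)"
  shows "sigma_character \<sigma> J \<theta> c = (\<Sum>\<mu>\<in>Omega \<sigma> J \<theta>. \<mu> (inv_cayley c))"
proof -
  let ?f = "orbit_class_fun \<theta>"
  have cf: "c \<in> G.fixed" using c by (simp add: fixed_group_eq)
  have cls: "?f (y \<otimes>\<^bsub>G\<^esub> x \<otimes>\<^bsub>G\<^esub> inv\<^bsub>G\<^esub> y) = ?f x" if "x \<in> carrier G" "y \<in> carrier G" for x y
    using that orbit_class_fun_conj[OF \<theta>] unfolding carrier_G by (simp add: inv_G)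
  have idem: "(\<Sum>y\<in>carrier G. ?f y * ?f (inv\<^bsub>G\<^esub> y \<otimes>\<^bsub>G\<^esub> x)) = of_nat (card (carrier G)) * ?f x"
    if "x \<in> carrier G" for x
    using that orbit_class_fun_convolution[OF \<theta>] unfolding carrier_G by (simp add: inv_G)
  have inj: "inj_on (\<lambda>b. 1 + b) J_plus" by (simp add: inj_on_def)
  have sq: "(\<Sum>x\<in>P. F (group_act \<sigma> x * minv x)) = of_nat (card G.fixed) * (\<Sum>b\<in>J_plus. F (1 + b))"
    for F :: "'a \<Rightarrow> complex"
    using G.twisted_square_sum[of F, unfolded J_plus_group sum.reindex[OF inj]] unfolding carrier_G
    by (simp add: inv_G)
  \<comment> \<open>Counting with the constant function 1 gives |P| = |C_P(\<sigma>)| |J_plus|,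
    exactly the factor produced by the two summations below.\<close>
  have card: "of_nat (card P) = (of_nat (card G.fixed) * of_nat (card J_plus) :: complex)"
    using sq[of "\<lambda>_. 1"] by simp
  have set: "glauberman_constituents \<sigma> J \<theta>
      = glauberman G.C ` {\<chi> \<in> Irr G. G.invariant \<chi> \<and> char_inner G \<chi> ?f \<noteq> 0}"
    unfolding glauberman_constituents_def invariant_Irr_def G.invariant_def fixed_group_eq
    by (auto simp: char_inner_supercharacter[OF \<theta>])
  have "sigma_character \<sigma> J \<theta> c
      = (\<Sum>\<psi>\<in>glauberman G.C ` {\<chi> \<in> Irr G. G.invariant \<chi> \<and> char_inner G \<chi> ?f \<noteq> 0}. \<psi> 1 * \<psi> c)"
    using c by (simp add: sigma_character_def set)
  then have "of_nat (card P) * sigma_character \<sigma> J \<theta> c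
      = (\<Sum>x\<in>carrier G. ?f (c \<otimes>\<^bsub>G\<^esub> group_act \<sigma> x \<otimes>\<^bsub>G\<^esub> inv\<^bsub>G\<^esub> x))"
    using G.glauberman_sum[of ?f, OF cls idem cf] by (simp only: carrier_G algebra_group_simps(3))
  also have "\<dots> = (\<Sum>x\<in>P. ?f (c * (group_act \<sigma> x * minv x)))"
    unfolding carrier_G by (intro sum.cong refl) (simp add: inv_G mult.assoc)
  also have "\<dots> = of_nat (card G.fixed) * (\<Sum>b\<in>J_plus. ?f (c * (1 + b)))"
    by (rule sq)
  also have "\<dots> = of_nat (card P) * (\<Sum>\<mu>\<in>Omega \<sigma> J \<theta>. \<mu> (inv_cayley c))"
    unfolding orbit_class_fun_twisted_sum[OF \<theta> cf] card by (simp only: mult.assoc)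
  finally show ?thesis using finite_P P_one by (auto simp: card_gt_0_iff)
qed

text \<open>Skewness of both elements gives w a = a \<sigma>(w) for w = \<sigma>(y)^-1 x. The square
  root v of w is a power of w, so v a = a \<sigma>(v) as well, and z = \<sigma>(y) v succeeds
  because v a \<sigma>(v) = v v a = w a.\<close>

lemma skew_orbit_conjugate:
  assumes a: "a \<in> J" "\<sigma> a = - a" and b: "b = x * a * y" "\<sigma> b = - b" and xy: "x \<in> P" "y \<in> P"
  obtains z where "z \<in> P" "b = z * a * \<sigma> z"
proof -
  define w where "w = minv (\<sigma> y) * x"
  have w: "w \<in> P" using xy by (simp add: w_def P_mult P_minv \<sigma>_P)
  have "x * a * y = \<sigma> y * a * \<sigma> x"
    using b arg_cong[OF b(1), of \<sigma>] a(2) by (simp add: \<sigma>_mult mult.assoc)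
  then have "minv (\<sigma> y) * (x * a * y) * minv y = minv (\<sigma> y) * (\<sigma> y * a * \<sigma> x) * minv y" by simp
  then have wa: "w * a = a * \<sigma> w"
    using xy by (simp add: w_def mult.assoc minv_cancel \<sigma>_P minv_right \<sigma>_mult \<sigma>_minv \<sigma>_\<sigma>)
  have pow: "w ^ k * a = a * \<sigma> w ^ k" for k
  proof (induction k)
    case (Suc k)
    have "w ^ Suc k * a = w ^ k * (w * a)" by (simp only: power_Suc2 mult.assoc)
    also have "\<dots> = w ^ k * a * \<sigma> w" by (simp only: wa mult.assoc)
    also have "\<dots> = a * \<sigma> w ^ Suc k" by (simp only: Suc mult.assoc power_Suc2)
    finally show ?case .
  qed simp
  have \<sigma>_pow: "\<sigma> (w ^ k) = \<sigma> w ^ k" for k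
    by (induction k) (simp_all add: \<sigma>_one \<sigma>_mult power_commutes)
  have powP: "w ^ k \<in> P" for k by (induction k) (simp_all add: P_one P_mult w)
  define k where "k = (card (carrier G) + 1) div 2"
  have "w [^]\<^bsub>G\<^esub> n = w ^ n" for n :: nat
    by (induction n) (simp_all add: G.nat_pow_Suc power_commutes)
  then have "w ^ (2 * k) = w" using G.square_root_power[of w] w unfolding carrier_G k_def by simp
  then have vv: "w ^ k * w ^ k = w" by (simp add: mult_2 power_add)
  define z where "z = \<sigma> y * w ^ k"
  have "z * a * \<sigma> z = \<sigma> y * (w ^ k * a * \<sigma> w ^ k) * y"
    by (simp add: z_def \<sigma>_mult \<sigma>_\<sigma> \<sigma>_pow mult.assoc)
  also have "w ^ k * a * \<sigma> w ^ k = w * a"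
    by (simp only: pow[symmetric] mult.assoc) (simp only: pow[symmetric] mult.assoc[symmetric] vv)
  also have "\<sigma> y * (w * a) * y = b"
    using xy by (simp add: b(1) w_def mult.assoc minv_cancel \<sigma>_P)
  finally show thesis using that[of z] xy powP by (simp add: z_def P_mult \<sigma>_P)
qed

text \<open>The elements Psi(x) for x in \<open>K\<close> are skew and lie in one two-sided orbit,
  that of half of the representative \<open>g\<close>. They are therefore congruent under a |-> z a
  \<sigma>(z), which leaves the sum over \<open>Omega\<close> unchanged.\<close>

theorem sigma_character_superclass:
  assumes \<theta>: "\<theta> \<in> dual J" and K: "K \<in> fixed_superclasses \<sigma> J"
  shows "\<exists>k. \<forall>x\<in>K. sigma_character \<sigma> J \<theta> x = k"
proof -
  from K obtain g where g: "g \<in> J"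
    and Kg: "K = {1 + x * g * y | x y. x \<in> P \<and> y \<in> P} \<inter> carrier (fixed_group \<sigma> J)" and "K \<noteq> {}"
    unfolding fixed_superclasses_def superclasses_def carrier_G by auto
  then obtain x0 where x0: "x0 \<in> K" by blast
  \<comment> \<open>For x = 1 + p g q the half of x - 1 is p h(g) q, and passing to Psi(x)
    multiplies it on the right by an element of \<open>P\<close>.\<close>
  have form: "\<exists>u v. u \<in> P \<and> v \<in> P \<and> inv_cayley x = u * h g * v" if x: "x \<in> K" for x
  proof -
    obtain p q where pq: "p \<in> P" "q \<in> P" "x = 1 + p * g * q" using x Kg by auto
    have xP: "x \<in> P" using pq g by (simp add: P_iff P_J_P)
    have "inv_cayley x = p * h g * q * minv (1 + h (x - 1))"
      unfolding inv_cayley_eq[OF xP] using pq(3) by (simp add: half_mult_left half_mult_right mult.assoc flip: half_mult_left half_mult_right)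
    moreover have "minv (1 + h (x - 1)) \<in> P" using xP by (intro P_minv P_one_add J_half) (simp add: P_iff)
    ultimately show ?thesis using pq P_mult by (metis mult.assoc)
  qed
  obtain u v where uv: "u \<in> P" "v \<in> P" "inv_cayley x0 = u * h g * v" using form[OF x0] by blast
  have fx: "x \<in> carrier (fixed_group \<sigma> J)" if "x \<in> K" for x using that Kg by simp
  have skew: "inv_cayley x \<in> J" "\<sigma> (inv_cayley x) = - inv_cayley x" if "x \<in> K" for x
    using inv_cayley_fixed[of x] fx[OF that] by (simp_all add: fixed_group_eq)
  have "sigma_character \<sigma> J \<theta> x = sigma_character \<sigma> J \<theta> x0" if x: "x \<in> K" for x
  proof -
    obtain p q where pq: "p \<in> P" "q \<in> P" "inv_cayley x = p * h g * q" using form[OF x] by blast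
    have hg: "h g = minv u * inv_cayley x0 * minv v"
      using uv by (simp add: mult.assoc minv_cancel minv_right)
    have "inv_cayley x = (p * minv u) * inv_cayley x0 * (minv v * q)"
      unfolding pq(3) hg by (simp only: mult.assoc)
    then obtain z where z: "z \<in> P" "inv_cayley x = z * inv_cayley x0 * \<sigma> z"
      using skew_orbit_conjugate[OF skew[OF x0] _ skew(2)[OF x]] uv pq P_mult P_minv by metis
    show ?thesis
      unfolding sigma_character_eq[OF \<theta> fx[OF x]] sigma_character_eq[OF \<theta> fx[OF x0]] z(2)
      by (rule Omega_sum_invariant[OF \<theta> skew(1)[OF x0] z(1)])
  qed
  then show ?thesis by blast
qed

end

section \<open>Return to algebras over a finite field of odd characteristic\<close>

context involutive_algebra
begin

text \<open>Otherwise the odd characteristic would divide 2 and so be 1, but 1 is not 0 in a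
  field.\<close>

lemma two_neq_zero: "(2 :: 'k) \<noteq> 0"
proof
  assume "(2 :: 'k) = 0"
  then have "of_nat 2 = (0 :: 'k)" by simp
  then have "CHAR('k) dvd 2" by (simp only: of_nat_eq_0_iff_char_dvd)
  then have "CHAR('k) = 1" using odd_char prime_nat_iff two_is_prime_nat by (metis even_numeral)
  then have "CHAR('k) dvd 1" by simp
  then have "of_nat 1 = (0 :: 'k)" by (simp only: of_nat_eq_0_iff_char_dvd)
  then show False by simp
qed

text \<open>Every element is a combination of a finite spanning set, and there are finitely many
  coefficient functions with values in the finite field. This makes \<open>P\<close> a finite
  group.\<close>

lemma finite_algebra: "finite (UNIV :: 'a set)"
proof -
  obtain B where B: "finite B" "span B = UNIV" using finite_dim by blast
  have "x \<in> (\<lambda>u. \<Sum>v\<in>B. scale (u v) v) ` (B \<rightarrow>\<^sub>E UNIV)" for x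
  proof -
    have "x \<in> span B" using B by simp
    then obtain u where "x = (\<Sum>v\<in>B. scale (u v) v)" unfolding span_finite[OF B(1)] by blast
    then show ?thesis by (intro image_eqI[of _ _ "restrict u B"]) auto
  qed
  then have "(UNIV :: 'a set) \<subseteq> (\<lambda>u. \<Sum>v\<in>B. scale (u v) v) ` (B \<rightarrow>\<^sub>E UNIV)" by blast
  moreover have "finite (B \<rightarrow>\<^sub>E (UNIV :: 'k set))" using B(1) by (intro finite_PiE) auto
  ultimately show ?thesis by (meson finite_imageI finite_subset)
qed

lemma nilpotent_involution_ring:
  assumes J: "nilpotent_subalgebra scale J" "\<sigma> ` J \<subseteq> J"
  shows "nilpotent_involution_ring \<sigma> J (scale (inverse 2))"
proof
  have sub: "subspace J" using J(1) by (simp add: nilpotent_subalgebra_def)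
  show "finite J" by (rule finite_subset[OF subset_UNIV finite_algebra])
  show "0 \<in> J" using subspace_0[OF sub] .
  fix a b
  show "a + b \<in> J" if "a \<in> J" "b \<in> J" using subspace_add[OF sub that] .
  show "- a \<in> J" if "a \<in> J" using subspace_neg[OF sub that] .
  show "a * b \<in> J" if "a \<in> J" "b \<in> J" using J(1) that by (simp add: nilpotent_subalgebra_def)
  show "scale (inverse 2) a \<in> J" if "a \<in> J" using subspace_scale[OF sub that] .
  \<comment> \<open>Nilpotency of the subalgebra concerns products of arbitrary lists; the list with
    all entries equal to \<open>a\<close> gives the power.\<close>
  show "\<exists>n>0. a ^ n = 0" if a: "a \<in> J"
  proof -
    obtain n where n: "n > 0" "\<And>as. length as = n \<Longrightarrow> set as \<subseteq> J \<Longrightarrow> prod_list as = 0"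
      using J(1) unfolding nilpotent_subalgebra_def by blast
    have "prod_list (replicate m a) = a ^ m" for m by (induction m) simp_all
    then show ?thesis using n(1) n(2)[of "replicate n a"] a by auto
  qed
  have half: "scale (inverse 2) x + scale (inverse 2) x = x" for x
  proof -
    have "inverse 2 + inverse 2 = (1 :: 'k)"
      using two_neq_zero by (metis mult_2 right_inverse)
    then show ?thesis by (simp flip: scale_left_distrib)
  qed
  then show "scale (inverse 2) a + scale (inverse 2) a = a" .
  show "a = b" if "a + a = b + b"
    using half[of a] half[of b] that by (metis scale_right_distrib)
  show "\<sigma> (a + b) = \<sigma> a + \<sigma> b" "\<sigma> (a * b) = \<sigma> b * \<sigma> a" "\<sigma> (\<sigma> a) = a"
    by (rule involution_add involution_mult involution_involution)+
  show "\<sigma> a \<in> J" if "a \<in> J" using J(2) that by blast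
qed

end

theorem theorem3p8:
  fixes scale :: "'k::{field,finite} \<Rightarrow> 'a::ring_1 \<Rightarrow> 'a"
    and \<sigma> :: "'a \<Rightarrow> 'a" and J :: "'a set" and \<theta> :: "'a \<Rightarrow> complex"
  assumes "involutive_algebra scale \<sigma>"
    and "nilpotent_subalgebra scale J"
    and "\<sigma> ` J \<subseteq> J"
    and "\<theta> \<in> fixed_dual \<sigma> J"
  shows "(\<forall>x\<in>carrier (fixed_group \<sigma> J).
            sigma_character \<sigma> J \<theta> x = (\<Sum>\<mu>\<in>Omega \<sigma> J \<theta>. \<mu> (inv_cayley x)))
       \<and> (\<forall>K\<in>fixed_superclasses \<sigma> J. \<exists>c. \<forall>x\<in>K. sigma_character \<sigma> J \<theta> x = c)"
proof -
  interpret nilpotent_involution_ring \<sigma> J "scale (inverse 2)"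
    using involutive_algebra.nilpotent_involution_ring assms(1-3) by blast
  have "\<theta> \<in> dual J" using assms(4) by (simp add: fixed_dual_def)
  then show ?thesis by (simp add: sigma_character_eq sigma_character_superclass)
qed

end
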